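(* There is an algorithm which, given a non-degenerate financial network $\mathcal{F}=(N\cup\{\mathcal{CCD}\},e,c)$ with rational data satisfying the central CDS debtor property, computes an exact clearing recovery rate vector of $\mathcal{F}$ (under proportional payments) in exponential time.
   Context: A financial network consists of banks, external assets $e_i\in\mathbb{Q}_{\ge0}$, debt contracts with notionals $c_{i,j}\ge0$ (debtor $i$, creditor $j$) and CDSes with notionals $c^k_{i,j}\ge0$ (debtor $i$, creditor $j$, reference bank $k$, all distinct). For recovery rates $r$: liability $l_{i,j}(r)=c_{i,j}+\sum_k(1-r_k)c^k_{i,j}$, $l_i(r)=\sum_jl_{i,j}(r)$, payment $p_{i,j}(r)=r_il_{i,j}(r)$, assets $a_i(r)=e_i+\sum_jp_{j,i}(r)$. A clearing recovery rate vector satisfies $r_i=\min\{1,a_i(r)/l_i(r)\}$ if $l_i(r)>0$ and $r_i=1$ if $l_i(r)=0$, for all banks $i$. Non-degenerate: every reference bank is the debtor of some debt contract and every CDS debtor has positive external assets or is the debtor of some debt contract. Central CDS debtor property: a single bank $\mathcal{CCD}$ is the debtor of every CDS with nonzero notional, $\mathcal{CCD}$ is the debtor of no debt contract, and $e_{\mathcal{CCD}}\ge\sum_{j,R}c^R_{\mathcal{CCD},j}$. *)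

theory Defs
  imports Complex_Main "HOL-Library.Log_Nat" "HOL-Computational_Algebra.Polynomial"
begin

section \<open>Financial networks with debts and credit default swaps\<close>

text \<open>The banks of a network are the numbers below \<open>banks\<close>; the values of the other fields
  at larger arguments are irrelevant.  A notional of zero means that the contract is absent.\<close>

record network =
  banks :: nat
  ext :: "nat \<Rightarrow> rat"                        \<comment> \<open>external assets\<close>
  debt :: "nat \<Rightarrow> nat \<Rightarrow> rat"                \<comment> \<open>debtor, creditor\<close>
  cds :: "nat \<Rightarrow> nat \<Rightarrow> nat \<Rightarrow> rat"          \<comment> \<open>debtor, creditor, reference bank\<close>

definition financial_network :: "network \<Rightarrow> bool" where
  "financial_network F \<longleftrightarrow>
     (\<forall>i<banks F. ext F i \<ge> 0) \<and>
     (\<forall>i<banks F. \<forall>j<banks F. debt F i j \<ge> 0) \<and>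
     (\<forall>i<banks F. \<forall>j<banks F. \<forall>k<banks F. cds F i j k \<ge> 0) \<and>
     (\<forall>i<banks F. \<forall>j<banks F. \<forall>k<banks F.
        cds F i j k \<noteq> 0 \<longrightarrow> i \<noteq> j \<and> i \<noteq> k \<and> j \<noteq> k)"

definition liability :: "network \<Rightarrow> (nat \<Rightarrow> real) \<Rightarrow> nat \<Rightarrow> nat \<Rightarrow> real" where
  "liability F r i j = of_rat (debt F i j) + (\<Sum>k<banks F. (1 - r k) * of_rat (cds F i j k))"

definition total_liability :: "network \<Rightarrow> (nat \<Rightarrow> real) \<Rightarrow> nat \<Rightarrow> real" where
  "total_liability F r i = (\<Sum>j<banks F. liability F r i j)"

definition payment :: "network \<Rightarrow> (nat \<Rightarrow> real) \<Rightarrow> nat \<Rightarrow> nat \<Rightarrow> real" where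
  "payment F r i j = r i * liability F r i j"

definition assets :: "network \<Rightarrow> (nat \<Rightarrow> real) \<Rightarrow> nat \<Rightarrow> real" where
  "assets F r i = of_rat (ext F i) + (\<Sum>j<banks F. payment F r j i)"

definition clearing :: "network \<Rightarrow> (nat \<Rightarrow> real) \<Rightarrow> bool" where
  "clearing F r \<longleftrightarrow>
     (\<forall>i<banks F. 0 \<le> r i \<and> r i \<le> 1 \<and>
        (total_liability F r i > 0 \<longrightarrow>
           r i = min 1 (assets F r i / total_liability F r i)) \<and>
        (total_liability F r i = 0 \<longrightarrow> r i = 1))"

definition debt_debtor :: "network \<Rightarrow> nat \<Rightarrow> bool" where
  "debt_debtor F i \<longleftrightarrow> (\<exists>j<banks F. debt F i j > 0)"

definition nondegenerate :: "network \<Rightarrow> bool" where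
  "nondegenerate F \<longleftrightarrow>
     (\<forall>i<banks F. \<forall>j<banks F. \<forall>k<banks F. cds F i j k > 0 \<longrightarrow>
        debt_debtor F k \<and> (ext F i > 0 \<or> debt_debtor F i))"

definition central_cds_debtor :: "network \<Rightarrow> bool" where
  "central_cds_debtor F \<longleftrightarrow>
     (\<exists>d<banks F.
        (\<forall>i<banks F. \<forall>j<banks F. \<forall>k<banks F. cds F i j k \<noteq> 0 \<longrightarrow> i = d) \<and>
        \<not> debt_debtor F d \<and>
        ext F d \<ge> (\<Sum>j<banks F. \<Sum>k<banks F. cds F d j k))"


section \<open>Random access machines with logarithmic cost\<close>

text \<open>Programs of the random access machine of Aho, Hopcroft and Ullman, with structured
  control flow instead of jumps: a memory of registers holding natural numbers, indirect
  addressing, an input tape read from left to right and an output tape.  Time is measured by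
  the logarithmic cost criterion (every number that takes part in an operation, addresses
  included, is charged its binary length), so that this model and multitape Turing machines
  simulate each other with polynomial overhead.\<close>

definition bit_length :: "nat \<Rightarrow> nat" where
  "bit_length n = max 1 (floorlog 2 n)"

text \<open>Subtraction is truncated at zero, division is integer division, with \<open>x div 0 = 0\<close>.\<close>

datatype expr =
    Const nat
  | Load expr
  | Plus expr expr
  | Minus expr expr
  | Times expr expr
  | Div expr expr

fun val :: "(nat \<Rightarrow> nat) \<Rightarrow> expr \<Rightarrow> nat" where
  "val m (Const n) = n"
| "val m (Load a) = m (val m a)"
| "val m (Plus a b) = val m a + val m b"
| "val m (Minus a b) = val m a - val m b"
| "val m (Times a b) = val m a * val m b"
| "val m (Div a b) = val m a div val m b"

text \<open>The cost of an expression covers the operations in it and the length of its value.\<close>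

fun cost :: "(nat \<Rightarrow> nat) \<Rightarrow> expr \<Rightarrow> nat" where
  "cost m (Const n) = bit_length n"
| "cost m (Load a) = cost m a + bit_length (val m (Load a))"
| "cost m (Plus a b) = cost m a + cost m b + bit_length (val m (Plus a b))"
| "cost m (Minus a b) = cost m a + cost m b + bit_length (val m (Minus a b))"
| "cost m (Times a b) = cost m a + cost m b + bit_length (val m (Times a b))"
| "cost m (Div a b) = cost m a + cost m b + bit_length (val m (Div a b))"

datatype prog =
    Skip
  | Read expr
  | Write expr
  | Store expr expr
  | Seq prog prog
  | Cond expr prog prog
  | Loop expr prog

text \<open>A state consists of the memory, the unread part of the input and the output so far.
  Reading beyond the end of the input yields 0.\<close>

type_synonym state = "(nat \<Rightarrow> nat) \<times> nat list \<times> nat list"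

definition next_input :: "nat list \<Rightarrow> nat" where
  "next_input xs = (case xs of [] \<Rightarrow> 0 | x # _ \<Rightarrow> x)"

text \<open>\<open>exec P s t s'\<close>: started in state \<open>s\<close>, program \<open>P\<close> halts after time \<open>t\<close> in state \<open>s'\<close>.\<close>

inductive exec :: "prog \<Rightarrow> state \<Rightarrow> nat \<Rightarrow> state \<Rightarrow> bool" where
  Skip: "exec Skip s 1 s"
| Read: "exec (Read a) (m, xs, ys) (1 + cost m a + bit_length (next_input xs))
           (m(val m a := next_input xs), tl xs, ys)"
| Write: "exec (Write a) (m, xs, ys) (1 + cost m a) (m, xs, ys @ [val m a])"
| Store: "exec (Store a b) (m, xs, ys) (1 + cost m a + cost m b) (m(val m a := val m b), xs, ys)"
| Seq: "exec P s t s' \<Longrightarrow> exec Q s' t' s'' \<Longrightarrow> exec (Seq P Q) s (t + t') s''"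
| CondTrue: "val (fst s) b \<noteq> 0 \<Longrightarrow> exec P s t s' \<Longrightarrow>
    exec (Cond b P Q) s (1 + cost (fst s) b + t) s'"
| CondFalse: "val (fst s) b = 0 \<Longrightarrow> exec Q s t s' \<Longrightarrow>
    exec (Cond b P Q) s (1 + cost (fst s) b + t) s'"
| LoopTrue: "val (fst s) b \<noteq> 0 \<Longrightarrow> exec P s t s' \<Longrightarrow> exec (Loop b P) s' t' s'' \<Longrightarrow>
    exec (Loop b P) s (1 + cost (fst s) b + t + t') s''"
| LoopFalse: "val (fst s) b = 0 \<Longrightarrow> exec (Loop b P) s (1 + cost (fst s) b) s"

inductive_cases exec_elims:
  "exec Skip s t s'"
  "exec (Read a) s t s'"
  "exec (Write a) s t s'"
  "exec (Store a b) s t s'"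
  "exec (Seq P Q) s t s'"
  "exec (Cond b P Q) s t s'"
  "exec (Loop b P) s t s'"

lemma exec_deterministic:
  "exec P s t s' \<Longrightarrow> exec P s u s'' \<Longrightarrow> u = t \<and> s'' = s'"
proof (induction arbitrary: u s'' rule: exec.induct)
  case (Skip s)
  then show ?case by (rule exec_elims(1)) simp
next
  case (Read a m xs ys)
  then show ?case by (rule exec_elims(2)) simp
next
  case (Write a m xs ys)
  then show ?case by (rule exec_elims(3)) simp
next
  case (Store a b m xs ys)
  then show ?case by (rule exec_elims(4)) simp
next
  case (Seq P s t s' Q t' s3)
  from Seq.prems show ?case
  proof (rule exec_elims(5))
    fix v r v' assume "u = v + v'" "exec P s v r" "exec Q r v' s''"
    with Seq.IH(1)[of v r] Seq.IH(2)[of v' s''] show ?thesis by simp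
  qed
next
  case (CondTrue s b P t s' Q)
  from CondTrue.prems show ?case
  proof (rule exec_elims(6))
    fix v assume "0 < val (fst s) b" "u = Suc (cost (fst s) b + v)" "exec P s v s''"
    with CondTrue.IH[of v s''] show ?thesis by simp
  qed (use CondTrue.hyps in simp)
next
  case (CondFalse s b Q t s' P)
  from CondFalse.prems show ?case
  proof (rule exec_elims(6))
    fix v assume "val (fst s) b = 0" "u = Suc (cost (fst s) b + v)" "exec Q s v s''"
    with CondFalse.IH[of v s''] show ?thesis by simp
  qed (use CondFalse.hyps in simp)
next
  case (LoopTrue s b P t s' t' s3)
  from LoopTrue.prems show ?case
  proof (rule exec_elims(7))
    fix v r v'
    assume "0 < val (fst s) b" "u = Suc (cost (fst s) b + v + v')" "exec P s v r" "exec (Loop b P) r v' s''"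
    with LoopTrue.IH(1)[of v r] LoopTrue.IH(2)[of v' s''] show ?thesis by simp
  qed (use LoopTrue.hyps in simp)
next
  case (LoopFalse s b P)
  from LoopFalse.prems show ?case
    by (rule exec_elims(7)) (use LoopFalse.hyps in simp_all)
qed

definition runs :: "prog \<Rightarrow> nat list \<Rightarrow> nat \<Rightarrow> nat list \<Rightarrow> bool" where
  "runs P xs t ys \<longleftrightarrow> (\<exists>m xs'. exec P (\<lambda>_. 0, xs, []) t (m, xs', ys))"


section \<open>Inputs and outputs\<close>

text \<open>Only used for nonnegative rationals: numerator and denominator in lowest terms.\<close>

definition encode_rat :: "rat \<Rightarrow> nat list" where
  "encode_rat q = [nat (fst (quotient_of q)), nat (snd (quotient_of q))]"

definition encode_network :: "network \<Rightarrow> nat list" where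
  "encode_network F =
     (let B = [0..<banks F] in
        banks F #
        concat [encode_rat (ext F i). i \<leftarrow> B] @
        concat [encode_rat (debt F i j). i \<leftarrow> B, j \<leftarrow> B] @
        concat [encode_rat (cds F i j k). i \<leftarrow> B, j \<leftarrow> B, k \<leftarrow> B])"

definition input_size :: "nat list \<Rightarrow> nat" where
  "input_size xs = (\<Sum>x\<leftarrow>xs. bit_length x)"

text \<open>The output lists numerator and denominator, not necessarily in lowest terms, of the
  recovery rate of each bank.\<close>

definition outputs_clearing :: "network \<Rightarrow> nat list \<Rightarrow> bool" where
  "outputs_clearing F ys \<longleftrightarrow>
     length ys = 2 * banks F \<and>
     (\<forall>i<banks F. ys ! (2 * i + 1) > 0) \<and>
     clearing F (\<lambda>i. real (ys ! (2 * i)) / real (ys ! (2 * i + 1)))"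

end

theory Submission
  imports Defs "HOL-Analysis.Brouwer_Fixpoint" "Jordan_Normal_Form.Determinant"
begin

text \<open>The central CDS debtor can always pay all its CDSs, so its recovery rate is 1, and the clearing
  conditions of the other banks read \<open>l i * r i = min (l i) (a r i)\<close> with constant liabilities \<open>l\<close>
  and affine assets \<open>a\<close>.  Brouwer's theorem yields a real solution.  The solutions with the same
  set of fully paying banks form a nonempty polytope with rational data.  A point of it that makes
  as many constraints as possible tight is determined by the tight ones, so by Cramer's rule its
  coordinates have a common denominator of polynomial length.  Hence exhaustive search over the
  common denominators \<open>D = 1, 2, \<dots>\<close> and the numerators in \<open>{0..D}\<close> meets a clearing vector
  after exponentially many candidates, of which each is checked in integer arithmetic.\<close>

subsection \<open>Brouwer's theorem in coordinates\<close>

text \<open>The obstacle is the product \<open>r j * (1 - r k)\<close> in the CDS payments: in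
  general it makes clearing a quadratic problem, whose solutions may be irrational. The central
  debtor confines these products to one \<open>j\<close>, with \<open>r j = 1\<close>. Existence and
  search are kept apart. The program knows neither the central debtor nor the set of fully paying
  banks nor the bound on the denominator. It tests the unreduced quadratic clearing conditions on
  each candidate, so whatever it outputs is correct, and the existence argument only bounds the
  moment at which it stops. The cubic exponent arises as follows. With \<open>s\<close> the input
  size, a determinant of order \<open>n \<le> s\<close> whose entries have O(s) bits has O(s^2)
  bits, and choosing \<open>n\<close> numerators up to such a denominator leaves 2^O(s^3)
  possibilities. All other costs are polynomial in that number.\<close>

lemma subsequence_convergent_coordinates:
  fixes z :: "nat \<Rightarrow> nat \<Rightarrow> real"
  assumes "\<And>p i. i < n \<Longrightarrow> z p i \<in> {0..1}"
  shows "\<exists>l h. strict_mono h \<and> (\<forall>i<n. (\<lambda>p. z (h p) i) \<longlonglongrightarrow> l i)"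
proof -
  have "\<forall>\<delta>\<subseteq>{..<n}. \<exists>l::nat \<Rightarrow> real. \<exists>h::nat\<Rightarrow>nat. strict_mono h \<and>
      (\<forall>e>0. eventually (\<lambda>p. \<forall>i\<in>\<delta>. dist (z (h p) i) (l i) < e) sequentially)"
  proof (rule compact_lemma_general[where unproj = "\<lambda>x. x"])
    fix i assume "i \<in> {..<n}"
    then have "(\<lambda>x. x i) ` range z \<subseteq> {0..1}"
      using assms by auto
    then show "bounded ((\<lambda>x. x i) ` range z)"
      by (rule bounded_subset[OF compact_imp_bounded[OF compact_Icc]])
  qed auto
  then obtain l :: "nat \<Rightarrow> real" and h where h: "strict_mono h"
    and l: "\<And>e. e > 0 \<Longrightarrow> eventually (\<lambda>p. \<forall>i\<in>{..<n}. dist (z (h p) i) (l i) < e) sequentially"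
    by blast
  have "(\<lambda>p. z (h p) i) \<longlonglongrightarrow> l i" if "i < n" for i
    by (rule tendstoI, drule l, erule eventually_mono) (use that in simp)
  with h show ?thesis by blast
qed

text \<open>The dimension \<open>n\<close> is the number of banks, a variable, so points are
  functions on \<open>{..<n}\<close> and continuity is sequential in the coordinates. On the grid of
  mesh \<open>1 / (p + 1)\<close> each point gets, per coordinate, a label for the sign of
  \<open>f x i - x i\<close>. Kuhn's combinatorial lemma supplies a cell in which both labels occur
  for every \<open>i\<close>, and a limit of such cells is a fixed point.\<close>

lemma brouwer_unit_cube_coordinates:
  fixes f :: "(nat \<Rightarrow> real) \<Rightarrow> nat \<Rightarrow> real"
  assumes range: "\<And>x i. \<forall>j<n. x j \<in> {0..1} \<Longrightarrow> i < n \<Longrightarrow> f x i \<in> {0..1}"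
    and cont: "\<And>x z i. i < n \<Longrightarrow> \<forall>j<n. (\<lambda>p. x p j) \<longlonglongrightarrow> z j \<Longrightarrow> (\<lambda>p. f (x p) i) \<longlonglongrightarrow> f z i"
  shows "\<exists>x. (\<forall>i<n. x i \<in> {0..1}) \<and> (\<forall>i<n. f x i = x i)"
proof -
  define sc where "sc p q = (\<lambda>i::nat. real (q i) / real (Suc p))" for p :: nat and q :: "nat \<Rightarrow> nat"
  have sc_range: "\<forall>j<n. sc p q j \<in> {0..1}" if "\<forall>j<n. q j \<le> Suc p" for p q
    using that by (auto simp: sc_def simp flip: of_nat_Suc)
  have "\<exists>q. (\<forall>i<n. q i < Suc p) \<and> (\<forall>i<n. \<exists>u v.
      (\<forall>j<n. q j \<le> u j \<and> u j \<le> q j + 1) \<and> (\<forall>j<n. q j \<le> v j \<and> v j \<le> q j + 1) \<and>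
      sc p u i \<le> f (sc p u) i \<and> f (sc p v) i \<le> sc p v i)" for p
  proof -
    \<comment> \<open>Kuhn's lemma wants label 0 on the face \<open>q i = 0\<close> and label 1 on
      the face \<open>q i = Suc p\<close>. The first holds because \<open>f\<close> is nonnegative.
      The second is forced by the extra conjunct, and there \<open>f \<le> 1\<close> still gives the
      inequality that label 1 stands for.\<close>
    define label :: "(nat \<Rightarrow> nat) \<Rightarrow> nat \<Rightarrow> nat" where
      "label q i = (if sc p q i \<le> f (sc p q) i \<and> q i \<noteq> Suc p then 0 else 1)" for q i
    have lab0: "label q i = 0" if "\<forall>j<n. q j \<le> Suc p" "i < n" "q i = 0" for q i
      using range[OF sc_range[OF that(1)] that(2)] that(3) by (auto simp: label_def sc_def)
    have le: "f (sc p q) i \<le> sc p q i" if "label q i \<noteq> 0" "\<forall>j<n. q j \<le> Suc p" "i < n" for q i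
      using range[OF sc_range[OF that(2)] that(3)] that(1)
      by (auto simp: label_def sc_def simp flip: of_nat_Suc split: if_splits)
    obtain q where q: "\<forall>i<n. q i < Suc p"
      and uv: "\<forall>i<n. \<exists>u v. (\<forall>j<n. q j \<le> u j \<and> u j \<le> q j + 1) \<and>
        (\<forall>j<n. q j \<le> v j \<and> v j \<le> q j + 1) \<and> label u i \<noteq> label v i"
      by (rule kuhn_lemma[of "Suc p" n label]) (use lab0 in \<open>auto simp: label_def\<close>)
    have "\<exists>u v. (\<forall>j<n. q j \<le> u j \<and> u j \<le> q j + 1) \<and> (\<forall>j<n. q j \<le> v j \<and> v j \<le> q j + 1) \<and>
        sc p u i \<le> f (sc p u) i \<and> f (sc p v) i \<le> sc p v i" if i: "i < n" for i
    proof -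
      obtain u v where u: "\<forall>j<n. q j \<le> u j \<and> u j \<le> q j + 1"
        and v: "\<forall>j<n. q j \<le> v j \<and> v j \<le> q j + 1" and ne: "label u i \<noteq> label v i"
        using uv i by blast
      have u': "\<forall>j<n. u j \<le> Suc p"
        using u q by (metis Suc_eq_plus1 Suc_leI le_trans)
      have v': "\<forall>j<n. v j \<le> Suc p"
        using v q by (metis Suc_eq_plus1 Suc_leI le_trans)
      have ge: "sc p w i \<le> f (sc p w) i" if "label w i = 0" for w
        using that by (auto simp: label_def split: if_splits)
      show ?thesis
      proof (cases "label u i = 0")
        case True
        then have "label v i \<noteq> 0" using ne by simp
        then show ?thesis using ge[OF True] le[OF _ v' i] u v by blast
      next
        case False
        then have "label v i = 0" using ne by (auto simp: label_def split: if_splits)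
        then show ?thesis using ge le[OF False u' i] u v by blast
      qed
    qed
    with q show ?thesis by blast
  qed
  then obtain q where q: "\<And>p i. i < n \<Longrightarrow> q p i < Suc p"
    and uv: "\<And>p i. i < n \<Longrightarrow> \<exists>u v.
      (\<forall>j<n. q p j \<le> u j \<and> u j \<le> q p j + 1) \<and> (\<forall>j<n. q p j \<le> v j \<and> v j \<le> q p j + 1) \<and>
      sc p u i \<le> f (sc p u) i \<and> f (sc p v) i \<le> sc p v i"
    by metis
  have z01: "sc p (q p) i \<in> {0..1}" if "i < n" for p i
    using sc_range[of "q p" p] q that less_imp_le by blast
  obtain l h where h: "strict_mono h" and l: "\<And>i. i < n \<Longrightarrow> (\<lambda>p. sc (h p) (q (h p)) i) \<longlonglongrightarrow> l i"
    using subsequence_convergent_coordinates[of n "\<lambda>p. sc p (q p)"] z01 by blast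
  \<comment> \<open>All corners of a cell differ from its base corner by at most the mesh in each
    coordinate, so every selection of corners has the same limit \<open>l\<close>.\<close>
  have close: "(\<lambda>p. sc (h p) (w (h p)) j) \<longlonglongrightarrow> l j"
    if w: "\<And>p. \<forall>j<n. q p j \<le> w p j \<and> w p j \<le> q p j + 1" and j: "j < n" for w j
  proof (rule tendsto_sandwich)
    show "\<forall>\<^sub>F p in sequentially. sc (h p) (q (h p)) j \<le> sc (h p) (w (h p)) j"
      using w j by (intro always_eventually) (auto simp: sc_def intro!: divide_right_mono)
    have "real (w (h p) j) \<le> real (q (h p) j) + 1" for p
      using w[of "h p"] j by (metis of_nat_1 of_nat_add of_nat_mono)
    then show "\<forall>\<^sub>F p in sequentially. sc (h p) (w (h p)) j \<le> sc (h p) (q (h p)) j + 1 / real (Suc (h p))"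
      by (intro always_eventually allI)
        (auto simp: sc_def simp flip: add_divide_distrib of_nat_Suc intro!: divide_right_mono)
    have "(\<lambda>p. 1 / real (Suc (h p))) \<longlonglongrightarrow> 0"
      using LIMSEQ_subseq_LIMSEQ[OF LIMSEQ_inverse_real_of_nat h]
      by (simp add: inverse_eq_divide o_def)
    then show "(\<lambda>p. sc (h p) (q (h p)) j + 1 / real (Suc (h p))) \<longlonglongrightarrow> l j"
      using tendsto_add[OF l[OF j]] by fastforce
  qed (use l j in auto)
  have "f l i = l i" if i: "i < n" for i
  proof -
    obtain u v where u: "\<And>p. \<forall>j<n. q p j \<le> u p j \<and> u p j \<le> q p j + 1"
      and v: "\<And>p. \<forall>j<n. q p j \<le> v p j \<and> v p j \<le> q p j + 1"
      and fu: "\<And>p. sc p (u p) i \<le> f (sc p (u p)) i" and fv: "\<And>p. f (sc p (v p)) i \<le> sc p (v p) i"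
      using uv[OF i] by metis
    have "(\<lambda>p. f (sc (h p) (u (h p))) i) \<longlonglongrightarrow> f l i" "(\<lambda>p. f (sc (h p) (v (h p))) i) \<longlonglongrightarrow> f l i"
      using close[OF u] close[OF v] by (intro cont[OF i]; blast)+
    then have "l i \<le> f l i" "f l i \<le> l i"
      using LIMSEQ_le[OF close[OF u i]] LIMSEQ_le[OF _ close[OF v i]] fu fv by blast+
    then show ?thesis by simp
  qed
  moreover have "l i \<in> {0..1}" if "i < n" for i
    by (rule closed_sequentially[OF closed_atLeastAtMost _ l[OF that]]) (use z01 that in blast)
  ultimately show ?thesis by blast
qed

subsection \<open>Rational points of polytopes with small common denominators\<close>

text \<open>Assumption \<open>rec\<close> says that the recession cone is trivial: every nonzero
  direction eventually leaves the polyhedron. At a feasible point with the greatest number of tight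
  constraints, a nonzero direction in the kernel of the tight ones would lead to a further tight
  constraint without losing any. The point found is a vertex.\<close>

lemma polyhedron_point_tight_kernel_trivial:
  fixes g :: "'c \<Rightarrow> nat \<Rightarrow> real" and x0 :: "nat \<Rightarrow> real"
  assumes fin: "finite I"
    and feas: "\<And>c. c \<in> I \<Longrightarrow> (\<Sum>j<n. g c j * x0 j) \<le> h c"
    and rec: "\<And>v. (\<And>c. c \<in> I \<Longrightarrow> (\<Sum>j<n. g c j * v j) \<le> 0) \<Longrightarrow> \<forall>j<n. v j = 0"
  shows "\<exists>x. (\<forall>c\<in>I. (\<Sum>j<n. g c j * x j) \<le> h c) \<and>
    (\<forall>v. (\<forall>c\<in>I. (\<Sum>j<n. g c j * x j) = h c \<longrightarrow> (\<Sum>j<n. g c j * v j) = 0) \<longrightarrow> (\<forall>j<n. v j = 0))"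
proof -
  define dot where "dot c x = (\<Sum>j<n. g c j * x j)" for c x
  define tight where "tight x = {c \<in> I. dot c x = h c}" for x
  let ?P = "\<lambda>x. \<forall>c\<in>I. dot c x \<le> h c"
  have "?P x0" using feas by (simp add: dot_def)
  moreover have "\<forall>x. ?P x \<longrightarrow> card (tight x) < Suc (card I)"
    unfolding tight_def using card_mono[OF fin] by (simp add: le_imp_less_Suc)
  ultimately obtain x where x: "?P x" and max: "\<And>y. ?P y \<Longrightarrow> card (tight y) \<le> card (tight x)"
    using ex_has_greatest_nat[of ?P x0 "\<lambda>x. card (tight x)"] by blast
  have "\<forall>j<n. v j = 0" if ker: "\<forall>c\<in>I. dot c x = h c \<longrightarrow> dot c v = 0" for v
  proof (rule ccontr)
    assume ne: "\<not> (\<forall>j<n. v j = 0)"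
    \<comment> \<open>Ratio test of the simplex method: \<open>B\<close> collects the constraints
      that \<open>v\<close> runs into, \<open>r c\<close> is the step length at which
      \<open>c\<close> becomes tight, and the least such length keeps all others satisfied.\<close>
    define B where "B = {c \<in> I. dot c v > 0}"
    define r where "r c = (h c - dot c x) / dot c v" for c
    have "B \<noteq> {}"
      using rec[of v] ne unfolding B_def dot_def by fastforce
    moreover have "finite B" using fin by (simp add: B_def)
    ultimately obtain b where b: "b \<in> B" and bmin: "\<And>c. c \<in> B \<Longrightarrow> r b \<le> r c"
      using arg_min_if_finite(1)[of B r] arg_min_if_finite(2)[of B r]
      by (metis not_less)
    have bI: "b \<in> I" and bpos: "dot b v > 0" using b by (auto simp: B_def)
    have r0: "r b \<ge> 0" using x bI bpos by (simp add: r_def)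
    define y where "y j = x j + r b * v j" for j
    have dy: "dot c y = dot c x + r b * dot c v" for c
      unfolding dot_def y_def by (simp add: algebra_simps sum.distrib sum_distrib_left)
    have "?P y"
    proof
      fix c assume c: "c \<in> I"
      show "dot c y \<le> h c"
      proof (cases "dot c v > 0")
        case True
        then have "r b * dot c v \<le> r c * dot c v"
          using bmin[of c] c by (intro mult_right_mono) (auto simp: B_def)
        then show ?thesis using True by (simp add: dy r_def)
      next
        case False
        then have "r b * dot c v \<le> 0"
          using r0 by (simp add: mult_nonneg_nonpos)
        then show ?thesis using x c by (fastforce simp: dy)
      qed
    qed
    moreover have "insert b (tight x) \<subseteq> tight y"
      using ker bI bpos by (auto simp: tight_def dy r_def)
    then have "card (insert b (tight x)) \<le> card (tight y)"
      using fin by (intro card_mono) (auto simp: tight_def)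
    moreover have "b \<notin> tight x" using ker bpos by (auto simp: tight_def)
    moreover have "finite (tight x)" using fin by (simp add: tight_def)
    ultimately show False using max[of y] by simp
  qed
  with x show ?thesis unfolding dot_def by blast
qed

text \<open>Leibniz's formula has \<open>n!\<close> terms of size at most \<open>B ^ n\<close>. This
  is cruder than Hadamard's inequality, but only the order of the bit length matters.\<close>

lemma abs_det_le:
  fixes A :: "int mat"
  assumes A: "A \<in> carrier_mat n n" and bd: "\<And>i j. i < n \<Longrightarrow> j < n \<Longrightarrow> \<bar>A $$ (i, j)\<bar> \<le> B"
  shows "\<bar>det A\<bar> \<le> fact n * B ^ n"
proof -
  have "\<bar>det A\<bar> \<le> (\<Sum>p | p permutes {0..<n}. \<bar>signof p * (\<Prod>i = 0..<n. A $$ (i, p i))\<bar>)"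
    unfolding det_def'[OF A] by (rule sum_abs)
  also have "\<dots> \<le> (\<Sum>p | p permutes {0..<n}. B ^ n)"
  proof (rule sum_mono)
    fix p assume "p \<in> {p. p permutes {0..<n}}"
    then have p: "p permutes {0..<n}" by simp
    have "\<bar>signof p :: int\<bar> = 1" by (simp add: sign_def)
    then have "\<bar>signof p * (\<Prod>i = 0..<n. A $$ (i, p i))\<bar> = (\<Prod>i = 0..<n. \<bar>A $$ (i, p i)\<bar>)"
      by (simp add: abs_mult abs_prod)
    also have "\<dots> \<le> (\<Prod>i = 0..<n. B)"
      using permutes_in_image[OF p] by (intro prod_mono) (auto intro: bd)
    finally show "\<bar>signof p * (\<Prod>i = 0..<n. A $$ (i, p i))\<bar> \<le> B ^ n" by simp
  qed
  also have "\<dots> = fact n * B ^ n"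
    by (simp add: card_permutations)
  finally show ?thesis .
qed

text \<open>The normal equations turn the overdetermined system into a square one, to which Cramer's
  rule applies.\<close>

lemma common_denominator_of_determined_system:
  fixes g :: "'c \<Rightarrow> nat \<Rightarrow> int" and x :: "nat \<Rightarrow> real"
  assumes fin: "finite J"
    and sol: "\<And>c. c \<in> J \<Longrightarrow> (\<Sum>j<n. real_of_int (g c j) * x j) = real_of_int (h c)"
    and ker: "\<And>v::nat \<Rightarrow> real. (\<And>c. c \<in> J \<Longrightarrow> (\<Sum>j<n. real_of_int (g c j) * v j) = 0) \<Longrightarrow> \<forall>j<n. v j = 0"
    and bd: "\<And>c j. c \<in> J \<Longrightarrow> j < n \<Longrightarrow> \<bar>g c j\<bar> \<le> M"
  shows "\<exists>D z. 0 < D \<and> D \<le> fact n * (int (card J) * M\<^sup>2) ^ n \<and> (\<forall>i<n. real_of_int D * x i = real_of_int (z i))"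
proof -
  define A where "A = mat n n (\<lambda>(i, j). \<Sum>c\<in>J. g c i * g c j)"
  define b where "b = vec n (\<lambda>i. \<Sum>c\<in>J. g c i * h c)"
  define R where "R = map_mat real_of_int A"
  have A: "A \<in> carrier_mat n n" and R: "R \<in> carrier_mat n n" by (auto simp: A_def R_def)
  have Rv: "(R *\<^sub>v vec n v) $ i = (\<Sum>c\<in>J. real_of_int (g c i) * (\<Sum>j<n. real_of_int (g c j) * v j))"
    if "i < n" for i and v :: "nat \<Rightarrow> real"
  proof -
    have "(R *\<^sub>v vec n v) $ i = (\<Sum>j<n. (\<Sum>c\<in>J. real_of_int (g c i) * real_of_int (g c j)) * v j)"
      using that by (simp add: R_def A_def scalar_prod_def lessThan_atLeast0)
    also have "\<dots> = (\<Sum>j<n. \<Sum>c\<in>J. real_of_int (g c i) * real_of_int (g c j) * v j)"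
      by (simp add: sum_distrib_right)
    also have "\<dots> = (\<Sum>c\<in>J. \<Sum>j<n. real_of_int (g c i) * real_of_int (g c j) * v j)"
      by (rule sum.swap)
    finally show ?thesis by (simp add: sum_distrib_left mult.assoc)
  qed
  \<comment> \<open>\<open>R\<close> is the Gram matrix of the coefficient columns: if it
    annihilates \<open>w\<close>, the quadratic form of \<open>R\<close> at \<open>w\<close>, which
    is the sum of the squares of \<open>d c\<close>, vanishes. So \<open>w\<close> solves the
    homogeneous system and is zero by \<open>ker\<close>.\<close>
  have "det R \<noteq> 0"
  proof
    assume "det R = 0"
    then obtain w where w: "w \<in> carrier_vec n" "w \<noteq> 0\<^sub>v n" "R *\<^sub>v w = 0\<^sub>v n"
      using det_0_iff_vec_prod_zero_field[OF R] by blast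
    define v where "v j = w $ j" for j
    have wv: "w = vec n v" using w(1) by (auto simp: v_def)
    define d where "d c = (\<Sum>j<n. real_of_int (g c j) * v j)" for c
    have "(\<Sum>c\<in>J. (d c)\<^sup>2) = (\<Sum>c\<in>J. \<Sum>i<n. v i * (real_of_int (g c i) * d c))"
      by (rule sum.cong[OF refl])
        (simp add: power2_eq_square d_def[of c for c] sum_distrib_right ac_simps)
    also have "\<dots> = (\<Sum>i<n. v i * (R *\<^sub>v w) $ i)"
      by (subst sum.swap) (simp add: wv Rv d_def sum_distrib_left)
    also have "\<dots> = 0" by (simp add: w(3))
    finally have "\<forall>c\<in>J. d c = 0"
      using fin by (simp add: sum_nonneg_eq_0_iff)
    then have "\<forall>j<n. v j = 0" unfolding d_def by (intro ker) auto
    then have "w = 0\<^sub>v n" by (auto simp: wv)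
    with w(2) show False by simp
  qed
  moreover have detR: "det R = real_of_int (det A)"
    unfolding R_def by simp
  ultimately have det0: "det A \<noteq> 0" by auto
  have cr: "x i * real_of_int (det A) = real_of_int (det (replace_col A b i))" if i: "i < n" for i
  proof -
    have "R *\<^sub>v vec n x = map_vec real_of_int b"
      by (rule eq_vecI) (use R in \<open>auto simp: Rv sol b_def simp del: index_mult_mat_vec\<close>)
    then have "replace_col R (R *\<^sub>v vec n x) i = map_mat real_of_int (replace_col A b i)"
      by (auto simp: replace_col_def R_def A_def b_def)
    then show ?thesis
      using cramer_lemma_mat[OF R _ i, of "vec n x"] i detR by simp
  qed
  have "\<bar>A $$ (i, j)\<bar> \<le> int (card J) * M\<^sup>2" if "i < n" "j < n" for i j
  proof -
    have "\<bar>A $$ (i, j)\<bar> \<le> (\<Sum>c\<in>J. \<bar>g c i\<bar> * \<bar>g c j\<bar>)"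
      using that by (simp add: A_def flip: abs_mult)
    also have "\<dots> \<le> (\<Sum>c\<in>J. M\<^sup>2)"
      unfolding power2_eq_square using that
      by (intro sum_mono mult_mono') (auto intro: bd)
    finally show ?thesis by simp
  qed
  then have "\<bar>det A\<bar> \<le> fact n * (int (card J) * M\<^sup>2) ^ n"
    by (rule abs_det_le[OF A])
  \<comment> \<open>The determinant may be negative; its sign is moved into the numerators to make
    the denominator positive.\<close>
  then show ?thesis
    using det0 cr
    by (intro exI[of _ "\<bar>det A\<bar>"] exI[of _ "\<lambda>i. sgn (det A) * det (replace_col A b i)"])
      (auto simp: abs_if sgn_if mult.commute)
qed

text \<open>Adding the box \<open>0 \<le> x i \<le> 1\<close> to the system makes its recession cone
  trivial, so a point determined by its tight constraints exists; the box accounts for the summand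
  \<open>2 * n\<close>. Multiplying by \<open>D\<close> turns the result into a statement about
  integers.\<close>

lemma small_denominator_feasible_point:
  fixes g :: "'c \<Rightarrow> nat \<Rightarrow> int" and x0 :: "nat \<Rightarrow> real"
  assumes fin: "finite I"
    and box: "\<And>i. i < n \<Longrightarrow> x0 i \<in> {0..1}"
    and feas: "\<And>c. c \<in> I \<Longrightarrow> (\<Sum>j<n. real_of_int (g c j) * x0 j) \<le> real_of_int (h c)"
    and bd: "\<And>c j. c \<in> I \<Longrightarrow> j < n \<Longrightarrow> \<bar>g c j\<bar> \<le> int M" and M: "1 \<le> M"
  shows "\<exists>D y. 0 < D \<and> D \<le> fact n * ((card I + 2 * n) * M\<^sup>2) ^ n \<and> (\<forall>i<n. y i \<le> D) \<and>
    (\<forall>c\<in>I. (\<Sum>j<n. g c j * int (y j)) \<le> h c * int D)"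
proof -
  \<comment> \<open>\<open>Inr (i, True)\<close> stands for \<open>x i \<le> 1\<close> and
    \<open>Inr (i, False)\<close> for \<open>- x i \<le> 0\<close>. Their coefficients are at most 1
    in absolute value, hence the assumption \<open>1 \<le> M\<close>.\<close>
  define K where "K = Inl ` I \<union> Inr ` ({..<n} \<times> (UNIV :: bool set))"
  define G :: "'c + nat \<times> bool \<Rightarrow> nat \<Rightarrow> int" where
    "G c j = (case c of Inl c \<Rightarrow> g c j | Inr (i, up) \<Rightarrow> if j = i then if up then 1 else - 1 else 0)" for c j
  define H :: "'c + nat \<times> bool \<Rightarrow> int" where
    "H c = (case c of Inl c \<Rightarrow> h c | Inr (i, up) \<Rightarrow> if up then 1 else 0)" for c
  have GI: "(\<Sum>j<n. real_of_int (G (Inl c) j) * v j) = (\<Sum>j<n. real_of_int (g c j) * v j)"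
    for c and v :: "nat \<Rightarrow> real" by (simp add: G_def)
  have GU: "(\<Sum>j<n. real_of_int (G (Inr (i, True)) j) * v j) = v i"
    if "i < n" for i and v :: "nat \<Rightarrow> real"
    using that by (simp add: G_def if_distrib[of real_of_int] if_distrib[of "\<lambda>t. t * _"] cong: if_cong)
  have GL: "(\<Sum>j<n. real_of_int (G (Inr (i, False)) j) * v j) = - v i"
    if "i < n" for i and v :: "nat \<Rightarrow> real"
    using that by (simp add: G_def if_distrib[of real_of_int] if_distrib[of "\<lambda>t. t * _"] cong: if_cong)
  have finK: "finite K" using fin by (simp add: K_def)
  have cardK: "card K \<le> card I + 2 * n"
    unfolding K_def by (subst card_Un_disjoint) (auto simp: fin card_image card_cartesian_product)
  have mem: "c \<in> I \<Longrightarrow> Inl c \<in> K" "i < n \<Longrightarrow> Inr (i, up) \<in> K" for c i up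
    by (auto simp: K_def)
  have "\<exists>x. (\<forall>c\<in>K. (\<Sum>j<n. real_of_int (G c j) * x j) \<le> real_of_int (H c)) \<and>
      (\<forall>v. (\<forall>c\<in>K. (\<Sum>j<n. real_of_int (G c j) * x j) = real_of_int (H c) \<longrightarrow>
         (\<Sum>j<n. real_of_int (G c j) * v j) = 0) \<longrightarrow> (\<forall>j<n. v j = 0))"
  proof (rule polyhedron_point_tight_kernel_trivial[OF finK])
    fix c assume "c \<in> K"
    then consider a where "c = Inl a" "a \<in> I" | i where "i < n" "c = Inr (i, True)"
      | i where "i < n" "c = Inr (i, False)"
      by (auto simp: K_def)
    then show "(\<Sum>j<n. real_of_int (G c j) * x0 j) \<le> real_of_int (H c)"
      using feas box by cases (simp_all add: GI GU GL H_def)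
  next
    fix v :: "nat \<Rightarrow> real"
    assume *: "\<And>c. c \<in> K \<Longrightarrow> (\<Sum>j<n. real_of_int (G c j) * v j) \<le> 0"
    show "\<forall>j<n. v j = 0"
      using *[OF mem(2)] GU GL by (metis antisym neg_le_0_iff_le)
  qed
  then obtain x where x: "\<And>c. c \<in> K \<Longrightarrow> (\<Sum>j<n. real_of_int (G c j) * x j) \<le> real_of_int (H c)"
    and ker: "\<And>v. \<forall>c\<in>K. (\<Sum>j<n. real_of_int (G c j) * x j) = real_of_int (H c) \<longrightarrow>
         (\<Sum>j<n. real_of_int (G c j) * v j) = 0 \<Longrightarrow> \<forall>j<n. v j = 0"
    by blast
  define J where "J = {c \<in> K. (\<Sum>j<n. real_of_int (G c j) * x j) = real_of_int (H c)}"
  have J: "finite J" "card J \<le> card I + 2 * n"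
    using finK cardK card_mono[OF finK, of J] by (auto simp: J_def)
  obtain D z where D: "0 < D" "D \<le> fact n * (int (card J) * (int M)\<^sup>2) ^ n"
    and z: "\<And>i. i < n \<Longrightarrow> real_of_int D * x i = real_of_int (z i)"
  proof -
    have "\<exists>D z. 0 < D \<and> D \<le> fact n * (int (card J) * (int M)\<^sup>2) ^ n \<and>
        (\<forall>i<n. real_of_int D * x i = real_of_int (z i))"
    proof (rule common_denominator_of_determined_system[where n = n and g = G and x = x and h = H, OF J(1)])
      show "\<bar>G c j\<bar> \<le> int M" if "c \<in> J" "j < n" for c j
        using that M bd by (auto simp: J_def K_def G_def split: sum.splits)
    qed (use ker in \<open>auto simp: J_def\<close>)
    then show ?thesis using that by blast
  qed
  have x01: "0 \<le> x i" "x i \<le> 1" if "i < n" for i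
    using x[OF mem(2)[OF that], of True] x[OF mem(2)[OF that], of False] that
    by (simp_all add: GU GL H_def)
  have z0: "0 \<le> z i" "z i \<le> D" if "i < n" for i
  proof -
    have "0 \<le> real_of_int D * x i" "real_of_int D * x i \<le> real_of_int D"
      using x01[OF that] D(1) by (auto intro: mult_left_le)
    then show "0 \<le> z i" "z i \<le> D" using z[OF that] by auto
  qed
  show ?thesis
  proof (intro exI[of _ "nat D"] exI[of _ "\<lambda>i. nat (z i)"] conjI allI impI ballI)
    show "0 < nat D" using D(1) by simp
    have "D \<le> int (fact n * (card J * M\<^sup>2) ^ n)" using D(2) by simp
    then have "nat D \<le> fact n * (card J * M\<^sup>2) ^ n" by linarith
    also have "\<dots> \<le> fact n * ((card I + 2 * n) * M\<^sup>2) ^ n"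
      using J(2) by (intro mult_left_mono power_mono mult_right_mono) auto
    finally show "nat D \<le> fact n * ((card I + 2 * n) * M\<^sup>2) ^ n" .
  next
    fix i assume "i < n"
    then show "nat (z i) \<le> nat D" using z0 by (simp add: nat_mono)
  next
    fix c assume c: "c \<in> I"
    have "real_of_int (\<Sum>j<n. g c j * int (nat (z j))) = (\<Sum>j<n. real_of_int (g c j) * (real_of_int D * x j))"
      using z0 z by simp
    also have "\<dots> = real_of_int D * (\<Sum>j<n. real_of_int (g c j) * x j)"
      by (simp add: sum_distrib_left ac_simps)
    also have "\<dots> \<le> real_of_int D * real_of_int (h c)"
      using x[OF mem(1)[OF c]] D(1) by (intro mult_left_mono) (auto simp: GI H_def)
    finally have "real_of_int (\<Sum>j<n. g c j * int (nat (z j))) \<le> real_of_int (h c * int (nat D))"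
      using D(1) by (simp add: mult.commute)
    then show "(\<Sum>j<n. g c j * int (nat (z j))) \<le> h c * int (nat D)"
      by (simp only: of_int_le_iff)
  qed
qed

subsection \<open>Small clearing vectors\<close>

text \<open>Brouwer's theorem gives a real solution; let \<open>Z\<close> be its set of fully paying
  banks. Every point of the cube that satisfies the linear conditions attached to \<open>Z\<close>
  solves the equations again: on \<open>Z\<close> it has rate 1 and liabilities covered by assets,
  and off \<open>Z\<close> it has \<open>l i * r i\<close> equal to the assets, while the box keeps
  this below \<open>l i\<close>. So the minimum is attained at the right argument, and a point with
  small denominator can replace the given one.\<close>

lemma small_denominator_truncated_affine_fixpoint:
  fixes l :: "nat \<Rightarrow> nat" and b :: "nat \<Rightarrow> int" and G :: "nat \<Rightarrow> nat \<Rightarrow> int"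
  assumes nonneg: "\<And>r i. \<forall>j<n. r j \<in> {0..1::real} \<Longrightarrow> i < n \<Longrightarrow>
      0 \<le> real_of_int (b i) + (\<Sum>j<n. real_of_int (G i j) * r j)"
    and bdl: "\<And>i. i < n \<Longrightarrow> l i \<le> M" and bdG: "\<And>i j. i < n \<Longrightarrow> j < n \<Longrightarrow> \<bar>G i j\<bar> \<le> int M"
    and M: "1 \<le> M"
  shows "\<exists>D y. 0 < D \<and> D \<le> fact n * (16 * n * M\<^sup>2) ^ n \<and> (\<forall>i<n. y i \<le> D) \<and>
    (\<forall>i<n. if l i = 0 then y i = D
      else int (l i * y i) = min (int (l i * D)) (b i * int D + (\<Sum>j<n. G i j * int (y j))))"
proof -
  define a where "a r i = real_of_int (b i) + (\<Sum>j<n. real_of_int (G i j) * r j)" for r i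
  define f where "f r i = (if l i = 0 then 1 else min 1 (a r i / real (l i)))" for r :: "nat \<Rightarrow> real" and i
  have "\<exists>r. (\<forall>i<n. r i \<in> {0..1}) \<and> (\<forall>i<n. f r i = r i)"
  proof (rule brouwer_unit_cube_coordinates)
    show "f r i \<in> {0..1}" if "\<forall>j<n. r j \<in> {0..1}" "i < n" for r i
      using nonneg[OF that] by (simp add: f_def a_def)
  next
    fix x :: "nat \<Rightarrow> nat \<Rightarrow> real" and z i
    assume "\<forall>j<n. (\<lambda>p. x p j) \<longlonglongrightarrow> z j"
    then have "(\<lambda>p. a (x p) i) \<longlonglongrightarrow> a z i"
      unfolding a_def by (intro tendsto_intros) auto
    then have "(\<lambda>p. min 1 (a (x p) i / real (l i))) \<longlonglongrightarrow> min 1 (a z i / real (l i))" if "l i \<noteq> 0"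
      using that by (intro tendsto_intros) auto
    then show "(\<lambda>p. f (x p) i) \<longlonglongrightarrow> f z i"
      unfolding f_def by (cases "l i = 0") simp_all
  qed
  then obtain r where r01: "\<And>i. i < n \<Longrightarrow> r i \<in> {0..1}" and r: "\<And>i. i < n \<Longrightarrow> f r i = r i"
    by blast
  define Z where "Z i \<longleftrightarrow> real (l i) \<le> a r i" for i
  have rZ: "r i = 1" if "i < n" "Z i" for i
    using r[OF that(1)] that(2) by (auto simp: f_def Z_def min_def field_simps split: if_splits)
  have rN: "real (l i) * r i = a r i \<and> l i \<noteq> 0" if "i < n" "\<not> Z i" for i
  proof -
    \<comment> \<open>Assets are nonnegative on the cube, so a bank without liabilities belongs to
      \<open>Z\<close>.\<close>
    have "l i \<noteq> 0" using nonneg[of r i] r01 that by (auto simp: Z_def a_def)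
    then show ?thesis
      using r[OF that(1)] that(2) by (auto simp: f_def Z_def min_def field_simps split: if_splits)
  qed
  \<comment> \<open>Two inequalities per bank. For \<open>Z i\<close> they are
    \<open>l i \<le> a r i\<close> and \<open>1 \<le> r i\<close>, the latter an equation together
    with the box. Otherwise they are the two directions of \<open>l i * r i = a r i\<close>. A
    diagonal coefficient combines \<open>l i\<close> with \<open>G i i\<close>, hence the bound
    \<open>2 * M\<close> used below.\<close>
  define g :: "nat \<times> bool \<Rightarrow> nat \<Rightarrow> int" where
    "g c j = (case c of (i, t) \<Rightarrow>
       if Z i then if t then - G i j else (if j = i then - 1 else 0)
       else if t then (if j = i then int (l i) else 0) - G i j
       else G i j - (if j = i then int (l i) else 0))" for c j
  define h :: "nat \<times> bool \<Rightarrow> int" where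
    "h c = (case c of (i, t) \<Rightarrow>
       if Z i then if t then b i - int (l i) else - 1 else if t then b i else - b i)" for c
  have delta_r: "(\<Sum>j<n. real_of_int (if j = i then w else 0) * v j) = real_of_int w * v i"
    if "i < n" for i w and v :: "nat \<Rightarrow> real"
    using that by (simp add: if_distrib[of real_of_int] if_distrib[of "\<lambda>t. t * _"] cong: if_cong)
  have delta_i: "(\<Sum>j<n. (if j = i then w else 0) * v j) = w * v i"
    if "i < n" for i and w :: int and v :: "nat \<Rightarrow> int"
    using that by (simp add: if_distrib[of "\<lambda>t. t * _"] cong: if_cong)
  have "\<exists>D y. 0 < D \<and> D \<le> fact n * ((card ({..<n} \<times> (UNIV :: bool set)) + 2 * n) * (2 * M)\<^sup>2) ^ n \<and>
      (\<forall>i<n. y i \<le> D) \<and>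
      (\<forall>c\<in>{..<n} \<times> UNIV. (\<Sum>j<n. g c j * int (y j)) \<le> h c * int D)"
  proof (rule small_denominator_feasible_point)
    fix c assume "c \<in> {..<n} \<times> (UNIV :: bool set)"
    then obtain i t where c: "c = (i, t)" and i: "i < n" by auto
    show "(\<Sum>j<n. real_of_int (g c j) * r j) \<le> real_of_int (h c)"
    proof (cases "Z i")
      case True
      show ?thesis
      proof (cases t)
        case t: True
        show ?thesis using True by (simp add: c t g_def h_def Z_def a_def sum_negf)
      next
        case t: False
        show ?thesis
          using True rZ[OF i True] delta_r[OF i, of "- 1" r] by (simp add: c t g_def h_def)
      qed
    next
      case False
      then show ?thesis
        using rN[OF i False] delta_r[OF i, of "int (l i)" r] i
        by (cases t) (auto simp: c g_def h_def a_def left_diff_distrib sum_subtractf)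
    qed
  next
    fix c j assume "c \<in> {..<n} \<times> (UNIV :: bool set)" and j: "j < n"
    then obtain i t where c: "c = (i, t)" and i: "i < n" by auto
    show "\<bar>g c j\<bar> \<le> int (2 * M)"
      using bdl[OF i] bdG[OF i j] M by (auto simp: c g_def)
  qed (use r01 M in auto)
  then obtain D y where D: "0 < D"
    and Db: "D \<le> fact n * ((card ({..<n} \<times> (UNIV :: bool set)) + 2 * n) * (2 * M)\<^sup>2) ^ n"
    and y: "\<And>i. i < n \<Longrightarrow> y i \<le> D"
    and con: "\<And>i t. i < n \<Longrightarrow> (\<Sum>j<n. g (i, t) j * int (y j)) \<le> h (i, t) * int D"
    by blast
  \<comment> \<open>\<open>2 * n\<close> inequalities of the system and \<open>2 * n\<close> of the
    box give the factor \<open>4 * n\<close>; squaring \<open>2 * M\<close> gives the other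
    4.\<close>
  have "(card ({..<n} \<times> (UNIV :: bool set)) + 2 * n) * (2 * M)\<^sup>2 = 16 * n * M\<^sup>2"
    by (simp add: card_cartesian_product power2_eq_square)
  with Db have Db': "D \<le> fact n * (16 * n * M\<^sup>2) ^ n" by (simp only:)
  have "if l i = 0 then y i = D
      else int (l i * y i) = min (int (l i * D)) (b i * int D + (\<Sum>j<n. G i j * int (y j)))"
    if i: "i < n" for i
  proof (cases "Z i")
    case True
    have "- int (y i) \<le> - int D"
      using con[OF i, of False] True i delta_i[OF i, of "- 1" "\<lambda>j. int (y j)"]
      by (simp add: g_def h_def)
    then have "y i = D" using y[OF i] by simp
    moreover have "int (l i * D) \<le> b i * int D + (\<Sum>j<n. G i j * int (y j))"
      using con[OF i, of True] True by (simp add: g_def h_def sum_negf left_diff_distrib)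
    ultimately show ?thesis by (simp add: min_def)
  next
    case False
    have "int (l i * y i) = b i * int D + (\<Sum>j<n. G i j * int (y j))"
      using con[OF i, of False] con[OF i, of True] False i
        delta_i[OF i, of "int (l i)" "\<lambda>j. int (y j)"]
      by (simp add: g_def h_def left_diff_distrib sum_subtractf)
    moreover have "int (l i * y i) \<le> int (l i * D)"
      using y[OF i] by (simp only: of_nat_le_iff mult_le_mono2)
    ultimately show ?thesis using rN[OF i False] by (simp add: min_def)
  qed
  with D Db' y show ?thesis by blast
qed

text \<open>For the candidate recovery rates \<open>x i / D\<close> and integral notionals, these are the total
  liabilities multiplied by \<open>D\<close> and the assets multiplied by \<open>D\<^sup>2\<close>.\<close>

definition scaled_liability ::
    "nat \<Rightarrow> (nat \<Rightarrow> nat \<Rightarrow> nat) \<Rightarrow> (nat \<Rightarrow> nat \<Rightarrow> nat \<Rightarrow> nat) \<Rightarrow> nat \<Rightarrow> (nat \<Rightarrow> nat) \<Rightarrow> nat \<Rightarrow> nat" where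
  "scaled_liability n C S D x i = (\<Sum>j<n. D * C i j + (\<Sum>k<n. (D - x k) * S i j k))"

definition scaled_assets ::
    "nat \<Rightarrow> (nat \<Rightarrow> nat) \<Rightarrow> (nat \<Rightarrow> nat \<Rightarrow> nat) \<Rightarrow> (nat \<Rightarrow> nat \<Rightarrow> nat \<Rightarrow> nat) \<Rightarrow> nat \<Rightarrow> (nat \<Rightarrow> nat) \<Rightarrow> nat \<Rightarrow> nat" where
  "scaled_assets n E C S D x i =
     D * D * E i + (\<Sum>j<n. D * x j * C j i + (\<Sum>k<n. x j * (D - x k) * S j i k))"

text \<open>The violation of the clearing condition of bank \<open>i\<close>, as a natural number.  With truncated
  subtraction, \<open>u - (u - v)\<close> is the minimum and \<open>1 - u\<close> tests for zero.\<close>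

definition violation where
  "violation n E C S D x i =
     (let u = scaled_liability n C S D x i; v = scaled_assets n E C S D x i;
          w = D * u - (D * u - v)
      in (x i * u - w) + (w - x i * u) + (D - x i) * (1 - u))"

lemma violation_eq_0_iff:
  "violation n E C S D x i = 0 \<longleftrightarrow>
     x i * scaled_liability n C S D x i = min (D * scaled_liability n C S D x i) (scaled_assets n E C S D x i)
     \<and> (scaled_liability n C S D x i = 0 \<longrightarrow> D \<le> x i)"
  unfolding violation_def Let_def by (auto simp: min_def)

text \<open>Assets are scaled by \<open>D * D * Q\<close> and liabilities by \<open>D * Q\<close>.
  In their ratio only one factor \<open>D\<close> survives, and multiplying out the clearing
  equation gives the integer equation of \<open>violation_eq_0_iff\<close>. This is the soundness of
  the search.\<close>

lemma clearing_if_no_violation: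
  assumes n: "n = banks F" and Q: "0 < Q" and D: "0 < D" and x: "\<And>i. i < n \<Longrightarrow> x i \<le> D"
    and E: "\<And>i. i < n \<Longrightarrow> of_rat (ext F i) = real (E i) / real Q"
    and C: "\<And>i j. i < n \<Longrightarrow> j < n \<Longrightarrow> of_rat (debt F i j) = real (C i j) / real Q"
    and S: "\<And>i j k. i < n \<Longrightarrow> j < n \<Longrightarrow> k < n \<Longrightarrow> of_rat (cds F i j k) = real (S i j k) / real Q"
    and ok: "\<And>i. i < n \<Longrightarrow> violation n E C S D x i = 0"
    and r: "\<And>i. i < n \<Longrightarrow> r i = real (x i) / real D"
  shows "clearing F r"
proof -
  have liab: "liability F r i j = real (D * C i j + (\<Sum>k<n. (D - x k) * S i j k)) / (real D * real Q)"
    if "i < n" "j < n" for i j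
  proof -
    have "(1 - r k) * of_rat (cds F i j k) = real ((D - x k) * S i j k) / (real D * real Q)"
      if "k < n" for k
      using that \<open>i < n\<close> \<open>j < n\<close> D x[OF that] by (simp add: S r of_nat_diff field_simps)
    then have "(\<Sum>k<n. (1 - r k) * of_rat (cds F i j k)) = (\<Sum>k<n. real ((D - x k) * S i j k)) / (real D * real Q)"
      by (simp add: sum_divide_distrib)
    then show ?thesis
      using that D by (simp add: liability_def C n[symmetric] add_divide_distrib)
  qed
  have total: "total_liability F r i = real (scaled_liability n C S D x i) / (real D * real Q)"
    if "i < n" for i
    using that by (simp add: total_liability_def n[symmetric] liab scaled_liability_def sum_divide_distrib)
  have pay: "payment F r j i =
      real (D * x j * C j i + (\<Sum>k<n. x j * (D - x k) * S j i k)) / (real D * real D * real Q)"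
    if "i < n" "j < n" for i j
  proof -
    define w where "w = D * C j i + (\<Sum>k<n. (D - x k) * S j i k)"
    have "x j * w = D * x j * C j i + (\<Sum>k<n. x j * (D - x k) * S j i k)"
      by (simp add: w_def distrib_left sum_distrib_left mult.assoc mult.left_commute)
    moreover have "payment F r j i = real (x j * w) / (real D * real D * real Q)"
      using that D by (simp add: payment_def liab r w_def)
    ultimately show ?thesis by simp
  qed
  have ass: "assets F r i = real (scaled_assets n E C S D x i) / (real D * real D * real Q)"
    if "i < n" for i
    using that D
    by (simp add: assets_def n[symmetric] pay E scaled_assets_def sum_divide_distrib add_divide_distrib)
  show ?thesis
    unfolding clearing_def n[symmetric]
  proof (intro allI impI conjI)
    fix i assume i: "i < n"
    define u where "u = scaled_liability n C S D x i"
    define v where "v = scaled_assets n E C S D x i"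
    have uv: "x i * u = min (D * u) v" "u = 0 \<Longrightarrow> D \<le> x i"
      using ok[OF i] unfolding violation_eq_0_iff u_def v_def by auto
    show "0 \<le> r i" "r i \<le> 1" using D x[OF i] by (auto simp: r i)
    show "r i = 1" if "total_liability F r i = 0"
      using that uv(2) x[OF i] D Q by (auto simp: total[OF i] r i u_def)
    assume "total_liability F r i > 0"
    then have u: "0 < u" using D Q by (simp add: total[OF i] u_def zero_less_divide_iff)
    have "assets F r i / total_liability F r i = real v / (real D * real u)"
      using D Q u by (simp add: total[OF i] ass[OF i] u_def v_def field_simps)
    moreover have "real (x i) * real u = min (real D * real u) (real v)"
      using uv(1) by (metis of_nat_min of_nat_mult)
    then have "real (x i) / real D = min 1 (real v / (real D * real u))"
      using u D by (auto simp: min_def field_simps split: if_splits)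
    ultimately show "r i = min 1 (assets F r i / total_liability F r i)"
      by (simp add: r i)
  qed
qed

text \<open>Bank \<open>d\<close> owes at most the sum of its CDS notionals, which its external
  assets cover, so \<open>x d = D\<close> satisfies its condition. As every CDS is then paid at rate
  1, the CDS income of bank \<open>i\<close> from reference bank \<open>k\<close> is
  \<open>(1 - r k) * S d i k\<close>, which is affine; \<open>b\<close> and \<open>G\<close> collect
  constants and coefficients. The other banks owe debts only, so their liabilities are
  constant.\<close>

lemma small_candidate_without_violation:
  fixes E :: "nat \<Rightarrow> nat" and C :: "nat \<Rightarrow> nat \<Rightarrow> nat" and S :: "nat \<Rightarrow> nat \<Rightarrow> nat \<Rightarrow> nat"
  assumes d: "d < n"
    and S0: "\<And>i j k. i < n \<Longrightarrow> j < n \<Longrightarrow> k < n \<Longrightarrow> i \<noteq> d \<Longrightarrow> S i j k = 0"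
    and C0: "\<And>j. j < n \<Longrightarrow> C d j = 0"
    and Ed: "(\<Sum>j<n. \<Sum>k<n. S d j k) \<le> E d"
    and bdC: "\<And>i j. i < n \<Longrightarrow> j < n \<Longrightarrow> C i j \<le> B"
    and bdS: "\<And>i j k. i < n \<Longrightarrow> j < n \<Longrightarrow> k < n \<Longrightarrow> S i j k \<le> B" and B: "1 \<le> B"
  shows "\<exists>D x. 0 < D \<and> D \<le> fact n * (16 * n * (n * B)\<^sup>2) ^ n \<and> (\<forall>i<n. x i \<le> D) \<and>
    (\<forall>i<n. violation n E C S D x i = 0)"
proof -
  \<comment> \<open>Only debts are counted, so \<open>l d = 0\<close> and the fixed point equation
    sets \<open>y d = D\<close>; that this suits the actual liabilities of \<open>d\<close> is
    checked afterwards. A row of \<open>C\<close> sums to at most \<open>n * B\<close>, the bound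
    handed to the previous lemma.\<close>
  define l where "l i = (\<Sum>j<n. C i j)" for i
  define b where "b i = int (E i + (\<Sum>k<n. S d i k))" for i
  define G where "G i j = int (C j i) - int (S d i j)" for i j
  have Gsum: "b i + (\<Sum>j<n. G i j * t j) = int (E i) + (\<Sum>j<n. int (C j i) * t j) + (\<Sum>k<n. (1 - t k) * int (S d i k))"
    for i t by (simp add: b_def G_def algebra_simps sum.distrib sum_subtractf)
  have "\<exists>D y. 0 < D \<and> D \<le> fact n * (16 * n * (n * B)\<^sup>2) ^ n \<and> (\<forall>i<n. y i \<le> D) \<and>
    (\<forall>i<n. if l i = 0 then y i = D
      else int (l i * y i) = min (int (l i * D)) (b i * int D + (\<Sum>j<n. G i j * int (y j))))"
  proof (rule small_denominator_truncated_affine_fixpoint)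
    fix r i assume r: "\<forall>j<n. r j \<in> {0..1::real}" and i: "i < n"
    \<comment> \<open>\<open>G\<close> may be negative. Grouping the terms of \<open>S\<close> as
      \<open>(1 - r k) * S d i k\<close> shows that assets are nonnegative on the cube.\<close>
    have "real_of_int (b i) + (\<Sum>j<n. real_of_int (G i j) * r j) =
        real (E i) + (\<Sum>j<n. real (C j i) * r j) + (\<Sum>k<n. (1 - r k) * real (S d i k))"
      by (simp add: b_def G_def algebra_simps sum.distrib sum_subtractf)
    also have "\<dots> \<ge> 0"
      using r by (intro add_nonneg_nonneg sum_nonneg mult_nonneg_nonneg) auto
    finally show "0 \<le> real_of_int (b i) + (\<Sum>j<n. real_of_int (G i j) * r j)" .
  next
    fix i assume i: "i < n"
    have "l i \<le> (\<Sum>j<n. B)"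
      unfolding l_def using i by (intro sum_mono) (auto intro: bdC)
    then show "l i \<le> n * B" by simp
  next
    fix i j assume ij: "i < n" "j < n"
    have "C j i \<le> n * B" "S d i j \<le> n * B"
      using bdC[of j i] bdS[of d i j] ij d by (auto intro: order.trans)
    then show "\<bar>G i j\<bar> \<le> int (n * B)"
      unfolding G_def by linarith
  next
    show "1 \<le> n * B" using d B by simp
  qed
  then obtain D y where D: "0 < D" "D \<le> fact n * (16 * n * (n * B)\<^sup>2) ^ n"
    and y: "\<And>i. i < n \<Longrightarrow> y i \<le> D"
    and fix_y: "\<And>i. i < n \<Longrightarrow> if l i = 0 then y i = D
      else int (l i * y i) = min (int (l i * D)) (b i * int D + (\<Sum>j<n. G i j * int (y j)))"
    by blast
  have ld: "l d = 0" using C0 by (simp add: l_def)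
  have yd: "y d = D" using fix_y[OF d] ld by simp
  have "violation n E C S D y i = 0" if i: "i < n" for i
  proof (cases "i = d")
    case True
    have "scaled_liability n C S D y d = (\<Sum>j<n. \<Sum>k<n. (D - y k) * S d j k)"
      by (simp add: scaled_liability_def C0)
    also have "\<dots> \<le> (\<Sum>j<n. \<Sum>k<n. D * S d j k)"
      by (intro sum_mono mult_right_mono) auto
    also have "\<dots> = D * (\<Sum>j<n. \<Sum>k<n. S d j k)" by (simp add: sum_distrib_left)
    also have "\<dots> \<le> D * E d" using Ed by simp
    finally have "D * scaled_liability n C S D y d \<le> D * (D * E d)" by simp
    also have "\<dots> \<le> scaled_assets n E C S D y d" by (simp add: scaled_assets_def)
    finally show ?thesis by (simp add: True violation_eq_0_iff yd min_def)
  next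
    case False
    have L: "scaled_liability n C S D y i = D * l i"
      using S0[OF i _ _ False] by (simp add: scaled_liability_def l_def sum_distrib_left)
    have "(\<Sum>j<n. \<Sum>k<n. y j * (D - y k) * S j i k) = (\<Sum>j<n. if j = d then (\<Sum>k<n. y d * (D - y k) * S d i k) else 0)"
      using S0 i by (intro sum.cong) auto
    also have "\<dots> = D * (\<Sum>k<n. (D - y k) * S d i k)"
      using d by (simp add: yd sum_distrib_left mult.assoc)
    finally have A: "scaled_assets n E C S D y i =
        D * (D * E i + (\<Sum>j<n. y j * C j i) + (\<Sum>k<n. (D - y k) * S d i k))"
      by (simp add: scaled_assets_def sum.distrib sum_distrib_left distrib_left mult.assoc)
    have "(\<Sum>k<n. int ((D - y k) * S d i k)) = (\<Sum>k<n. int D * int (S d i k) - int (y k) * int (S d i k))"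
      using y by (intro sum.cong) (auto simp: of_nat_diff left_diff_distrib)
    then have aff: "b i * int D + (\<Sum>j<n. G i j * int (y j)) =
        int (D * E i + (\<Sum>j<n. y j * C j i) + (\<Sum>k<n. (D - y k) * S d i k))"
      by (simp add: b_def G_def algebra_simps sum.distrib sum_subtractf sum_distrib_left)
    show ?thesis
    proof (cases "l i = 0")
      case True
      then show ?thesis using fix_y[OF i] by (simp add: violation_eq_0_iff L)
    next
      case False
      then have "l i * y i = min (l i * D) (D * E i + (\<Sum>j<n. y j * C j i) + (\<Sum>k<n. (D - y k) * S d i k))"
        using fix_y[OF i] unfolding aff by (metis of_nat_eq_iff of_nat_min)
      then have "D * (l i * y i) = min (D * (l i * D)) (scaled_assets n E C S D y i)"
        unfolding A by (simp add: nat_mult_min_right)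
      then show ?thesis using False D(1) by (simp add: violation_eq_0_iff L ac_simps)
    qed
  qed
  with D y show ?thesis by blast
qed

subsection \<open>Running times with bounded memory\<close>

lemma less_two_power_bit_length: "n < 2 ^ bit_length n"
proof (cases "n = 0")
  case False
  then have "n < 2 ^ floorlog 2 n" using floorlog_bounds[of n 2] by simp
  also have "\<dots> \<le> 2 ^ bit_length n" by (intro power_increasing) (auto simp: bit_length_def)
  finally show ?thesis .
qed simp

lemma bit_length_le: "n < 2 ^ b \<Longrightarrow> 1 \<le> b \<Longrightarrow> bit_length n \<le> b"
  unfolding bit_length_def using floorlog_leI[of n 2 b] by simp

lemma bit_length_pos: "1 \<le> bit_length n"
  by (simp add: bit_length_def)

lemma bit_length_mono: "m \<le> n \<Longrightarrow> bit_length m \<le> bit_length n"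
  by (meson bit_length_le bit_length_pos le_less_trans less_two_power_bit_length)

section \<open>Cost of expressions and instructions over a bounded memory\<close>

fun esize :: "expr \<Rightarrow> nat" where
  "esize (Const n) = 1"
| "esize (Load a) = esize a + 1"
| "esize (Plus a b) = esize a + esize b + 1"
| "esize (Minus a b) = esize a + esize b + 1"
| "esize (Times a b) = esize a + esize b + 1"
| "esize (Div a b) = esize a + esize b + 1"

fun constants_le :: "nat \<Rightarrow> expr \<Rightarrow> bool" where
  "constants_le c (Const n) \<longleftrightarrow> n \<le> c"
| "constants_le c (Load a) \<longleftrightarrow> constants_le c a"
| "constants_le c (Plus a b) \<longleftrightarrow> constants_le c a \<and> constants_le c b"
| "constants_le c (Minus a b) \<longleftrightarrow> constants_le c a \<and> constants_le c b"
| "constants_le c (Times a b) \<longleftrightarrow> constants_le c a \<and> constants_le c b"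
| "constants_le c (Div a b) \<longleftrightarrow> constants_le c a \<and> constants_le c b"

definition bounded_mem :: "nat \<Rightarrow> (nat \<Rightarrow> nat) \<Rightarrow> bool" where
  "bounded_mem V m \<longleftrightarrow> (\<forall>a. m a \<le> V)"

lemma esize_pos: "1 \<le> esize e"
  by (cases e) auto

text \<open>Both powers are at least 2, so their sum is at most their product, and one bound serves
  addition and multiplication alike.\<close>

lemma add_le_power_add:
  fixes V :: nat
  assumes "2 \<le> V" "x \<le> V ^ a" "y \<le> V ^ b" "1 \<le> a" "1 \<le> b"
  shows "x + y \<le> V ^ (a + b)" "x * y \<le> V ^ (a + b)"
proof -
  have V: "2 \<le> V ^ a" "2 \<le> V ^ b"
    using assms self_le_power[of V a] self_le_power[of V b] by auto
  have "V ^ a + V ^ b \<le> V ^ a * V ^ b"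
  proof (cases "V ^ a \<le> V ^ b")
    case True
    then have "V ^ a + V ^ b \<le> 2 * V ^ b" by simp
    also have "\<dots> \<le> V ^ a * V ^ b" using V by (intro mult_right_mono) auto
    finally show ?thesis .
  next
    case False
    then have "V ^ a + V ^ b \<le> V ^ a * 2" by simp
    also have "\<dots> \<le> V ^ a * V ^ b" using V by (intro mult_left_mono) auto
    finally show ?thesis .
  qed
  then show "x + y \<le> V ^ (a + b)" using assms by (simp add: power_add)
  show "x * y \<le> V ^ (a + b)" using assms by (simp add: power_add mult_mono)
qed

text \<open>Each operation at most multiplies the bounds of its arguments, so exponents add up along
  the tree. A \<open>Load\<close> yields at most \<open>V\<close>, whatever its address.\<close>

lemma val_le_power:
  assumes "bounded_mem V m" "constants_le V e" "2 \<le> V"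
  shows "val m e \<le> V ^ esize e"
proof -
  have mono: "x \<le> V ^ (j + k)" if "x \<le> V ^ j" for x j k
    using that assms(3) by (meson le_add1 le_trans one_le_numeral power_increasing)
  show ?thesis
    using assms(2)
  proof (induction e)
    case (Const c)
    then show ?case by simp
  next
    case (Load a)
    have "m (val m a) \<le> V ^ 1" using assms(1) by (simp add: bounded_mem_def)
    from mono[OF this, of "esize a"] show ?case by (simp add: add.commute)
  next
    case (Plus a b)
    have "val m a + val m b \<le> V ^ (esize a + esize b)"
      using Plus by (intro add_le_power_add assms esize_pos) auto
    from mono[OF this, of 1] show ?case by simp
  next
    case (Minus a b)
    have "val m a - val m b \<le> V ^ esize a" using Minus by simp
    from mono[OF this, of "esize b + 1"] show ?case by (simp add: add.assoc)
  next
    case (Times a b)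
    have "val m a * val m b \<le> V ^ (esize a + esize b)"
      using Times by (intro add_le_power_add assms esize_pos) auto
    from mono[OF this, of 1] show ?case by simp
  next
    case (Div a b)
    have "val m a div val m b \<le> V ^ esize a" using Div order.trans[OF div_le_dividend] by auto
    from mono[OF this, of "esize b + 1"] show ?case by (simp add: add.assoc)
  qed
qed

lemma bit_length_val_le:
  assumes "bounded_mem V m" "constants_le V e" "2 \<le> V"
  shows "bit_length (val m e) \<le> esize e * bit_length V"
proof (rule bit_length_le)
  have "val m e \<le> V ^ esize e" using assms by (rule val_le_power)
  also have "\<dots> < (2 ^ bit_length V) ^ esize e"
    using less_two_power_bit_length[of V] esize_pos[of e] by (intro power_strict_mono) auto
  finally show "val m e < 2 ^ (esize e * bit_length V)" by (metis mult.commute power_mult)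
  show "1 \<le> esize e * bit_length V" using esize_pos[of e] bit_length_pos[of V] using mult_le_mono[of 1 "esize e" 1 "bit_length V"] by simp
qed

text \<open>A node costs at most its size times \<open>w\<close>, and
  \<open>a^2 + b^2 + (a + b + 1)\<close> is at most \<open>(a + b + 1)^2\<close>. This makes the
  cost of an expression quadratic in its size.\<close>

lemma square_cost_add:
  fixes p q w :: nat
  assumes "p \<le> a\<^sup>2 * w" "q \<le> b\<^sup>2 * w" "r \<le> (a + b + 1) * w"
  shows "p + q + r \<le> (a + b + 1)\<^sup>2 * w"
proof -
  have "p + q + r \<le> (a\<^sup>2 + b\<^sup>2 + (a + b + 1)) * w"
    using assms by (simp add: distrib_right)
  also have "\<dots> \<le> (a + b + 1)\<^sup>2 * w"
    by (intro mult_right_mono) (auto simp: power2_eq_square algebra_simps)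
  finally show ?thesis .
qed

lemma cost_le:
  assumes m: "bounded_mem V m" and V: "2 \<le> V" and e: "constants_le V e"
  shows "cost m e \<le> (esize e)\<^sup>2 * bit_length V"
  using e
proof (induction e)
  case (Const n)
  then show ?case by (simp add: bit_length_mono)
next
  case (Load a)
  have "cost m a + 0 + bit_length (val m (Load a)) \<le> (esize a + 0 + 1)\<^sup>2 * bit_length V"
    using Load bit_length_val_le[OF m Load.prems V] by (intro square_cost_add) auto
  then show ?case by simp
next
  case (Plus a b)
  have "cost m a + cost m b + bit_length (val m (Plus a b)) \<le> (esize a + esize b + 1)\<^sup>2 * bit_length V"
    using Plus bit_length_val_le[OF m Plus.prems V] by (intro square_cost_add) auto
  then show ?case by simp
next
  case (Minus a b)
  have "cost m a + cost m b + bit_length (val m (Minus a b)) \<le> (esize a + esize b + 1)\<^sup>2 * bit_length V"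
    using Minus bit_length_val_le[OF m Minus.prems V] by (intro square_cost_add) auto
  then show ?case by simp
next
  case (Times a b)
  have "cost m a + cost m b + bit_length (val m (Times a b)) \<le> (esize a + esize b + 1)\<^sup>2 * bit_length V"
    using Times bit_length_val_le[OF m Times.prems V] by (intro square_cost_add) auto
  then show ?case by simp
next
  case (Div a b)
  have "cost m a + cost m b + bit_length (val m (Div a b)) \<le> (esize a + esize b + 1)\<^sup>2 * bit_length V"
    using Div bit_length_val_le[OF m Div.prems V] by (intro square_cost_add) auto
  then show ?case by simp
qed

text \<open>The program is fixed, so uniform constants suffice: 13, the base address of the
  denominators, is its largest literal, and 100 exceeds the size of each of its expressions.\<close>

definition small_expr :: "expr \<Rightarrow> bool" where
  "small_expr e \<longleftrightarrow> esize e \<le> 100 \<and> constants_le 13 e"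

lemma constants_le_mono: "constants_le c e \<Longrightarrow> c \<le> d \<Longrightarrow> constants_le d e"
  by (induction e) auto

lemma cost_small_expr:
  assumes "bounded_mem V m" "13 \<le> V" "small_expr e"
  shows "cost m e \<le> 10000 * bit_length V"
proof -
  have "cost m e \<le> (esize e)\<^sup>2 * bit_length V"
    using assms by (intro cost_le) (auto simp: small_expr_def intro: constants_le_mono)
  also have "\<dots> \<le> 100\<^sup>2 * bit_length V"
    using assms by (intro mult_right_mono power_mono) (auto simp: small_expr_def)
  finally show ?thesis by simp
qed

text \<open>\<open>N\<close> counts elementary steps.  While the memory is bounded by \<open>V\<close>, each of them, on
  expressions of constant size, costs at most a constant times the length of \<open>V\<close>.\<close>

definition steps :: "nat \<Rightarrow> prog \<Rightarrow> state \<Rightarrow> nat \<Rightarrow> state \<Rightarrow> bool" where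
  "steps V P s N s' \<longleftrightarrow> 13 \<le> V \<and> (\<exists>t \<le> N * (20001 * bit_length V). exec P s t s')"

lemma steps_mono: "steps V P s M s' \<Longrightarrow> M \<le> N \<Longrightarrow> steps V P s N s'"
  unfolding steps_def by (meson le_trans mult_le_mono1)

lemma steps_Seq:
  assumes "steps V P s M s'" "steps V Q s' N s''"
  shows "steps V (Seq P Q) s (M + N) s''"
proof -
  from assms obtain t u where V: "13 \<le> V" and t: "t \<le> M * (20001 * bit_length V)" "exec P s t s'"
    and u: "u \<le> N * (20001 * bit_length V)" "exec Q s' u s''"
    by (auto simp: steps_def)
  have "t + u \<le> (M + N) * (20001 * bit_length V)"
    using t(1) u(1) by (simp add: distrib_right)
  then show ?thesis unfolding steps_def using V exec.Seq[OF t(2) u(2)] by blast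
qed

lemma steps_Store:
  assumes "bounded_mem V m" "13 \<le> V" "small_expr a" "small_expr b"
    and "s' = (m(val m a := val m b), xs, ys)"
  shows "steps V (Store a b) (m, xs, ys) 1 s'"
proof -
  \<comment> \<open>Two expressions of cost at most \<open>10000 * bit_length V\<close> and one unit
    for the instruction: the origin of the factor 20001 in \<open>steps\<close>.\<close>
  have "1 + cost m a + cost m b \<le> 20001 * bit_length V"
    using cost_small_expr[OF assms(1,2,3)] cost_small_expr[OF assms(1,2,4)] bit_length_pos[of V]
    by linarith
  then show ?thesis unfolding steps_def using assms(2,5) exec.Store[of a b m xs ys] by auto
qed

lemma steps_Read:
  assumes "bounded_mem V m" "13 \<le> V" "small_expr a" "x \<le> V"
    and "s' = (m(val m a := x), xs, ys)"
  shows "steps V (Read a) (m, x # xs, ys) 1 s'"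
proof -
  have "1 + cost m a + bit_length x \<le> 20001 * bit_length V"
    using cost_small_expr[OF assms(1,2,3)] bit_length_mono[OF assms(4)] bit_length_pos[of V] by linarith
  then show ?thesis
    unfolding steps_def using assms(2,5) exec.Read[of a m "x # xs" ys] by (auto simp: next_input_def)
qed

lemma steps_Write:
  assumes "bounded_mem V m" "13 \<le> V" "small_expr a" and "s' = (m, xs, ys @ [val m a])"
  shows "steps V (Write a) (m, xs, ys) 1 s'"
proof -
  have "1 + cost m a \<le> 20001 * bit_length V"
    using cost_small_expr[OF assms(1,2,3)] bit_length_pos[of V] by linarith
  then show ?thesis unfolding steps_def using assms(2,4) exec.Write[of a m xs ys] by auto
qed

lemma test_cost:
  assumes "bounded_mem V m" "13 \<le> V" "small_expr b"
  shows "1 + cost m b \<le> 20001 * bit_length V"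
  using cost_small_expr[OF assms] bit_length_pos[of V] by linarith

lemma steps_Cond:
  assumes m: "bounded_mem V (fst s)" "small_expr b"
    and P: "val (fst s) b \<noteq> 0 \<Longrightarrow> steps V P s N s'"
    and Q: "val (fst s) b = 0 \<Longrightarrow> steps V Q s N s'"
  shows "steps V (Cond b P Q) s (N + 1) s'"
proof -
  have V: "13 \<le> V" using P Q by (cases "val (fst s) b = 0") (auto simp: steps_def)
  obtain t where t: "t \<le> N * (20001 * bit_length V)" "exec (Cond b P Q) s (1 + cost (fst s) b + t) s'"
  proof (cases "val (fst s) b = 0")
    case True
    then show ?thesis using Q exec.CondFalse[of s b Q _ s' P] that by (auto simp: steps_def)
  next
    case False
    then show ?thesis using P exec.CondTrue[of s b P _ s' Q] that by (auto simp: steps_def)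
  qed
  have "1 + cost (fst s) b + t \<le> (N + 1) * (20001 * bit_length V)"
    using test_cost[OF m(1) V m(2)] t(1) by (simp add: distrib_right)
  then show ?thesis unfolding steps_def using V t(2) by blast
qed

lemma steps_Loop_False:
  assumes "bounded_mem V (fst s)" "13 \<le> V" "small_expr b" "val (fst s) b = 0"
  shows "steps V (Loop b P) s 1 s"
  unfolding steps_def using test_cost[OF assms(1-3)] assms(2) exec.LoopFalse[of s b P, OF assms(4)] by auto

lemma steps_Loop_True:
  assumes "bounded_mem V (fst s)" "small_expr b" "val (fst s) b \<noteq> 0"
    and "steps V P s M s'" "steps V (Loop b P) s' N s''"
  shows "steps V (Loop b P) s (M + 1 + N) s''"
proof -
  from assms(4,5) obtain t u where V: "13 \<le> V" and t: "t \<le> M * (20001 * bit_length V)" "exec P s t s'"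
    and u: "u \<le> N * (20001 * bit_length V)" "exec (Loop b P) s' u s''"
    by (auto simp: steps_def)
  have "1 + cost (fst s) b + t + u \<le> (M + 1 + N) * (20001 * bit_length V)"
    using test_cost[OF assms(1) V assms(2)] t(1) u(1) by (simp add: distrib_right)
  then show ?thesis
    unfolding steps_def using V exec.LoopTrue[OF assms(3) t(2) u(2)] by blast
qed

text \<open>The states of a counting loop are known in advance, so the sequence \<open>S\<close>
  takes the place of an invariant. The induction is on the number of rounds still to come, because a
  loop unfolds at its front.\<close>

lemma steps_for_loop:
  assumes body: "\<And>i. i < N \<Longrightarrow> val (fst (S i)) b \<noteq> 0 \<and> steps V P (S i) c (S (Suc i))"
    and stop: "val (fst (S N)) b = 0"
    and bd: "\<And>i. i \<le> N \<Longrightarrow> bounded_mem V (fst (S i))" and b: "small_expr b" and V: "13 \<le> V"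
  shows "steps V (Loop b P) (S 0) (N * (c + 1) + 1) (S N)"
proof -
  have "steps V (Loop b P) (S (N - j)) (j * (c + 1) + 1) (S N)" if "j \<le> N" for j
    using that
  proof (induction j)
    case 0
    then show ?case using steps_Loop_False[OF bd[of N] V b stop] by simp
  next
    case (Suc j)
    have "Suc (N - Suc j) = N - j" using Suc.prems by simp
    then have "steps V P (S (N - Suc j)) c (S (N - j))" "val (fst (S (N - Suc j))) b \<noteq> 0"
      using body[of "N - Suc j"] Suc.prems by auto
    from steps_Loop_True[OF bd b this(2,1) Suc.IH] show ?case
      using Suc.prems by (simp add: algebra_simps)
  qed
  from this[of N] show ?thesis by simp
qed

text \<open>For the search, whose number of rounds is not known in advance: each round lowers
  \<open>\<mu>\<close>, which therefore bounds the number of rounds as well as ensuring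
  termination.\<close>

lemma steps_while:
  assumes body: "\<And>s. Inv s \<Longrightarrow> val (fst s) b \<noteq> 0 \<Longrightarrow> \<exists>s'. steps V P s c s' \<and> Inv s' \<and> \<mu> s' < \<mu> s"
    and bd: "\<And>s. Inv s \<Longrightarrow> bounded_mem V (fst s)" and b: "small_expr b" and V: "13 \<le> V"
    and "Inv s"
  shows "\<exists>s'. steps V (Loop b P) s (\<mu> s * (c + 1) + 1) s' \<and> Inv s' \<and> val (fst s') b = 0"
  using \<open>Inv s\<close>
proof (induction "\<mu> s" arbitrary: s rule: less_induct)
  case less
  show ?case
  proof (cases "val (fst s) b = 0")
    case True
    have "steps V (Loop b P) s (\<mu> s * (c + 1) + 1) s"
      by (rule steps_mono[OF steps_Loop_False[OF bd[OF less.prems] V b True]]) simp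
    then show ?thesis using less.prems True by blast
  next
    case False
    obtain s' where s': "steps V P s c s'" "Inv s'" "\<mu> s' < \<mu> s"
      using body[OF less.prems False] by blast
    obtain s'' where s'': "steps V (Loop b P) s' (\<mu> s' * (c + 1) + 1) s''" "Inv s''"
      "val (fst s'') b = 0"
      using less.hyps[OF s'(3,2)] by blast
    have "c + 1 + (\<mu> s' * (c + 1) + 1) = Suc (\<mu> s') * (c + 1) + 1" by simp
    also have "\<dots> \<le> \<mu> s * (c + 1) + 1"
      using s'(3) by (intro add_mono mult_right_mono) auto
    finally have "steps V (Loop b P) s (\<mu> s * (c + 1) + 1) s''"
      using steps_mono[OF steps_Loop_True[OF bd[OF less.prems] b False s'(1) s''(1)]] by blast
    then show ?thesis using s'' by blast
  qed
qed

subsection \<open>The search program\<close>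

text \<open>Registers 0 to 11 hold \<open>n\<close>, the product \<open>Q\<close> of all input denominators, the candidate
  denominator \<open>D\<close>, the candidate code \<open>x\<close>, the indices \<open>i, j, k\<close>, the accumulators for
  liability, assets and violation, the quotient of the digit extraction, and the number \<open>T\<close> of
  rationals in the input.  The input without its first entry is stored from address 12, the
  numerators of the candidate from address \<open>12 + 2 * T\<close>.\<close>

definition mem :: "nat list \<Rightarrow> (nat \<Rightarrow> nat) \<Rightarrow> nat \<Rightarrow> nat" where
  "mem regs arr = (\<lambda>a. if a < 12 then regs ! a else arr (a - 12))"

lemma mem_reg [simp]: "a < 12 \<Longrightarrow> mem regs arr a = regs ! a"
  by (simp add: mem_def)

lemma mem_array [simp]: "mem regs arr (12 + a) = arr a" "mem regs arr (13 + a) = arr (Suc a)"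
  by (simp_all add: mem_def Suc_diff_le)

lemma mem_update_reg [simp]:
  "length regs = 12 \<Longrightarrow> a < 12 \<Longrightarrow> (mem regs arr)(a := v) = mem (regs[a := v]) arr"
  by (auto simp: mem_def nth_list_update)

lemma mem_update_array [simp]:
  "(mem regs arr)(12 + a := v) = mem regs (arr(a := v))"
  "(mem regs arr)(13 + a := v) = mem regs (arr(Suc a := v))"
  by (auto simp: mem_def fun_eq_iff)

lemma bounded_mem_mem:
  "length regs = 12 \<Longrightarrow> bounded_mem V (mem regs arr) \<longleftrightarrow> (\<forall>v\<in>set regs. v \<le> V) \<and> (\<forall>a. arr a \<le> V)"
  unfolding bounded_mem_def mem_def
  by (auto simp: all_set_conv_all_nth) (metis add_diff_cancel_left' not_add_less1)

abbreviation "reg c \<equiv> Load (Const c)"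

text \<open>Rational number \<open>e\<close> of the input multiplied by \<open>Q\<close>. The
  division is exact because this denominator is a factor of \<open>Q\<close>, so the program
  computes with integers throughout.\<close>

abbreviation "rational_at e \<equiv>
  Times (Load (Plus (Const 12) (Times (Const 2) e)))
    (Div (reg 1) (Load (Plus (Const 13) (Times (Const 2) e))))"

abbreviation "candidate_at e \<equiv> Load (Plus (Const 12) (Plus (Times (Const 2) (reg 11)) e))"

text \<open>The offsets follow the encoding: \<open>n\<close> external assets, then
  \<open>n * n\<close> debts, then the CDSs, with debts and CDSs in row-major order.\<close>

abbreviation "debt_at i j \<equiv> rational_at (Plus (reg 0) (Plus (Times i (reg 0)) j))"

abbreviation "cds_at i j k \<equiv>
  rational_at (Plus (Plus (reg 0) (Times (reg 0) (reg 0)))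
    (Plus (Times (Plus (Times i (reg 0)) j) (reg 0)) k))"

abbreviation "increment c \<equiv> Store (Const c) (Plus (reg c) (Const 1))"

text \<open>One pass over the reference banks serves two sums: the CDS from bank \<open>i\<close>
  (register 4) to bank \<open>j\<close> (register 5) enters the liabilities of \<open>i\<close>, the
  one from \<open>j\<close> to \<open>i\<close> enters its assets.\<close>

definition cds_loop :: prog where
  "cds_loop = Loop (Minus (reg 0) (reg 6))
     (Seq (Store (Const 7) (Plus (reg 7)
        (Times (Minus (reg 2) (candidate_at (reg 6))) (cds_at (reg 4) (reg 5) (reg 6)))))
     (Seq (Store (Const 8) (Plus (reg 8)
        (Times (Times (candidate_at (reg 5)) (Minus (reg 2) (candidate_at (reg 6))))
          (cds_at (reg 5) (reg 4) (reg 6)))))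
        (increment 6)))"

definition counterparty_loop :: prog where
  "counterparty_loop = Loop (Minus (reg 0) (reg 5))
     (Seq (Store (Const 7) (Plus (reg 7) (Times (reg 2) (debt_at (reg 4) (reg 5)))))
     (Seq (Store (Const 8) (Plus (reg 8)
        (Times (Times (reg 2) (candidate_at (reg 5))) (debt_at (reg 5) (reg 4)))))
     (Seq (Store (Const 6) (Const 0))
     (Seq cds_loop (increment 5)))))"

abbreviation "violation_expr \<equiv>
  (let v = Times (candidate_at (reg 4)) (reg 7);
       u = Times (reg 2) (reg 7); w = Minus u (Minus u (reg 8))
   in Plus (Plus (Minus v w) (Minus w v))
        (Times (Minus (reg 2) (candidate_at (reg 4))) (Minus (Const 1) (reg 7))))"

definition bank_loop :: prog where
  "bank_loop = Loop (Minus (reg 0) (reg 4))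
     (Seq (Store (Const 7) (Const 0))
     (Seq (Store (Const 8) (Times (Times (reg 2) (reg 2)) (rational_at (reg 4))))
     (Seq (Store (Const 5) (Const 0))
     (Seq counterparty_loop
     (Seq (Store (Const 9) (Plus (reg 9) violation_expr))
        (increment 4))))))"

text \<open>Expressions offer integer division only, so a remainder is the dividend minus the
  quotient times \<open>D + 1\<close>.\<close>

definition digit_loop :: prog where
  "digit_loop = Loop (Minus (reg 0) (reg 4))
     (Seq (Store (Plus (Const 12) (Plus (Times (Const 2) (reg 11)) (reg 4)))
        (Minus (reg 10) (Times (Div (reg 10) (Plus (reg 2) (Const 1))) (Plus (reg 2) (Const 1)))))
     (Seq (Store (Const 10) (Div (reg 10) (Plus (reg 2) (Const 1))))
        (increment 4)))"

text \<open>Codes \<open>x\<close> are tried without computing \<open>(D + 1) ^ n\<close>: once \<open>x\<close> has reached it, a nonzero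
  quotient is left in register 10 after \<open>n\<close> digits.  This quotient counts as a violation and
  makes the search pass on to the next denominator.\<close>

definition candidate_step :: prog where
  "candidate_step =
     (Seq (Store (Const 10) (reg 3))
     (Seq (Store (Const 4) (Const 0))
     (Seq digit_loop
     (Seq (Store (Const 9) (reg 10))
     (Seq (Store (Const 4) (Const 0))
     (Seq bank_loop
        (Cond (reg 10) (Seq (increment 2) (Store (Const 3) (Const 0))) (increment 3))))))))"

definition search_loop :: prog where "search_loop = Loop (reg 9) candidate_step"

section \<open>Candidates as numerals in base \<open>D + 1\<close>\<close>

definition digit :: "nat \<Rightarrow> nat \<Rightarrow> nat \<Rightarrow> nat" where
  "digit D x i = x div (D + 1) ^ i - x div (D + 1) ^ i div (D + 1) * (D + 1)"

lemma digit_mod: "digit D x i = x div (D + 1) ^ i mod (D + 1)"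
  by (simp only: digit_def minus_div_mult_eq_mod)

lemma digit_le: "digit D x i \<le> D"
  unfolding digit_mod using mod_less_divisor[of "D + 1"] by (simp add: less_Suc_eq_le)

text \<open>Horner's scheme: \<open>y 0\<close> is the last digit, and the shifted sequence is coded
  in the quotient. Hence enumerating the codes below \<open>(D + 1) ^ n\<close> misses no candidate
  with denominator \<open>D\<close>.\<close>

lemma digits_exist:
  "\<forall>i<m. y i \<le> D \<Longrightarrow> \<exists>x < (D + 1) ^ m. \<forall>i<m. digit D x i = y i"
proof (induction m arbitrary: y)
  case (Suc m)
  then have "\<forall>i<m. y (Suc i) \<le> D" by simp
  then obtain x where x: "x < (D + 1) ^ m" "\<And>i. i < m \<Longrightarrow> digit D x i = y (Suc i)"
    using Suc.IH[of "\<lambda>i. y (Suc i)"] by blast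
  have y0: "y 0 < D + 1" using Suc.prems by (simp add: less_Suc_eq_le)
  let ?x = "y 0 + (D + 1) * x"
  have div: "?x div (D + 1) = x"
    using y0 by (subst div_mult_self2) auto
  have shift: "?x div (D + 1) ^ Suc i = x div (D + 1) ^ i" for i
    by (simp only: power_Suc div_mult2_eq div)
  have "?x < (D + 1) * (x + 1)" using y0 by simp
  also have "\<dots> \<le> (D + 1) * (D + 1) ^ m" using x(1) by (intro mult_left_mono) auto
  finally have "?x < (D + 1) ^ Suc m" by simp
  moreover have "digit D ?x i = y i" if "i < Suc m" for i
  proof (cases i)
    case 0
    then show ?thesis using y0 by (simp add: digit_mod del: mult_Suc)
  next
    case (Suc i')
    then show ?thesis using x(2)[of i'] that unfolding digit_mod by (simp only: shift)
  qed
  ultimately show ?case by blast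
qed simp

subsection \<open>Correctness of the search\<close>

text \<open>\<open>B\<close> bounds what is read or enumerated, \<open>V\<close> what is stored.
  Intermediate values inside expressions may exceed \<open>V\<close>; they are accounted for by
  \<open>cost_le\<close>. The tapes \<open>xs\<close> and \<open>ys\<close> are parameters because
  the search leaves them alone.\<close>

locale candidate_check =
  fixes n T Q B V :: nat and inp :: "nat \<Rightarrow> nat" and xs ys :: "nat list"
  assumes n: "n \<le> B" and T: "T = n + n * n + n * n * n" "T \<le> B" and Q: "Q \<le> B"
    and inp: "\<And>a. inp a \<le> B" and B: "13 \<le> B" and V: "B ^ 10 \<le> V"
begin

definition rat_at :: "nat \<Rightarrow> nat" where "rat_at e = inp (2 * e) * (Q div inp (Suc (2 * e)))"
definition E where "E i = rat_at i"
definition C where "C i j = rat_at (n + (i * n + j))"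
definition S where "S i j k = rat_at (n + n * n + ((i * n + j) * n + k))"

definition cells :: "(nat \<Rightarrow> nat) \<Rightarrow> nat \<Rightarrow> nat" where
  "cells X = (\<lambda>a. if a < 2 * T then inp a else X (a - 2 * T))"

lemma cells_candidate [simp]: "cells X (2 * T + i) = X i"
  by (simp add: cells_def)

lemma cells_update [simp]: "(cells X)(2 * T + i := v) = cells (X(i := v))"
  by (auto simp: cells_def fun_eq_iff)

lemma cells_input: "e < T \<Longrightarrow> cells X (2 * e) * (Q div cells X (Suc (2 * e))) = rat_at e"
  by (simp add: cells_def rat_at_def)

lemma index_less:
  assumes "i < n" "j < n" shows "i * n + j < n * n"
proof -
  have "i * n + j < Suc i * n" using assms by simp
  also have "\<dots> \<le> n * n" using assms by (intro mult_right_mono) auto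
  finally show ?thesis .
qed

lemma index_less3:
  assumes "i < n" "j < n" "k < n" shows "(i * n + j) * n + k < n * n * n"
proof -
  have "(i * n + j) * n + k < Suc (i * n + j) * n" using assms by simp
  also have "\<dots> \<le> n * n * n" using index_less[OF assms(1,2)] by (intro mult_right_mono) auto
  finally show ?thesis .
qed

lemma cells_E: "i < n \<Longrightarrow> cells X (2 * i) * (Q div cells X (Suc (2 * i))) = E i"
  unfolding E_def by (rule cells_input) (simp add: T)

lemma cells_C: "i < n \<Longrightarrow> j < n \<Longrightarrow>
    cells X (2 * (n + (i * n + j))) * (Q div cells X (Suc (2 * (n + (i * n + j))))) = C i j"
  unfolding C_def by (rule cells_input) (use index_less[of i j] in \<open>simp add: T\<close>)

lemma cells_S: "i < n \<Longrightarrow> j < n \<Longrightarrow> k < n \<Longrightarrow>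
    cells X (2 * (n + n * n + ((i * n + j) * n + k))) *
      (Q div cells X (Suc (2 * (n + n * n + ((i * n + j) * n + k))))) = S i j k"
  unfolding S_def by (rule cells_input) (use index_less3[of i j k] in \<open>simp add: T\<close>)

lemma rat_at_le: "rat_at e \<le> B ^ 2"
  unfolding rat_at_def power2_eq_square
  using inp Q by (intro mult_mono) (auto intro: order.trans[OF div_le_dividend])

lemma power_le_V: "t \<le> B ^ k \<Longrightarrow> k \<le> 10 \<Longrightarrow> t \<le> V"
  using V B power_increasing[of k 10 B] by linarith

text \<open>The arguments are registers 2 to 10 in this order, followed by the candidate; registers
  0, 1 and 11 are constant during the search.\<close>

definition st where
  "st D x i j k l a b q X = ((mem [n, Q, D, x, i, j, k, l, a, b, q, T] (cells X), xs, ys) :: state)"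

lemma bounded_st:
  assumes "D \<le> V" "x \<le> V" "i \<le> V" "j \<le> V" "k \<le> V" "l \<le> V" "a \<le> V" "b \<le> V" "q \<le> V" "\<And>i. X i \<le> V"
  shows "bounded_mem V (mem [n, Q, D, x, i, j, k, l, a, b, q, T] (cells X))"
proof -
  have "B \<le> V" by (rule power_le_V[of _ 1]) auto
  then have "n \<le> V" "Q \<le> V" "T \<le> V" "\<And>a. inp a \<le> V" using n T Q inp order.trans by blast+
  then show ?thesis using assms by (simp add: bounded_mem_mem cells_def)
qed

lemma V13: "13 \<le> V" using power_le_V[of 13 1] B by simp

text \<open>Since \<open>S\<close> is at most \<open>B ^ 2\<close>, the accumulators grow by at most
  \<open>n * B ^ 3\<close> and \<open>n * B ^ 4\<close> in \<open>n\<close> rounds; the last two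
  assumptions reserve this room below \<open>V\<close>. A round is three stores and a test, and one
  test ends the loop.\<close>

lemma steps_cds_loop:
  assumes D: "D \<le> B" and X: "\<And>i. X i \<le> B" and le: "x \<le> V" "b \<le> V" "q \<le> V" and ij: "i < n" "j < n"
    and l: "l + n * B ^ 3 \<le> V" and a: "a + n * B ^ 4 \<le> V"
  shows "steps V cds_loop (st D x i j 0 l a b q X) (n * 4 + 1)
    (st D x i j n (l + (\<Sum>k<n. (D - X k) * S i j k)) (a + (\<Sum>k<n. X j * (D - X k) * S j i k)) b q X)"
proof -
  define st' where "st' k = st D x i j k (l + (\<Sum>k<k. (D - X k) * S i j k))
    (a + (\<Sum>k<k. X j * (D - X k) * S j i k)) b q X" for k
  have S: "S i j k \<le> B ^ 2" for i j k by (simp add: S_def rat_at_le)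
  have "(\<Sum>k<k. (D - X k) * S i j k) \<le> k * B ^ 3" for k
  proof -
    have "(D - X k) * S i j k \<le> B * B ^ 2" for k using D S by (intro mult_mono) auto
    then have "(D - X k) * S i j k \<le> B ^ 3" for k by (simp add: power3_eq_cube power2_eq_square mult.assoc)
    then show ?thesis
      using sum_bounded_above[of "{..<k}" "\<lambda>k. (D - X k) * S i j k" "B ^ 3"] by simp
  qed
  moreover have "(\<Sum>k<k. X j * (D - X k) * S j i k) \<le> k * B ^ 4" for k
  proof -
    have "X j * (D - X k) * S j i k \<le> B * B * B ^ 2" for k using D S X by (intro mult_mono) auto
    then have "X j * (D - X k) * S j i k \<le> B ^ 4" for k by (simp add: power4_eq_xxxx power2_eq_square mult.assoc)
    then show ?thesis
      using sum_bounded_above[of "{..<k}" "\<lambda>k. X j * (D - X k) * S j i k" "B ^ 4"] by simp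
  qed
  moreover have "k * B ^ p \<le> n * B ^ p" if "k \<le> n" for k p using that by simp
  ultimately have lk: "l + (\<Sum>k<k. (D - X k) * S i j k) \<le> V"
    and ak: "a + (\<Sum>k<k. X j * (D - X k) * S j i k) \<le> V" if "k \<le> n" for k
    using that l a by (meson add_left_mono order.trans)+
  have BV: "B \<le> V" by (rule power_le_V[of _ 1]) auto
  have DV: "D \<le> V" and XV: "X i \<le> V" and nV: "n \<le> V" for i using D X n BV order.trans by blast+
  have bd: "bounded_mem V (mem [n, Q, D, x, i, j, k, l', a', b, q, T] (cells X))"
    if "k \<le> n" "l' \<le> V" "a' \<le> V" for k l' a'
    by (rule bounded_st) (use that DV XV le nV ij in auto)
  have "steps V cds_loop (st' 0) (n * (1 + (1 + 1) + 1) + 1) (st' n)"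
    unfolding cds_loop_def
  proof (rule steps_for_loop)
    fix k assume k: "k < n"
    let ?l = "\<lambda>k. l + (\<Sum>k<k. (D - X k) * S i j k)"
    let ?a = "\<lambda>k. a + (\<Sum>k<k. X j * (D - X k) * S j i k)"
    show "val (fst (st' k)) (Minus (reg 0) (reg 6)) \<noteq> 0 \<and>
      steps V (Seq (Store (Const 7) (Plus (reg 7)
        (Times (Minus (reg 2) (candidate_at (reg 6))) (cds_at (reg 4) (reg 5) (reg 6)))))
     (Seq (Store (Const 8) (Plus (reg 8)
        (Times (Times (candidate_at (reg 5)) (Minus (reg 2) (candidate_at (reg 6))))
          (cds_at (reg 5) (reg 4) (reg 6)))))
        (increment 6))) (st' k) (1 + (1 + 1)) (st' (Suc k))"
    proof (intro conjI steps_Seq)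
      show "val (fst (st' k)) (Minus (reg 0) (reg 6)) \<noteq> 0"
        using k by (simp add: st'_def st_def)
      show "steps V (Store (Const 7) (Plus (reg 7)
        (Times (Minus (reg 2) (candidate_at (reg 6))) (cds_at (reg 4) (reg 5) (reg 6)))))
        (st' k) 1 (st D x i j k (?l (Suc k)) (?a k) b q X)"
        unfolding st'_def st_def
        by (rule steps_Store[OF bd V13])
          (use k lk[of k] ak[of k] ij cells_S[OF ij k] in \<open>simp_all add: small_expr_def add.assoc\<close>)
      show "steps V (Store (Const 8) (Plus (reg 8)
        (Times (Times (candidate_at (reg 5)) (Minus (reg 2) (candidate_at (reg 6))))
          (cds_at (reg 5) (reg 4) (reg 6)))))
        (st D x i j k (?l (Suc k)) (?a k) b q X) 1 (st D x i j k (?l (Suc k)) (?a (Suc k)) b q X)"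
        unfolding st_def
        by (rule steps_Store[OF bd V13])
          (use k lk[of "Suc k"] ak[of k] ij cells_S[OF ij(2,1) k] in \<open>simp_all add: small_expr_def add.assoc\<close>)
      show "steps V (increment 6) (st D x i j k (?l (Suc k)) (?a (Suc k)) b q X) 1 (st' (Suc k))"
        unfolding st'_def st_def
        by (rule steps_Store[OF bd V13])
          (use k lk[of "Suc k"] ak[of "Suc k"] in \<open>simp_all add: small_expr_def\<close>)
    qed
  next
    show "val (fst (st' n)) (Minus (reg 0) (reg 6)) = 0" by (simp add: st'_def st_def)
    show "bounded_mem V (fst (st' k))" if "k \<le> n" for k
      unfolding st'_def st_def fst_conv by (rule bd) (use that lk ak in auto)
  qed (simp_all add: small_expr_def V13)
  moreover have "n * (1 + (1 + 1) + 1) + 1 = n * 4 + 1" by simp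
  ultimately have "steps V cds_loop (st' 0) (n * 4 + 1) (st' n)" by (simp only:)
  then show ?thesis by (simp add: st'_def)
qed

section \<open>Bounds on liabilities and assets as powers of \<open>B\<close>\<close>

definition liability_part where
  "liability_part D X i j = D * C i j + (\<Sum>k<n. (D - X k) * S i j k)"

definition assets_part where
  "assets_part D X i j = D * X j * C j i + (\<Sum>k<n. X j * (D - X k) * S j i k)"

text \<open>Each factor \<open>n\<close> and each factor 2 is paid for by one more power of
  \<open>B\<close>. Constants are absorbed in this way throughout, so that bounds become pure powers
  of \<open>B\<close>.\<close>

lemma n_times_le: "n * (B ^ p + n * B ^ p) \<le> B ^ (p + 3)"
proof -
  have "n * (B ^ p + n * B ^ p) \<le> B * (B * B ^ p + B * B ^ p)"
    using n B by (intro mult_mono add_mono) auto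
  also have "\<dots> = 2 * (B * B * B ^ p)" by simp
  also have "\<dots> \<le> B * (B * B * B ^ p)" using B by (intro mult_right_mono) auto
  finally show ?thesis by (simp add: power_add power3_eq_cube mult_ac)
qed

context
  fixes D :: nat and X :: "nat \<Rightarrow> nat"
  assumes D: "D \<le> B" and X: "\<And>i. X i \<le> B"
begin

lemma parts_le:
  "D * C i j \<le> B ^ 3" "D * X j * C j i \<le> B ^ 4" "D * D * E i \<le> B ^ 4"
  "(D - X k) * S i j k \<le> B ^ 3" "X j * (D - X k) * S j i k \<le> B ^ 4"
proof -
  have rat: "C i j \<le> B ^ 2" "E i \<le> B ^ 2" "S i j k \<le> B ^ 2" for i j k
    by (simp_all add: C_def E_def S_def rat_at_le)
  show "D * C i j \<le> B ^ 3"
    using mult_mono[OF D rat(1)[of i j]] by (simp add: power3_eq_cube power2_eq_square mult.assoc)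
  show "D * X j * C j i \<le> B ^ 4"
    using mult_mono[OF mult_mono[OF D X[of j]] rat(1)[of j i]] by (simp add: power4_eq_xxxx power2_eq_square mult.assoc)
  show "D * D * E i \<le> B ^ 4"
    using mult_mono[OF mult_mono[OF D D] rat(2)[of i]] by (simp add: power4_eq_xxxx power2_eq_square mult.assoc)
  show "(D - X k) * S i j k \<le> B ^ 3"
    using mult_mono[OF _ rat(3)[of i j k], of "D - X k" B] D by (simp add: power3_eq_cube power2_eq_square mult.assoc)
  show "X j * (D - X k) * S j i k \<le> B ^ 4"
    using mult_mono[OF mult_mono[OF X[of j], of "D - X k" B] rat(3)[of j i k]] D
    by (simp add: power4_eq_xxxx power2_eq_square mult.assoc)
qed

text \<open>The first form leaves room for one more counterparty, as the premises of
  \<open>steps_cds_loop\<close> require; the second covers the states between rounds.\<close>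

lemma liability_parts_le:
  "j < n \<Longrightarrow> (\<Sum>j<j. liability_part D X i j) + B ^ 3 + n * B ^ 3 \<le> B ^ 6"
  "j \<le> n \<Longrightarrow> (\<Sum>j<j. liability_part D X i j) \<le> B ^ 6"
proof -
  have "(\<Sum>k<n. (D - X k) * S i j k) \<le> n * B ^ 3" for j
    using sum_bounded_above[of "{..<n}" "\<lambda>k. (D - X k) * S i j k" "B ^ 3"] parts_le(4) by simp
  then have "liability_part D X i j \<le> B ^ 3 + n * B ^ 3" for j
    unfolding liability_part_def by (intro add_mono parts_le)
  then have sl: "(\<Sum>j<j. liability_part D X i j) \<le> j * (B ^ 3 + n * B ^ 3)" for j
    using sum_bounded_above[of "{..<j}" "liability_part D X i" "B ^ 3 + n * B ^ 3"] by simp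
  have *: "m * (B ^ 3 + n * B ^ 3) \<le> B ^ 6" if "m \<le> n" for m
    by (rule order.trans[OF mult_le_mono1[OF that]]) (use n_times_le[of 3] in simp)
  show "(\<Sum>j<j. liability_part D X i j) \<le> B ^ 6" if "j \<le> n"
    using sl[of j] *[OF that] by simp
  show "(\<Sum>j<j. liability_part D X i j) + B ^ 3 + n * B ^ 3 \<le> B ^ 6" if "j < n"
    using sl[of j] *[of "Suc j"] that by simp
qed

lemma assets_parts_le:
  "j < n \<Longrightarrow> D * D * E i + (\<Sum>j<j. assets_part D X i j) + B ^ 4 + n * B ^ 4 \<le> B ^ 8"
  "j \<le> n \<Longrightarrow> D * D * E i + (\<Sum>j<j. assets_part D X i j) \<le> B ^ 8"
proof -
  have "(\<Sum>k<n. X j * (D - X k) * S j i k) \<le> n * B ^ 4" for j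
    using sum_bounded_above[of "{..<n}" "\<lambda>k. X j * (D - X k) * S j i k" "B ^ 4"] parts_le(5) by simp
  then have "assets_part D X i j \<le> B ^ 4 + n * B ^ 4" for j
    unfolding assets_part_def by (intro add_mono parts_le)
  then have sa: "(\<Sum>j<j. assets_part D X i j) \<le> j * (B ^ 4 + n * B ^ 4)" for j
    using sum_bounded_above[of "{..<j}" "assets_part D X i" "B ^ 4 + n * B ^ 4"] by simp
  have *: "m * (B ^ 4 + n * B ^ 4) \<le> B ^ 7" if "m \<le> n" for m
    by (rule order.trans[OF mult_le_mono1[OF that]]) (use n_times_le[of 4] in simp)
  have "B ^ 4 + B ^ 7 \<le> 2 * B ^ 7" using power_increasing[of 4 7 B] B by simp
  also have "\<dots> \<le> B * B ^ 7" using B by (intro mult_right_mono) auto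
  finally have B8: "B ^ 4 + B ^ 7 \<le> B ^ 8" by (simp flip: power_Suc)
  show "D * D * E i + (\<Sum>j<j. assets_part D X i j) \<le> B ^ 8" if "j \<le> n"
    using parts_le(3)[of i] sa[of j] *[OF that] B8 by linarith
  show "D * D * E i + (\<Sum>j<j. assets_part D X i j) + B ^ 4 + n * B ^ 4 \<le> B ^ 8" if "j < n"
    using parts_le(3)[of i] sa[of j] *[of "Suc j"] that B8 by simp
qed

lemma scaled_bounds:
  "scaled_liability n C S D X i \<le> B ^ 6" "scaled_assets n E C S D X i \<le> B ^ 8"
  using liability_parts_le(2)[of n i] assets_parts_le(2)[of n i]
  by (simp_all add: scaled_liability_def scaled_assets_def liability_part_def assets_part_def)

end

lemma steps_counterparty_loop:
  assumes D: "D \<le> B" and X: "\<And>i. X i \<le> B" and le: "x \<le> V" "k0 \<le> V" "b \<le> V" "q \<le> V" and i: "i < n"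
  shows "steps V counterparty_loop (st D x i 0 k0 0 (D * D * E i) b q X) (n * (4 * n + 6) + 1)
    (st D x i n n (scaled_liability n C S D X i) (scaled_assets n E C S D X i) b q X)"
proof -
  let ?l = "\<lambda>j. \<Sum>j<j. liability_part D X i j"
  let ?a = "\<lambda>j. D * D * E i + (\<Sum>j<j. assets_part D X i j)"
  \<comment> \<open>Register 6 holds a leftover before the first round and the exit value
    \<open>n\<close> of the inner loop before every later one.\<close>
  let ?k = "\<lambda>j. if j = 0 then k0 else n"
  define st' where "st' j = st D x i j (?k j) (?l j) (?a j) b q X" for j
  note parts = liability_part_def assets_part_def
  have DC: "D * C i j \<le> B ^ 3" and DXC: "D * X j * C j i \<le> B ^ 4" for i j
    by (rule parts_le[OF D X])+
  have lV: "?l j + B ^ 3 + n * B ^ 3 \<le> V" if "j < n" for j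
    using liability_parts_le(1)[OF D X that] by (rule power_le_V) simp
  have aV: "?a j + B ^ 4 + n * B ^ 4 \<le> V" if "j < n" for j
    using assets_parts_le(1)[OF D X that] by (rule power_le_V) simp
  have lV': "?l j \<le> V" if "j \<le> n" for j
    using liability_parts_le(2)[OF D X that] by (rule power_le_V) simp
  have aV': "?a j \<le> V" if "j \<le> n" for j
    using assets_parts_le(2)[OF D X that] by (rule power_le_V) simp
  have BV: "B \<le> V" by (rule power_le_V[of _ 1]) auto
  have DV: "D \<le> V" and XV: "X i \<le> V" and nV: "n \<le> V" for i using D X n BV order.trans by blast+
  have bd: "bounded_mem V (mem [n, Q, D, x, i, j, k, l', a', b, q, T] (cells X))"
    if "j \<le> n" "k \<le> V" "l' \<le> V" "a' \<le> V" for j k l' a'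
    by (rule bounded_st) (use that DV XV le nV i in auto)
  have "steps V counterparty_loop (st' 0) (n * (1 + (1 + (1 + ((n * 4 + 1) + 1))) + 1) + 1) (st' n)"
    unfolding counterparty_loop_def
  proof (rule steps_for_loop)
    fix j assume j: "j < n"
    have kV: "?k j \<le> V" using le nV by simp
    show "val (fst (st' j)) (Minus (reg 0) (reg 5)) \<noteq> 0 \<and>
      steps V (Seq (Store (Const 7) (Plus (reg 7) (Times (reg 2) (debt_at (reg 4) (reg 5)))))
       (Seq (Store (Const 8) (Plus (reg 8)
          (Times (Times (reg 2) (candidate_at (reg 5))) (debt_at (reg 5) (reg 4)))))
       (Seq (Store (Const 6) (Const 0))
       (Seq cds_loop (increment 5))))) (st' j) (1 + (1 + (1 + ((n * 4 + 1) + 1)))) (st' (Suc j))"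
    proof (intro conjI steps_Seq)
      show "val (fst (st' j)) (Minus (reg 0) (reg 5)) \<noteq> 0"
        using j by (simp add: st'_def st_def)
      show "steps V (Store (Const 7) (Plus (reg 7) (Times (reg 2) (debt_at (reg 4) (reg 5)))))
          (st' j) 1 (st D x i j (?k j) (?l j + D * C i j) (?a j) b q X)"
        unfolding st'_def st_def
        by (rule steps_Store[OF bd V13])
          (use kV j lV'[of j] aV'[of j] i cells_C[OF i j] in \<open>simp_all add: small_expr_def\<close>)
      show "steps V (Store (Const 8) (Plus (reg 8)
          (Times (Times (reg 2) (candidate_at (reg 5))) (debt_at (reg 5) (reg 4)))))
          (st D x i j (?k j) (?l j + D * C i j) (?a j) b q X) 1
          (st D x i j (?k j) (?l j + D * C i j) (?a j + D * X j * C j i) b q X)"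
        unfolding st_def
        by (rule steps_Store[OF bd V13])
          (use kV j lV[OF j] DC[of i j] aV'[of j] i cells_C[OF j i] in \<open>simp_all add: small_expr_def\<close>)
      show "steps V (Store (Const 6) (Const 0))
          (st D x i j (?k j) (?l j + D * C i j) (?a j + D * X j * C j i) b q X) 1
          (st D x i j 0 (?l j + D * C i j) (?a j + D * X j * C j i) b q X)"
        unfolding st_def
        by (rule steps_Store[OF bd V13])
          (use kV j lV[OF j] DC[of i j] aV[OF j] DXC[of j i] in \<open>simp_all add: small_expr_def\<close>)
      show "steps V cds_loop (st D x i j 0 (?l j + D * C i j) (?a j + D * X j * C j i) b q X)
          (n * 4 + 1) (st D x i j n (?l (Suc j)) (?a (Suc j)) b q X)"
        using steps_cds_loop[OF D X le(1,3,4) i j, of "?l j + D * C i j" "?a j + D * X j * C j i"]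
          lV[OF j] DC[of i j] aV[OF j] DXC[of j i]
        by (simp add: parts add.assoc)
      show "steps V (increment 5) (st D x i j n (?l (Suc j)) (?a (Suc j)) b q X) 1 (st' (Suc j))"
        unfolding st'_def st_def
        by (rule steps_Store[OF bd V13])
          (use nV j lV'[of "Suc j"] aV'[of "Suc j"] in \<open>simp_all add: small_expr_def\<close>)
    qed
  next
    show "val (fst (st' n)) (Minus (reg 0) (reg 5)) = 0" by (simp add: st'_def st_def)
    show "bounded_mem V (fst (st' j))" if "j \<le> n" for j
      unfolding st'_def st_def fst_conv by (rule bd) (use that lV' aV' le nV in auto)
  qed (simp_all add: small_expr_def V13)
  moreover have "1 + (1 + (1 + ((n * 4 + 1) + 1))) + 1 = 4 * n + 6" by simp
  moreover have "?l n = scaled_liability n C S D X i" "?a n = scaled_assets n E C S D X i"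
    by (simp_all add: scaled_liability_def scaled_assets_def parts)
  moreover have "n \<noteq> 0" using i by simp
  ultimately show ?thesis by (simp add: st'_def distrib_left mult_ac add_ac)
qed

text \<open>Assets enter only through their minimum with \<open>D * u\<close>, so every term is at
  most \<open>B ^ 7\<close>. Of the two truncated differences at most one is nonzero, which leaves a
  factor 2.\<close>

lemma violation_le:
  assumes D: "D \<le> B" and X: "\<And>i. X i \<le> B"
  shows "violation n E C S D X i \<le> B ^ 8"
proof -
  define u where "u = scaled_liability n C S D X i"
  define v where "v = scaled_assets n E C S D X i"
  have u: "u \<le> B ^ 6" using scaled_bounds[OF D X] by (simp add: u_def)
  have "D * u \<le> B * B ^ 6" using D u by (rule mult_le_mono)
  moreover have "X i * u \<le> B * B ^ 6" using X u by (rule mult_le_mono)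
  moreover have "(D - X i) * (1 - u) \<le> B * 1" using D by (intro mult_le_mono) auto
  moreover have "B * 1 \<le> B * B ^ 6" using B by (intro mult_le_mono) auto
  ultimately have "violation n E C S D X i \<le> 2 * (B * B ^ 6)"
    unfolding violation_def u_def[symmetric] v_def[symmetric] Let_def by linarith
  also have "\<dots> \<le> B * (B * B ^ 6)" using B by (intro mult_right_mono) auto
  finally show ?thesis by (simp flip: power_Suc)
qed

text \<open>Register 9 needs the most room: up to \<open>n\<close> violations of at most
  \<open>B ^ 8\<close> each, added to the leftover quotient \<open>q\<close>. This is the origin of
  the exponent 10 in the bound on \<open>V\<close>.\<close>

lemma sum_violation_le:
  assumes D: "D \<le> B" and X: "\<And>i. X i \<le> B" and m: "m \<le> n" and q: "q \<le> B"
  shows "q + (\<Sum>i<m. violation n E C S D X i) \<le> B ^ 10"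
proof -
  have "(\<Sum>i<m. violation n E C S D X i) \<le> m * B ^ 8"
    using sum_bounded_above[of "{..<m}" "violation n E C S D X" "B ^ 8"] violation_le[OF D X] by simp
  also have "\<dots> \<le> B * B ^ 8" using m n by (intro mult_right_mono) auto
  finally have "q + (\<Sum>i<m. violation n E C S D X i) \<le> B + B * B ^ 8" using q by simp
  also have "\<dots> \<le> 2 * (B * B ^ 8)" using B by simp
  also have "\<dots> \<le> B * (B * B ^ 8)" using B by (intro mult_right_mono) auto
  finally show ?thesis by (simp flip: power_Suc)
qed

lemma steps_bank_loop:
  assumes D: "D \<le> B" and X: "\<And>i. X i \<le> B"
    and le: "x \<le> V" "j0 \<le> V" "k0 \<le> V" "l0 \<le> V" "a0 \<le> V" "q \<le> B" and n0: "0 < n"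
  shows "\<exists>l \<le> V. \<exists>a \<le> V. steps V bank_loop (st D x 0 j0 k0 l0 a0 q q X) (n * (n * (4 * n + 6) + 7) + 1)
    (st D x n n n l a (q + (\<Sum>i<n. violation n E C S D X i)) q X)"
proof -
  \<comment> \<open>On entry registers 5 to 8 contain what came before the loop; after each bank
    they contain the exit values of the inner loops and the two totals of that bank.\<close>
  define jj where "jj i = (if i = 0 then j0 else n)" for i :: nat
  define kk where "kk i = (if i = 0 then k0 else n)" for i :: nat
  define ll where "ll i = (case i of 0 \<Rightarrow> l0 | Suc i \<Rightarrow> scaled_liability n C S D X i)" for i
  define aa where "aa i = (case i of 0 \<Rightarrow> a0 | Suc i \<Rightarrow> scaled_assets n E C S D X i)" for i
  let ?b = "\<lambda>i. q + (\<Sum>i<i. violation n E C S D X i)"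
  define st' where "st' i = st D x i (jj i) (kk i) (ll i) (aa i) (?b i) q X" for i
  have BV: "B \<le> V" by (rule power_le_V[of _ 1]) auto
  have DV: "D \<le> V" and XV: "X i \<le> V" and nV: "n \<le> V" and qV: "q \<le> V" for i
    using D X n le BV order.trans by blast+
  have LV: "scaled_liability n C S D X i \<le> V" and AV: "scaled_assets n E C S D X i \<le> V" for i
    using scaled_bounds[OF D X] power_le_V[of _ 6] power_le_V[of _ 8] by simp_all
  have jV: "jj i \<le> V" "kk i \<le> V" "ll i \<le> V" "aa i \<le> V" for i
    using le nV LV AV by (auto simp: jj_def kk_def ll_def aa_def split: nat.splits)
  have bV: "?b i \<le> V" if "i \<le> n" for i
    using sum_violation_le[OF D X that le(6)] by (rule power_le_V) simp
  have DDE: "D * D * E i \<le> V" for i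
    using AV[of i] by (simp add: scaled_assets_def)
  have bd: "bounded_mem V (mem [n, Q, D, x, i, j, k, l', a', ?b m, q, T] (cells X))"
    if "i \<le> n" "j \<le> V" "k \<le> V" "l' \<le> V" "a' \<le> V" "m \<le> n" for i j k l' a' m
    by (rule bounded_st) (use that DV XV le nV qV bV[of m] in auto)
  have "steps V bank_loop (st' 0) (n * (1 + (1 + (1 + ((n * (4 * n + 6) + 1) + (1 + 1)))) + 1) + 1) (st' n)"
    unfolding bank_loop_def
  proof (rule steps_for_loop)
    fix i assume i: "i < n"
    let ?L = "scaled_liability n C S D X i"
    let ?A = "scaled_assets n E C S D X i"
    show "val (fst (st' i)) (Minus (reg 0) (reg 4)) \<noteq> 0 \<and>
      steps V (Seq (Store (Const 7) (Const 0))
     (Seq (Store (Const 8) (Times (Times (reg 2) (reg 2)) (rational_at (reg 4))))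
     (Seq (Store (Const 5) (Const 0))
     (Seq counterparty_loop
     (Seq (Store (Const 9) (Plus (reg 9) violation_expr))
        (increment 4)))))) (st' i) (1 + (1 + (1 + ((n * (4 * n + 6) + 1) + (1 + 1))))) (st' (Suc i))"
    proof (intro conjI steps_Seq)
      show "val (fst (st' i)) (Minus (reg 0) (reg 4)) \<noteq> 0"
        using i by (simp add: st'_def st_def)
      show "steps V (Store (Const 7) (Const 0)) (st' i) 1 (st D x i (jj i) (kk i) 0 (aa i) (?b i) q X)"
        unfolding st'_def st_def
        by (rule steps_Store[OF bd V13]) (use i jV in \<open>simp_all add: small_expr_def\<close>)
      show "steps V (Store (Const 8) (Times (Times (reg 2) (reg 2)) (rational_at (reg 4))))
          (st D x i (jj i) (kk i) 0 (aa i) (?b i) q X) 1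
          (st D x i (jj i) (kk i) 0 (D * D * E i) (?b i) q X)"
        unfolding st_def
        by (rule steps_Store[OF bd V13])
          (use i jV cells_E[OF i] in \<open>simp_all add: small_expr_def\<close>)
      show "steps V (Store (Const 5) (Const 0))
          (st D x i (jj i) (kk i) 0 (D * D * E i) (?b i) q X) 1
          (st D x i 0 (kk i) 0 (D * D * E i) (?b i) q X)"
        unfolding st_def
        by (rule steps_Store[OF bd V13]) (use i jV DDE in \<open>simp_all add: small_expr_def\<close>)
      show "steps V counterparty_loop (st D x i 0 (kk i) 0 (D * D * E i) (?b i) q X) (n * (4 * n + 6) + 1)
          (st D x i n n ?L ?A (?b i) q X)"
        using D X le(1) jV(2) bV qV i by (intro steps_counterparty_loop) auto
      show "steps V (Store (Const 9) (Plus (reg 9) violation_expr)) (st D x i n n ?L ?A (?b i) q X) 1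
          (st D x i n n ?L ?A (?b (Suc i)) q X)"
        unfolding st_def
        by (rule steps_Store[OF bd V13])
          (use i nV LV AV in \<open>simp_all add: small_expr_def violation_def Let_def add.assoc\<close>)
      show "steps V (increment 4) (st D x i n n ?L ?A (?b (Suc i)) q X) 1 (st' (Suc i))"
        unfolding st'_def st_def
        by (rule steps_Store[OF bd V13])
          (use i nV LV AV in \<open>simp_all add: small_expr_def jj_def kk_def ll_def aa_def\<close>)
    qed
  next
    show "val (fst (st' n)) (Minus (reg 0) (reg 4)) = 0" by (simp add: st'_def st_def)
    show "bounded_mem V (fst (st' i))" if "i \<le> n" for i
      unfolding st'_def st_def fst_conv by (rule bd) (use that jV in auto)
  qed (simp_all add: small_expr_def V13)
  moreover have "1 + (1 + (1 + ((n * (4 * n + 6) + 1) + (1 + 1)))) + 1 = n * (4 * n + 6) + 7" by simp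
  ultimately have "steps V bank_loop (st' 0) (n * (n * (4 * n + 6) + 7) + 1) (st' n)"
    by (simp only:)
  moreover have "st' 0 = st D x 0 j0 k0 l0 a0 q q X"
    by (simp add: st'_def jj_def kk_def ll_def aa_def)
  moreover have "st' n = st D x n n n (ll n) (aa n) (?b n) q X"
    using n0 by (simp add: st'_def jj_def kk_def)
  ultimately show ?thesis
    by (intro exI[of _ "ll n"] exI[of _ "aa n"] conjI jV) (simp only:)
qed

lemma steps_digit_loop:
  assumes D: "D \<le> B" and X: "\<And>i. X i \<le> B" and le: "x \<le> V" "j \<le> V" "k \<le> V" "l \<le> V" "a \<le> V" "b \<le> V"
  shows "steps V digit_loop (st D x 0 j k l a b x X) (n * 4 + 1)
    (st D x n j k l a b (x div (D + 1) ^ n) (\<lambda>i. if i < n then digit D x i else X i))"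
proof -
  define XX where "XX m = (\<lambda>i. if i < m then digit D x i else X i)" for m
  define st' where "st' i = st D x i j k l a b (x div (D + 1) ^ i) (XX i)" for i
  have BV: "B \<le> V" by (rule power_le_V[of _ 1]) auto
  have DV: "D \<le> V" and nV: "n \<le> V" using D n BV by simp_all
  have XV: "XX m i \<le> V" for m i
    using D X[of i] digit_le[of D x i] BV unfolding XX_def by (auto intro: order.trans)
  have qV: "x div (D + 1) ^ i \<le> V" for i
    using le(1) by (rule order.trans[OF div_le_dividend])
  have bd: "bounded_mem V (mem [n, Q, D, x, i, j, k, l, a, b, x div (D + 1) ^ m, T] (cells (XX m')))"
    if "i \<le> n" for i m m'
    by (rule bounded_st) (use that DV XV le nV qV in \<open>auto simp del: add_Suc_right\<close>)
  have "steps V digit_loop (st' 0) (n * (1 + (1 + 1) + 1) + 1) (st' n)"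
    unfolding digit_loop_def
  proof (rule steps_for_loop)
    fix i assume i: "i < n"
    have XXS: "XX (Suc i) = (XX i)(i := digit D x i)" by (auto simp: XX_def fun_eq_iff)
    show "val (fst (st' i)) (Minus (reg 0) (reg 4)) \<noteq> 0 \<and>
      steps V (Seq (Store (Plus (Const 12) (Plus (Times (Const 2) (reg 11)) (reg 4)))
        (Minus (reg 10) (Times (Div (reg 10) (Plus (reg 2) (Const 1))) (Plus (reg 2) (Const 1)))))
     (Seq (Store (Const 10) (Div (reg 10) (Plus (reg 2) (Const 1))))
        (increment 4))) (st' i) (1 + (1 + 1)) (st' (Suc i))"
    proof (intro conjI steps_Seq)
      show "val (fst (st' i)) (Minus (reg 0) (reg 4)) \<noteq> 0"
        using i by (simp add: st'_def st_def)
      show "steps V (Store (Plus (Const 12) (Plus (Times (Const 2) (reg 11)) (reg 4)))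
        (Minus (reg 10) (Times (Div (reg 10) (Plus (reg 2) (Const 1))) (Plus (reg 2) (Const 1)))))
        (st' i) 1 (st D x i j k l a b (x div (D + 1) ^ i) (XX (Suc i)))"
        unfolding st'_def st_def
        by (rule steps_Store[OF bd V13])
          (use i in \<open>simp_all add: small_expr_def XXS digit_def del: mult_Suc_right add_Suc_right\<close>)
      show "steps V (Store (Const 10) (Div (reg 10) (Plus (reg 2) (Const 1))))
        (st D x i j k l a b (x div (D + 1) ^ i) (XX (Suc i))) 1
        (st D x i j k l a b (x div (D + 1) ^ Suc i) (XX (Suc i)))"
        unfolding st_def
        by (rule steps_Store[OF bd V13])
          (use i in \<open>simp_all add: small_expr_def mult.commute flip: div_mult2_eq\<close>)
      show "steps V (increment 4) (st D x i j k l a b (x div (D + 1) ^ Suc i) (XX (Suc i))) 1 (st' (Suc i))"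
        unfolding st'_def st_def
        by (rule steps_Store[OF bd V13]) (use i in \<open>simp_all add: small_expr_def\<close>)
    qed
  next
    show "val (fst (st' n)) (Minus (reg 0) (reg 4)) = 0" by (simp add: st'_def st_def)
    show "bounded_mem V (fst (st' i))" if "i \<le> n" for i
      unfolding st'_def st_def fst_conv by (rule bd) (use that in auto)
  qed (simp_all add: small_expr_def V13)
  moreover have "n * (1 + (1 + 1) + 1) + 1 = n * 4 + 1" by simp
  ultimately have "steps V digit_loop (st' 0) (n * 4 + 1) (st' n)" by (simp only:)
  then show ?thesis by (simp add: st'_def XX_def)
qed

lemma steps_candidate_step:
  fixes D x :: nat and X :: "nat \<Rightarrow> nat"
  defines "r \<equiv> x div (D + 1) ^ n" and "X' \<equiv> \<lambda>i. if i < n then digit D x i else X i"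
  defines "v \<equiv> r + (\<Sum>i<n. violation n E C S D X' i)"
  assumes D: "D < B" and X: "\<And>i. X i \<le> B" and x: "x < B" and n0: "0 < n"
    and le: "i \<le> V" "j \<le> V" "k \<le> V" "l \<le> V" "a \<le> V" "b \<le> V" "q \<le> V"
  shows "\<exists>l' \<le> V. \<exists>a' \<le> V. steps V candidate_step (st D x i j k l a b q X)
    (n * (n * (4 * n + 6) + 7) + 4 * n + 9)
    (st (if r = 0 then D else D + 1) (if r = 0 then x + 1 else 0) n n n l' a' v r X')"
proof -
  have BV: "B \<le> V" by (rule power_le_V[of _ 1]) auto
  have DB: "D \<le> B" and xB: "x \<le> B" using D x by simp_all
  have rB: "r \<le> B" unfolding r_def using xB by (rule order.trans[OF div_le_dividend])
  have X'B: "X' i \<le> B" for i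
    using X[of i] digit_le[of D x i] DB by (auto simp: X'_def)
  have DV: "D \<le> V" "D + 1 \<le> V" "x \<le> V" "x + 1 \<le> V" "n \<le> V" "r \<le> V"
    using D x n rB BV by simp_all
  have XV: "X i \<le> V" "X' i \<le> V" for i
    using X[of i] X'B[of i] BV by simp_all
  have vV: "v \<le> V"
    unfolding v_def using sum_violation_le[OF DB X'B order.refl rB] by (rule power_le_V) simp
  have "\<exists>l'\<le>V. \<exists>a'\<le>V. steps V bank_loop (st D x 0 j k l a r r X') (n * (n * (4 * n + 6) + 7) + 1)
      (st D x n n n l' a' v r X')"
    unfolding v_def by (rule steps_bank_loop[OF DB X'B DV(3) le(2-5) rB n0])
  then obtain l' a' where l': "l' \<le> V" "a' \<le> V"
    and bank: "steps V bank_loop (st D x 0 j k l a r r X') (n * (n * (4 * n + 6) + 7) + 1)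
      (st D x n n n l' a' v r X')"
    by (elim exE conjE)
  have "steps V candidate_step (st D x i j k l a b q X)
    (1 + (1 + ((n * 4 + 1) + (1 + (1 + ((n * (n * (4 * n + 6) + 7) + 1) + (2 + 1)))))))
    (st (if r = 0 then D else D + 1) (if r = 0 then x + 1 else 0) n n n l' a' v r X')"
    unfolding candidate_step_def
  proof (intro steps_Seq)
    show "steps V (Store (Const 10) (reg 3)) (st D x i j k l a b q X) 1 (st D x i j k l a b x X)"
      unfolding st_def
      by (rule steps_Store[OF bounded_st V13]) (use DV XV le in \<open>simp_all add: small_expr_def\<close>)
    show "steps V (Store (Const 4) (Const 0)) (st D x i j k l a b x X) 1 (st D x 0 j k l a b x X)"
      unfolding st_def
      by (rule steps_Store[OF bounded_st V13]) (use DV XV le in \<open>simp_all add: small_expr_def\<close>)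
    show "steps V digit_loop (st D x 0 j k l a b x X) (n * 4 + 1) (st D x n j k l a b r X')"
      unfolding r_def X'_def by (rule steps_digit_loop[OF DB X DV(3) le(2-6)])
    show "steps V (Store (Const 9) (reg 10)) (st D x n j k l a b r X') 1 (st D x n j k l a r r X')"
      unfolding st_def
      by (rule steps_Store[OF bounded_st V13]) (use DV XV le in \<open>simp_all add: small_expr_def\<close>)
    show "steps V (Store (Const 4) (Const 0)) (st D x n j k l a r r X') 1 (st D x 0 j k l a r r X')"
      unfolding st_def
      by (rule steps_Store[OF bounded_st V13]) (use DV XV le in \<open>simp_all add: small_expr_def\<close>)
    show "steps V bank_loop (st D x 0 j k l a r r X') (n * (n * (4 * n + 6) + 7) + 1)
      (st D x n n n l' a' v r X')" by (rule bank)
    show "steps V (Cond (reg 10) (Seq (increment 2) (Store (Const 3) (Const 0))) (increment 3))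
      (st D x n n n l' a' v r X') (2 + 1)
      (st (if r = 0 then D else D + 1) (if r = 0 then x + 1 else 0) n n n l' a' v r X')"
    proof (rule steps_Cond)
      show "bounded_mem V (fst (st D x n n n l' a' v r X'))"
        unfolding st_def fst_conv by (rule bounded_st) (use DV XV l' vV in simp_all)
    next
      assume "val (fst (st D x n n n l' a' v r X')) (reg 10) \<noteq> 0"
      then have r0: "r \<noteq> 0" by (simp add: st_def)
      have "steps V (Seq (increment 2) (Store (Const 3) (Const 0))) (st D x n n n l' a' v r X') (1 + 1)
        (st (D + 1) 0 n n n l' a' v r X')"
      proof (rule steps_Seq)
        show "steps V (increment 2) (st D x n n n l' a' v r X') 1 (st (D + 1) x n n n l' a' v r X')"
          unfolding st_def
          by (rule steps_Store[OF bounded_st V13]) (use DV XV l' vV in \<open>simp_all add: small_expr_def\<close>)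
        show "steps V (Store (Const 3) (Const 0)) (st (D + 1) x n n n l' a' v r X') 1
            (st (D + 1) 0 n n n l' a' v r X')"
          unfolding st_def
          by (rule steps_Store[OF bounded_st V13]) (use DV XV l' vV in \<open>simp_all add: small_expr_def\<close>)
      qed
      then show "steps V (Seq (increment 2) (Store (Const 3) (Const 0))) (st D x n n n l' a' v r X') 2
          (st (if r = 0 then D else D + 1) (if r = 0 then x + 1 else 0) n n n l' a' v r X')"
        using r0 by (simp add: numeral_2_eq_2)
    next
      assume "val (fst (st D x n n n l' a' v r X')) (reg 10) = 0"
      then have r0: "r = 0" by (simp add: st_def)
      have "steps V (increment 3) (st D x n n n l' a' v r X') 1 (st D (x + 1) n n n l' a' v r X')"
        unfolding st_def
        by (rule steps_Store[OF bounded_st V13]) (use DV XV l' vV in \<open>simp_all add: small_expr_def\<close>)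
      then have "steps V (increment 3) (st D x n n n l' a' v r X') 2 (st D (x + 1) n n n l' a' v r X')"
        by (rule steps_mono) simp
      then show "steps V (increment 3) (st D x n n n l' a' v r X') 2
          (st (if r = 0 then D else D + 1) (if r = 0 then x + 1 else 0) n n n l' a' v r X')"
        using r0 by simp
    qed (simp add: small_expr_def)
  qed
  moreover have "1 + (1 + ((n * 4 + 1) + (1 + (1 + ((n * (n * (4 * n + 6) + 7) + 1) + (2 + 1)))))) =
    n * (n * (4 * n + 6) + 7) + 4 * n + 9" by simp
  ultimately show ?thesis
    by (intro exI[of _ l'] exI[of _ a'] conjI l') (simp only:)
qed

text \<open>Extracted digits agree with a wanted vector only below \<open>n\<close>; cells beyond
  keep older contents.\<close>

lemma violation_cong:
  assumes "\<And>i. i < n \<Longrightarrow> X i = Y i" "i < n"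
  shows "violation n E C S D X i = violation n E C S D Y i"
proof -
  have "scaled_liability n C S D X i = scaled_liability n C S D Y i"
    unfolding scaled_liability_def using assms(1) by (intro sum.cong refl arg_cong2[where f = "(+)"]) auto
  moreover have "scaled_assets n E C S D X i = scaled_assets n E C S D Y i"
    unfolding scaled_assets_def using assms(1) by (intro sum.cong refl arg_cong2[where f = "(+)"]) auto
  ultimately show ?thesis using assms by (simp add: violation_def)
qed

text \<open>The hypotheses supply one good candidate \<open>y\<close> over \<open>Dm\<close>, with
  code \<open>xm\<close>. Candidates are tried in lexicographic order of \<open>(D, x)\<close>, so
  the search stops at \<open>(Dm, xm)\<close> unless it has met another solution before.\<close>

lemma steps_search_loop:
  assumes n0: "0 < n" and Dm: "0 < Dm" "(Dm + 1) ^ n + 1 < B"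
    and y: "\<forall>i<n. y i \<le> Dm" "\<forall>i<n. violation n E C S Dm y i = 0"
    and X0: "\<And>i. X0 i \<le> B" and iV: "i0 \<le> V"
  shows "\<exists>D x i j k l a q X. 0 < D \<and> D < B \<and> x < B \<and> i \<le> V \<and> j \<le> V \<and> k \<le> V \<and> l \<le> V \<and> a \<le> V \<and> q \<le> V \<and>
    (\<forall>i. X i \<le> B) \<and> (\<forall>i<n. X i \<le> D \<and> violation n E C S D X i = 0) \<and>
    steps V search_loop (st 1 0 i0 0 0 0 0 1 0 X0) (B * (B + 1) * (n * (n * (4 * n + 6) + 7) + 4 * n + 10) + 1)
      (st D x i j k l a 0 q X)"
proof -
  obtain xm where xm: "xm < (Dm + 1) ^ n" "\<And>i. i < n \<Longrightarrow> digit Dm xm i = y i"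
    using digits_exist[of n y Dm] y(1) by blast
  define W where "W = (Dm + 1) ^ n"
  \<comment> \<open>While a violation is left, the next candidate is not beyond
    \<open>(Dm, xm)\<close>. After a success the code has already moved on, so only \<open>X\<close>
    and \<open>D\<close> are described. The code may equal \<open>(D + 1) ^ n\<close>, the value
    that reveals that \<open>D\<close> is exhausted.\<close>
  define Inv where "Inv s \<longleftrightarrow> (\<exists>D x i j k l a b q X. s = st D x i j k l a b q X \<and>
    0 < D \<and> D \<le> Dm \<and> x \<le> (D + 1) ^ n \<and>
    i \<le> V \<and> j \<le> V \<and> k \<le> V \<and> l \<le> V \<and> a \<le> V \<and> b \<le> V \<and> q \<le> V \<and> (\<forall>i. X i \<le> B) \<and>
    (b \<noteq> 0 \<longrightarrow> D < Dm \<or> D = Dm \<and> x \<le> xm) \<and>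
    (b = 0 \<longrightarrow> (\<forall>i<n. X i \<le> D \<and> violation n E C S D X i = 0)))" for s
  have InvI: "Inv (st D x i j k l a b q X)"
    if "0 < D" "D \<le> Dm" "x \<le> (D + 1) ^ n"
      "i \<le> V" "j \<le> V" "k \<le> V" "l \<le> V" "a \<le> V" "b \<le> V" "q \<le> V" "\<forall>i. X i \<le> B"
      "b \<noteq> 0 \<longrightarrow> D < Dm \<or> D = Dm \<and> x \<le> xm"
      "b = 0 \<longrightarrow> (\<forall>i<n. X i \<le> D \<and> violation n E C S D X i = 0)" for D x i j k l a b q X
    unfolding Inv_def using that by blast
  \<comment> \<open>The lexicographic rank as one number. Codes range over \<open>0..W\<close>, so
    the second summand lies between 1 and \<open>W + 1\<close>, and the weight \<open>W + 2\<close>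
    outweighs a reset of \<open>x\<close>.\<close>
  define \<mu> where "\<mu> s = (Dm - fst s 2) * (W + 2) + (W + 1 - fst s 3)" for s :: state
  have mu: "\<mu> (st D x i j k l a b q X) = (Dm - D) * (W + 2) + (W + 1 - x)" for D x i j k l a b q X
    by (simp add: \<mu>_def st_def)
  have BV: "B \<le> V" by (rule power_le_V[of _ 1]) auto
  have DmW: "Dm < W" unfolding W_def using self_le_power[of "Dm + 1" n] n0 by simp
  have WB: "W + 1 < B" using Dm(2) by (simp add: W_def)
  have pow: "(D + 1) ^ n \<le> W" if "D \<le> Dm" for D
    unfolding W_def using that by (intro power_mono) auto
  have "\<exists>s'. steps V search_loop (st 1 0 i0 0 0 0 0 1 0 X0)
      (\<mu> (st 1 0 i0 0 0 0 0 1 0 X0) * ((n * (n * (4 * n + 6) + 7) + 4 * n + 9) + 1) + 1) s' \<and>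
      Inv s' \<and> val (fst s') (reg 9) = 0"
    unfolding search_loop_def
  proof (rule steps_while)
    fix s assume "Inv s" and b0: "val (fst s) (reg 9) \<noteq> 0"
    then obtain D x i j k l a b q X where s: "s = st D x i j k l a b q X"
      and D: "0 < D" "D \<le> Dm" and x: "x \<le> (D + 1) ^ n"
      and le: "i \<le> V" "j \<le> V" "k \<le> V" "l \<le> V" "a \<le> V" "b \<le> V" "q \<le> V" and X: "\<And>i. X i \<le> B"
      and lex: "b \<noteq> 0 \<longrightarrow> D < Dm \<or> D = Dm \<and> x \<le> xm"
      unfolding Inv_def by blast
    have lex: "D < Dm \<or> D = Dm \<and> x \<le> xm" using lex b0 by (simp add: s st_def)
    have DB: "D < B" using D DmW WB by simp
    have xW: "x \<le> W" using x pow[OF D(2)] by simp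
    have xB: "x < B" using xW WB by simp
    define r where "r = x div (D + 1) ^ n"
    define X' where "X' = (\<lambda>i. if i < n then digit D x i else X i)"
    define v where "v = r + (\<Sum>i<n. violation n E C S D X' i)"
    have "\<exists>l'\<le>V. \<exists>a'\<le>V. steps V candidate_step s (n * (n * (4 * n + 6) + 7) + 4 * n + 9)
        (st (if r = 0 then D else D + 1) (if r = 0 then x + 1 else 0) n n n l' a' v r X')"
      unfolding s r_def v_def X'_def by (rule steps_candidate_step[OF DB X xB n0 le])
    then obtain l' a' where l': "l' \<le> V" "a' \<le> V"
      and st: "steps V candidate_step s (n * (n * (4 * n + 6) + 7) + 4 * n + 9)
        (st (if r = 0 then D else D + 1) (if r = 0 then x + 1 else 0) n n n l' a' v r X')"
      by (elim exE conjE)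
    have X'B: "X' i \<le> B" for i
      using X[of i] digit_le[of D x i] DB by (auto simp: X'_def)
    have rB: "r \<le> B" unfolding r_def using xB by (auto intro: order.trans[OF div_le_dividend])
    have vV: "v \<le> V"
      unfolding v_def using sum_violation_le[OF _ X'B order.refl rB] DB
      by (intro power_le_V[of _ 10]) auto
    have nV: "n \<le> V" "r \<le> V" using n rB BV by simp_all
    have ok: "\<forall>i<n. X' i \<le> D \<and> violation n E C S D X' i = 0" if "v = 0"
      using that digit_le[of D x] by (auto simp: v_def X'_def)
    show "\<exists>s'. steps V candidate_step s (n * (n * (4 * n + 6) + 7) + 4 * n + 9) s' \<and> Inv s' \<and> \<mu> s' < \<mu> s"
    proof (cases "r = 0")
      case True
      have xlt: "x < (D + 1) ^ n" using True by (simp add: r_def div_eq_0_iff)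
      have "D < Dm \<or> D = Dm \<and> x + 1 \<le> xm" if "v \<noteq> 0"
      proof (rule ccontr)
        assume "\<not> ?thesis"
        with lex have eq: "D = Dm" "x = xm" by auto
        have "violation n E C S D X' i = 0" if "i < n" for i
          using violation_cong[of X' y i D] y(2) that xm(2) by (simp add: X'_def eq)
        then have "v = 0" by (simp add: v_def True)
        with \<open>v \<noteq> 0\<close> show False by simp
      qed
      then have "Inv (st D (x + 1) n n n l' a' v r X')"
        using D xlt l' vV nV X'B ok by (intro InvI) auto
      moreover have "\<mu> (st D (x + 1) n n n l' a' v r X') < \<mu> s"
        using xW by (simp add: s mu)
      moreover have "steps V candidate_step s (n * (n * (4 * n + 6) + 7) + 4 * n + 9)
          (st D (x + 1) n n n l' a' v r X')"
        using st by (simp only: True refl if_True)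
      ultimately show ?thesis by (intro exI conjI)
    next
      case False
      then have xge: "(D + 1) ^ n \<le> x" by (simp add: r_def div_eq_0_iff not_less)
      \<comment> \<open>\<open>xm\<close> is below \<open>(Dm + 1) ^ n\<close>, so for
        \<open>D = Dm\<close> the codes cannot be exhausted before \<open>xm\<close> has been
        tried.\<close>
      have DDm: "D < Dm" using lex xge xm(1) by auto
      \<comment> \<open>The quotient is part of the total, so a success never coincides with an
        increment of \<open>D\<close>: at exit register 2 still holds the denominator that belongs
        to \<open>X\<close>.\<close>
      have "v \<noteq> 0" using False by (simp add: v_def)
      then have "Inv (st (D + 1) 0 n n n l' a' v r X')"
        using D DDm l' vV nV X'B by (intro InvI) auto
      moreover have "\<mu> (st (D + 1) 0 n n n l' a' v r X') < \<mu> s"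
      proof -
        define e where "e = Dm - (D + 1)"
        have "Dm - D = Suc e" using DDm by (simp add: e_def)
        then have "\<mu> s = W + 2 + e * (W + 2) + (W + 1 - x)" by (simp add: s mu)
        moreover have "\<mu> (st (D + 1) 0 n n n l' a' v r X') = e * (W + 2) + (W + 1)"
          by (simp only: mu e_def diff_zero)
        ultimately show ?thesis by linarith
      qed
      moreover have "steps V candidate_step s (n * (n * (4 * n + 6) + 7) + 4 * n + 9)
          (st (D + 1) 0 n n n l' a' v r X')"
        using st by (simp only: False if_False)
      ultimately show ?thesis by (intro exI conjI)
    qed
  next
    fix s assume "Inv s"
    then obtain D x i j k l a b q X where s: "s = st D x i j k l a b q X"
      and D: "0 < D" "D \<le> Dm" and x: "x \<le> (D + 1) ^ n"
      and le: "i \<le> V" "j \<le> V" "k \<le> V" "l \<le> V" "a \<le> V" "b \<le> V" "q \<le> V" and X: "\<And>i. X i \<le> B"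
      unfolding Inv_def by blast
    have "X i \<le> V" for i using X[of i] BV by simp
    then show "bounded_mem V (fst s)"
      unfolding s st_def fst_conv
      by (intro bounded_st) (use D DmW WB BV le x pow[OF D(2)] in auto)
  next
    show "Inv (st 1 0 i0 0 0 0 0 1 0 X0)"
      using Dm X0 iV V13 by (intro InvI) auto
  qed (simp_all add: small_expr_def V13)
  then obtain s' where s': "Inv s'" "val (fst s') (reg 9) = 0"
    and st: "steps V search_loop (st 1 0 i0 0 0 0 0 1 0 X0)
      (\<mu> (st 1 0 i0 0 0 0 0 1 0 X0) * ((n * (n * (4 * n + 6) + 7) + 4 * n + 9) + 1) + 1) s'"
    by blast
  have "\<mu> (st 1 0 i0 0 0 0 0 1 0 X0) \<le> B * (B + 1)"
  proof -
    have "\<mu> (st 1 0 i0 0 0 0 0 1 0 X0) \<le> (Dm - 1 + 1) * (W + 2)" by (simp add: mu)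
    also have "\<dots> \<le> B * (B + 1)" using DmW WB Dm(1) by (intro mult_le_mono) auto
    finally show ?thesis .
  qed
  moreover have "(n * (n * (4 * n + 6) + 7) + 4 * n + 9) + 1 \<le> n * (n * (4 * n + 6) + 7) + 4 * n + 10"
    by linarith
  ultimately have "\<mu> (st 1 0 i0 0 0 0 0 1 0 X0) * ((n * (n * (4 * n + 6) + 7) + 4 * n + 9) + 1) + 1 \<le>
      B * (B + 1) * (n * (n * (4 * n + 6) + 7) + 4 * n + 10) + 1"
    by (intro add_right_mono mult_le_mono)
  with st have st': "steps V search_loop (st 1 0 i0 0 0 0 0 1 0 X0)
      (B * (B + 1) * (n * (n * (4 * n + 6) + 7) + 4 * n + 10) + 1) s'"
    by (rule steps_mono)
  from s' obtain D x i j k l a b q X where s: "s' = st D x i j k l a b q X"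
      and D: "0 < D" "D \<le> Dm" and x: "x \<le> (D + 1) ^ n"
      and le: "i \<le> V" "j \<le> V" "k \<le> V" "l \<le> V" "a \<le> V" "b \<le> V" "q \<le> V" and X: "\<forall>i. X i \<le> B"
      and ok: "b = 0 \<longrightarrow> (\<forall>i<n. X i \<le> D \<and> violation n E C S D X i = 0)"
    unfolding Inv_def by blast
  have b: "b = 0" using s'(2) by (simp add: s st_def)
  have "D < B" "x < B" using D DmW WB x pow[OF D(2)] by simp_all
  moreover have "\<forall>i<n. X i \<le> D \<and> violation n E C S D X i = 0" using ok b by simp
  ultimately show ?thesis
    using D le X st'[unfolded s b]
    by - (rule exI[of _ D], rule exI[of _ x], rule exI[of _ i], rule exI[of _ j], rule exI[of _ k],
      rule exI[of _ l], rule exI[of _ a], rule exI[of _ q], rule exI[of _ X], intro conjI)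
qed

end

subsection \<open>Reading the input and writing the output\<close>

lemma length_concat_uniform:
  "(\<And>i. i < n \<Longrightarrow> length (f i) = m) \<Longrightarrow> length (concat (map f [0..<n])) = n * m"
  by (induction n) auto

lemma nth_concat_uniform:
  assumes "\<And>i. i < n \<Longrightarrow> length (f i) = m" and "i < n" "j < m"
  shows "concat (map f [0..<n]) ! (i * m + j) = f i ! j"
proof -
  have "[0..<n] = [0..<i] @ i # [Suc i..<n]"
    using upt_add_eq_append[of 0 i "n - i"] assms(2) by (simp add: upt_conv_Cons)
  then have "concat (map f [0..<n]) = concat (map f [0..<i]) @ f i @ concat (map f [Suc i..<n])"
    by simp
  moreover have "length (concat (map f [0..<i])) = i * m"
    by (rule length_concat_uniform) (use assms in auto)
  ultimately show ?thesis using assms by (simp add: nth_append)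
qed

lemma length_encode_rat [simp]: "length (encode_rat q) = 2"
  by (simp add: encode_rat_def)

lemma encode_rat_denominator_pos: "0 < encode_rat q ! 1"
  using quotient_of_denom_pos'[of q] by (simp add: encode_rat_def)

lemma of_rat_eq_encode_rat:
  assumes "0 \<le> q"
  shows "of_rat q = real (encode_rat q ! 0) / real (encode_rat q ! 1)"
proof -
  obtain a b where ab: "quotient_of q = (a, b)" by fastforce
  have b: "0 < b" using quotient_of_denom_pos[OF ab] .
  have q: "q = of_int a / of_int b" using quotient_of_div[OF ab] .
  then have a: "0 \<le> a" using assms b by (simp add: zero_le_divide_iff)
  have "of_rat q = real_of_int a / real_of_int b" by (simp add: q of_rat_divide)
  then show ?thesis using a b by (simp add: encode_rat_def ab)
qed

text \<open>Keeping the rationals whole separates the row-major index computation from the doubling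
  of positions into numerator and denominator.\<close>

definition network_rats :: "network \<Rightarrow> rat list" where
  "network_rats F = (let B = [0..<banks F] in
     map (ext F) B @ concat (map (\<lambda>i. map (debt F i) B) B) @
     concat (map (\<lambda>i. concat (map (\<lambda>j. map (cds F i j) B) B)) B))"

lemma encode_network_eq:
  "encode_network F = banks F # concat (map encode_rat (network_rats F))"
  by (simp add: encode_network_def network_rats_def Let_def map_concat comp_def)

lemma network_rats_nth:
  fixes F defines "n \<equiv> banks F"
  shows "length (network_rats F) = n + n * n + n * n * n"
    and "i < n \<Longrightarrow> network_rats F ! i = ext F i"
    and "i < n \<Longrightarrow> j < n \<Longrightarrow> network_rats F ! (n + (i * n + j)) = debt F i j"
    and "i < n \<Longrightarrow> j < n \<Longrightarrow> k < n \<Longrightarrow> network_rats F ! (n + n * n + ((i * n + j) * n + k)) = cds F i j k"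
proof -
  let ?D = "concat (map (\<lambda>i. map (debt F i) [0..<n]) [0..<n])"
  let ?S = "concat (map (\<lambda>i. concat (map (\<lambda>j. map (cds F i j) [0..<n]) [0..<n])) [0..<n])"
  have D: "length ?D = n * n" "i < n \<Longrightarrow> j < n \<Longrightarrow> ?D ! (i * n + j) = debt F i j" for i j
    using length_concat_uniform[of n "\<lambda>i. map (debt F i) [0..<n]" n]
      nth_concat_uniform[of n "\<lambda>i. map (debt F i) [0..<n]" n i j] by simp_all
  have s: "length (concat (map (\<lambda>j. map (cds F i j) [0..<n]) [0..<n])) = n * n"
    "j < n \<Longrightarrow> k < n \<Longrightarrow> concat (map (\<lambda>j. map (cds F i j) [0..<n]) [0..<n]) ! (j * n + k) = cds F i j k" for i j k
    using length_concat_uniform[of n "\<lambda>j. map (cds F i j) [0..<n]" n]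
      nth_concat_uniform[of n "\<lambda>j. map (cds F i j) [0..<n]" n j k] by simp_all
  have S: "length ?S = n * (n * n)" by (rule length_concat_uniform) (rule s)
  have eq: "network_rats F = map (ext F) [0..<n] @ ?D @ ?S"
    by (simp add: network_rats_def n_def Let_def)
  show "length (network_rats F) = n + n * n + n * n * n"
    unfolding eq using D(1) S by simp
  show "network_rats F ! i = ext F i" if "i < n"
    unfolding eq using that by (simp add: nth_append)
  have less: "i * n + j < n * n" if "i < n" "j < n" for i j
  proof -
    have "i * n + j < Suc i * n" using that by simp
    also have "\<dots> \<le> n * n" using that by (intro mult_right_mono) auto
    finally show ?thesis .
  qed
  show "network_rats F ! (n + (i * n + j)) = debt F i j" if "i < n" "j < n"
  proof -
    have "network_rats F ! (n + (i * n + j)) = (?D @ ?S) ! (i * n + j)"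
      unfolding eq by (subst nth_append_right) simp_all
    also have "\<dots> = ?D ! (i * n + j)" using less[OF that] D(1) by (intro nth_append_left) simp
    also have "\<dots> = debt F i j" by (rule D(2)[OF that])
    finally show ?thesis .
  qed
  show "network_rats F ! (n + n * n + ((i * n + j) * n + k)) = cds F i j k" if "i < n" "j < n" "k < n"
  proof -
    have idx: "(i * n + j) * n + k = i * (n * n) + (j * n + k)" by (simp add: distrib_right)
    have "network_rats F ! (n + n * n + ((i * n + j) * n + k)) = (?D @ ?S) ! (n * n + ((i * n + j) * n + k))"
      unfolding eq by (subst nth_append_right) simp_all
    also have "\<dots> = ?S ! ((i * n + j) * n + k)" using D(1) by (subst nth_append_right) simp_all
    also have "?S ! ((i * n + j) * n + k) = concat (map (\<lambda>j. map (cds F i j) [0..<n]) [0..<n]) ! (j * n + k)"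
      unfolding idx by (rule nth_concat_uniform[OF s(1) that(1) less[OF that(2,3)]])
    also have "\<dots> = cds F i j k" by (rule s(2)[OF that(2,3)])
    finally show ?thesis .
  qed
qed

lemma concat_encode_rat_nth:
  "e < length rs \<Longrightarrow> concat (map encode_rat rs) ! (2 * e) = encode_rat (rs ! e) ! 0"
  "e < length rs \<Longrightarrow> concat (map encode_rat rs) ! (Suc (2 * e)) = encode_rat (rs ! e) ! 1"
  "length (concat (map encode_rat rs)) = 2 * length rs"
proof -
  have eq: "concat (map encode_rat rs) = concat (map (\<lambda>e. encode_rat (rs ! e)) [0..<length rs])"
    by (intro arg_cong[of _ _ concat] nth_equalityI) simp_all
  show "length (concat (map encode_rat rs)) = 2 * length rs"
    unfolding eq by (subst length_concat_uniform[of _ _ 2]) simp_all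
  show "concat (map encode_rat rs) ! (2 * e) = encode_rat (rs ! e) ! 0" if "e < length rs"
    unfolding eq using nth_concat_uniform[OF _ that, of "\<lambda>e. encode_rat (rs ! e)" 2 0]
    by (simp only: length_encode_rat mult.commute[of e] add_0_right zero_less_numeral)
  show "concat (map encode_rat rs) ! (Suc (2 * e)) = encode_rat (rs ! e) ! 1" if "e < length rs"
    unfolding eq using nth_concat_uniform[OF _ that, of "\<lambda>e. encode_rat (rs ! e)" 2 1]
    by (simp only: length_encode_rat mult.commute[of e] Suc_eq_plus1 one_less_numeral_iff semiring_norm)
qed

lemma length_le_input_size: "length xs \<le> input_size xs"
proof (induction xs)
  case (Cons x xs)
  then show ?case using bit_length_pos[of x] by (simp add: input_size_def)
qed simp

lemma le_two_power_input_size: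
  assumes "x \<in> set xs" shows "x \<le> 2 ^ input_size xs"
proof -
  from assms have "bit_length x \<le> input_size xs"
    unfolding input_size_def by (intro member_le_sum_list) auto
  then have "2 ^ bit_length x \<le> (2 :: nat) ^ input_size xs" by (intro power_increasing) auto
  with less_two_power_bit_length[of x] show ?thesis by linarith
qed

text \<open>A product is at most 2 to the sum of the lengths of its factors, and the denominators
  are among the entries whose lengths the input size adds up. So \<open>Q\<close> has linear length
  although it has cubically many factors. The bound for every \<open>t\<close> covers the partial
  products formed while reading.\<close>

lemma prod_odd_positions_le:
  assumes "2 * t \<le> length xs"
  shows "(\<Prod>v<t. xs ! Suc (2 * v)) \<le> 2 ^ input_size xs"
proof -
  have "(\<Prod>v<t. xs ! Suc (2 * v)) \<le> (\<Prod>v<t. 2 ^ bit_length (xs ! Suc (2 * v)))"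
    by (intro prod_mono) (auto intro: less_imp_le less_two_power_bit_length)
  also have "\<dots> = 2 ^ (\<Sum>v<t. bit_length (xs ! Suc (2 * v)))" by (simp add: power_sum)
  also have "(\<Sum>v<t. bit_length (xs ! Suc (2 * v))) = (\<Sum>a\<in>(\<lambda>v. Suc (2 * v)) ` {..<t}. bit_length (xs ! a))"
    by (subst sum.reindex) (auto simp: inj_on_def)
  also have "(2 :: nat) ^ \<dots> \<le> 2 ^ (\<Sum>a<length xs. bit_length (xs ! a))"
    using assms by (intro power_increasing sum_mono2) auto
  also have "(\<Sum>a<length xs. bit_length (xs ! a)) = input_size xs"
    by (simp add: input_size_def sum_list_sum_nth atLeast0LessThan)
  finally show ?thesis .
qed

section \<open>The complete program\<close>

definition read_loop :: prog where
  "read_loop = Loop (Minus (reg 11) (reg 4))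
     (Seq (Read (Plus (Const 12) (Times (Const 2) (reg 4))))
     (Seq (Read (Plus (Const 13) (Times (Const 2) (reg 4))))
     (Seq (Store (Const 1) (Times (reg 1) (Load (Plus (Const 13) (Times (Const 2) (reg 4))))))
        (increment 4))))"

definition write_loop :: prog where
  "write_loop = Loop (Minus (reg 0) (reg 4))
     (Seq (Write (candidate_at (reg 4))) (Seq (Write (reg 2)) (increment 4)))"

text \<open>Register 9 starts at 1 so that the first candidate gets tested. The first denominator 1
  is stored explicitly, while the first code 0 is already there in the blank memory.\<close>

definition solver :: prog where
  "solver =
     Seq (Read (Const 0))
     (Seq (Store (Const 11) (Plus (Plus (reg 0) (Times (reg 0) (reg 0))) (Times (Times (reg 0) (reg 0)) (reg 0))))
     (Seq (Store (Const 1) (Const 1))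
     (Seq read_loop
     (Seq (Store (Const 2) (Const 1))
     (Seq (Store (Const 4) (Const 0))
     (Seq (Store (Const 9) (Const 1))
     (Seq search_loop
     (Seq (Store (Const 4) (Const 0)) write_loop))))))))"

lemma steps_read_loop:
  assumes len: "length xs = 2 * T" and xs: "\<And>a. a < 2 * T \<Longrightarrow> xs ! a \<le> V"
    and Q: "\<And>t. t \<le> T \<Longrightarrow> (\<Prod>v<t. xs ! Suc (2 * v)) \<le> V"
    and V: "n \<le> V" "T \<le> V" "13 \<le> V"
  shows "steps V read_loop (mem [n, 1, 0, 0, 0, 0, 0, 0, 0, 0, 0, T] (\<lambda>_. 0), xs, ys) (T * 5 + 1)
    (mem [n, (\<Prod>v<T. xs ! Suc (2 * v)), 0, 0, T, 0, 0, 0, 0, 0, 0, T] (\<lambda>a. if a < 2 * T then xs ! a else 0), [], ys)"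
proof -
  define q where "q t = (\<Prod>v<t. xs ! Suc (2 * v))" for t
  define ar where "ar m = (\<lambda>a. if a < m then xs ! a else 0)" for m
  define S where "S t = (mem [n, q t, 0, 0, t, 0, 0, 0, 0, 0, 0, T] (ar (2 * t)), drop (2 * t) xs, ys)" for t
  have bd: "bounded_mem V (mem [n, q t, 0, 0, t', 0, 0, 0, 0, 0, 0, T] (ar m))"
    if "t \<le> T" "t' \<le> T" "m \<le> 2 * T" for t t' m
    using that V Q[of t] xs by (simp add: bounded_mem_mem ar_def q_def)
  have "steps V read_loop (S 0) (T * (1 + (1 + (1 + 1)) + 1) + 1) (S T)"
    unfolding read_loop_def
  proof (rule steps_for_loop)
    fix t assume t: "t < T"
    have d: "drop (2 * t) xs = xs ! (2 * t) # xs ! Suc (2 * t) # drop (2 * Suc t) xs"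
      using t len by (simp add: Cons_nth_drop_Suc)
    have ar1: "ar (Suc (2 * t)) = (ar (2 * t))(2 * t := xs ! (2 * t))"
      and ar2: "ar (2 * Suc t) = (ar (Suc (2 * t)))(Suc (2 * t) := xs ! Suc (2 * t))"
      by (auto simp: ar_def fun_eq_iff)
    show "val (fst (S t)) (Minus (reg 11) (reg 4)) \<noteq> 0 \<and>
      steps V (Seq (Read (Plus (Const 12) (Times (Const 2) (reg 4))))
        (Seq (Read (Plus (Const 13) (Times (Const 2) (reg 4))))
        (Seq (Store (Const 1) (Times (reg 1) (Load (Plus (Const 13) (Times (Const 2) (reg 4))))))
        (increment 4)))) (S t) (1 + (1 + (1 + 1))) (S (Suc t))"
    proof (intro conjI steps_Seq)
      show "val (fst (S t)) (Minus (reg 11) (reg 4)) \<noteq> 0" using t by (simp add: S_def)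
      show "steps V (Read (Plus (Const 12) (Times (Const 2) (reg 4)))) (S t) 1
          (mem [n, q t, 0, 0, t, 0, 0, 0, 0, 0, 0, T] (ar (Suc (2 * t))), xs ! Suc (2 * t) # drop (2 * Suc t) xs, ys)"
        unfolding S_def d
        by (rule steps_Read[OF bd V(3)]) (use t xs ar1 in \<open>simp_all add: small_expr_def\<close>)
      show "steps V (Read (Plus (Const 13) (Times (Const 2) (reg 4))))
          (mem [n, q t, 0, 0, t, 0, 0, 0, 0, 0, 0, T] (ar (Suc (2 * t))), xs ! Suc (2 * t) # drop (2 * Suc t) xs, ys) 1
          (mem [n, q t, 0, 0, t, 0, 0, 0, 0, 0, 0, T] (ar (2 * Suc t)), drop (2 * Suc t) xs, ys)"
        unfolding ar2
        by (rule steps_Read[OF bd V(3)]) (use t xs in \<open>simp_all add: small_expr_def\<close>)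
      have "ar (2 * Suc t) (Suc (2 * t)) = xs ! Suc (2 * t)" by (simp add: ar_def)
      then show "steps V (Store (Const 1) (Times (reg 1) (Load (Plus (Const 13) (Times (Const 2) (reg 4))))))
          (mem [n, q t, 0, 0, t, 0, 0, 0, 0, 0, 0, T] (ar (2 * Suc t)), drop (2 * Suc t) xs, ys) 1
          (mem [n, q (Suc t), 0, 0, t, 0, 0, 0, 0, 0, 0, T] (ar (2 * Suc t)), drop (2 * Suc t) xs, ys)"
        by (intro steps_Store[OF bd V(3)]) (use t in \<open>simp_all add: small_expr_def q_def\<close>)
      show "steps V (increment 4)
          (mem [n, q (Suc t), 0, 0, t, 0, 0, 0, 0, 0, 0, T] (ar (2 * Suc t)), drop (2 * Suc t) xs, ys) 1 (S (Suc t))"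
        unfolding S_def
        by (rule steps_Store[OF bd V(3)]) (use t in \<open>simp_all add: small_expr_def\<close>)
    qed
  next
    show "val (fst (S T)) (Minus (reg 11) (reg 4)) = 0" by (simp add: S_def)
    show "bounded_mem V (fst (S t))" if "t \<le> T" for t
      unfolding S_def fst_conv using that by (intro bd) auto
  qed (simp_all add: small_expr_def V)
  moreover have "T * (1 + (1 + (1 + 1)) + 1) + 1 = T * 5 + 1" by simp
  ultimately have "steps V read_loop (S 0) (T * 5 + 1) (S T)" by (simp only:)
  then show ?thesis using len by (simp add: S_def q_def ar_def)
qed

lemma (in candidate_check) steps_write_loop:
  assumes le: "D \<le> V" "x \<le> V" "j \<le> V" "k \<le> V" "l \<le> V" "a \<le> V" "b \<le> V" "q \<le> V" "\<And>i. X i \<le> V"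
  shows "\<exists>m. steps V write_loop (st D x 0 j k l a b q X) (n * 4 + 1)
    (m, xs, ys @ concat (map (\<lambda>i. [X i, D]) [0..<n]))"
proof -
  define S where "S t = (mem [n, Q, D, x, t, j, k, l, a, b, q, T] (cells X), xs,
    ys @ concat (map (\<lambda>i. [X i, D]) [0..<t]))" for t
  have nV: "n \<le> V" using n by (intro power_le_V[of _ 1]) auto
  have bd: "bounded_mem V (mem [n, Q, D, x, t, j, k, l, a, b, q, T] (cells X))" if "t \<le> n" for t
    by (rule bounded_st) (use le that nV in simp_all)
  have "steps V write_loop (S 0) (n * (1 + (1 + 1) + 1) + 1) (S n)"
    unfolding write_loop_def
  proof (rule steps_for_loop)
    fix t assume t: "t < n"
    let ?ys = "ys @ concat (map (\<lambda>i. [X i, D]) [0..<t])"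
    show "val (fst (S t)) (Minus (reg 0) (reg 4)) \<noteq> 0 \<and>
      steps V (Seq (Write (candidate_at (reg 4))) (Seq (Write (reg 2)) (increment 4)))
        (S t) (1 + (1 + 1)) (S (Suc t))"
    proof (intro conjI steps_Seq)
      show "val (fst (S t)) (Minus (reg 0) (reg 4)) \<noteq> 0" using t by (simp add: S_def)
      show "steps V (Write (candidate_at (reg 4))) (S t) 1
          (mem [n, Q, D, x, t, j, k, l, a, b, q, T] (cells X), xs, ?ys @ [X t])"
        unfolding S_def by (rule steps_Write[OF bd V13]) (use t in \<open>simp_all add: small_expr_def\<close>)
      show "steps V (Write (reg 2))
          (mem [n, Q, D, x, t, j, k, l, a, b, q, T] (cells X), xs, ?ys @ [X t]) 1
          (mem [n, Q, D, x, t, j, k, l, a, b, q, T] (cells X), xs, (?ys @ [X t]) @ [D])"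
        by (rule steps_Write[OF bd V13]) (use t in \<open>simp_all add: small_expr_def\<close>)
      show "steps V (increment 4)
          (mem [n, Q, D, x, t, j, k, l, a, b, q, T] (cells X), xs, (?ys @ [X t]) @ [D]) 1 (S (Suc t))"
        unfolding S_def by (rule steps_Store[OF bd V13]) (use t in \<open>simp_all add: small_expr_def\<close>)
    qed
  next
    show "val (fst (S n)) (Minus (reg 0) (reg 4)) = 0" by (simp add: S_def)
    show "bounded_mem V (fst (S t))" if "t \<le> n" for t
      unfolding S_def fst_conv using that by (rule bd)
  qed (simp_all add: small_expr_def V13)
  moreover have "n * (1 + (1 + 1) + 1) + 1 = n * 4 + 1" by simp
  ultimately have "steps V write_loop (S 0) (n * 4 + 1) (S n)" by (simp only:)
  then show ?thesis by (auto simp: S_def st_def)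
qed

lemma (in candidate_check) steps_solver:
  assumes xs: "xs = []" and ys: "ys = []" and n0: "0 < n"
    and zs: "length zs = 2 * T" "\<And>a. a < 2 * T \<Longrightarrow> zs ! a = inp a" "\<And>a. 2 * T \<le> a \<Longrightarrow> inp a = 0"
    and Qp: "Q = (\<Prod>v<T. zs ! Suc (2 * v))" "\<And>t. t \<le> T \<Longrightarrow> (\<Prod>v<t. zs ! Suc (2 * v)) \<le> B"
    and Dm: "0 < Dm" "(Dm + 1) ^ n + 1 < B"
    and y: "\<forall>i<n. y i \<le> Dm" "\<forall>i<n. violation n E C S Dm y i = 0"
  shows "\<exists>D X m. 0 < D \<and> (\<forall>i<n. X i \<le> D \<and> violation n E C S D X i = 0) \<and>
    steps V solver (\<lambda>_. 0, n # zs, []) (B ^ 8) (m, [], concat (map (\<lambda>i. [X i, D]) [0..<n]))"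
proof -
  have BV: "B \<le> V" by (rule power_le_V[of _ 1]) auto
  have V: "n \<le> V" "T \<le> V" "Q \<le> V" "inp a \<le> V" for a
    using n T Q inp[of a] BV by auto
  from steps_search_loop[OF n0 Dm y, of "\<lambda>_. 0" 0, OF le0 le0]
  obtain D x i j k l a q X where D: "0 < D" "D < B" and x: "x < B"
    and le: "i \<le> V" "j \<le> V" "k \<le> V" "l \<le> V" "a \<le> V" "q \<le> V" and X: "\<forall>i. X i \<le> B"
    and ok: "\<forall>i<n. X i \<le> D \<and> violation n E C S D X i = 0"
    and search: "steps V search_loop (st 1 0 0 0 0 0 0 1 0 (\<lambda>_. 0))
      (B * (B + 1) * (n * (n * (4 * n + 6) + 7) + 4 * n + 10) + 1) (st D x i j k l a 0 q X)"
    by (elim exE conjE)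
  have DV: "D \<le> V" "x \<le> V" "X i \<le> V" for i
    using D x X[rule_format, of i] BV by auto
  obtain m where printing: "steps V write_loop (st D x 0 j k l a 0 q X) (n * 4 + 1)
      (m, [], concat (map (\<lambda>i. [X i, D]) [0..<n]))"
    using steps_write_loop[where X = X, OF DV(1,2) le(2-5) le0 le(6) DV(3)] by (auto simp: xs ys)
  define ar where "ar = (\<lambda>a. if a < 2 * T then zs ! a else 0)"
  have ar: "ar = cells (\<lambda>_. 0)" by (auto simp: ar_def cells_def zs fun_eq_iff)
  have arV: "ar a \<le> V" for a using V(4) zs(2) by (simp add: ar_def)
  have start: "st 1 0 0 0 0 0 0 1 0 (\<lambda>_. 0) = (mem [n, Q, 1, 0, 0, 0, 0, 0, 0, 1, 0, T] ar, [], [])"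
    unfolding st_def ar by (simp add: xs ys)
  note simps = small_expr_def bounded_mem_mem
  have "steps V solver (\<lambda>_. 0, n # zs, [])
    (1 + (1 + (1 + ((T * 5 + 1) + (1 + (1 + (1 +
      ((B * (B + 1) * (n * (n * (4 * n + 6) + 7) + 4 * n + 10) + 1) + (1 + (n * 4 + 1))))))))))
    (m, [], concat (map (\<lambda>i. [X i, D]) [0..<n]))"
    unfolding solver_def
  proof (intro steps_Seq)
    have zero: "mem [0, 0, 0, 0, 0, 0, 0, 0, 0, 0, 0, 0] (\<lambda>_. 0) = (\<lambda>_. 0)"
    proof
      fix r
      have "set [0, 0, 0, 0, 0, 0, 0, 0, 0, 0, 0, 0 :: nat] \<subseteq> {0}" by simp
      then show "mem [0, 0, 0, 0, 0, 0, 0, 0, 0, 0, 0, 0] (\<lambda>_. 0) r = 0"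
        using nth_mem[of r "[0, 0, 0, 0, 0, 0, 0, 0, 0, 0, 0, 0 :: nat]"] unfolding mem_def by auto
    qed
    have "steps V (Read (Const 0)) (mem [0, 0, 0, 0, 0, 0, 0, 0, 0, 0, 0, 0] (\<lambda>_. 0), n # zs, []) 1
        (mem [n, 0, 0, 0, 0, 0, 0, 0, 0, 0, 0, 0] (\<lambda>_. 0), zs, [])"
      by (rule steps_Read[OF _ V13]) (use V in \<open>simp_all add: simps\<close>)
    then show "steps V (Read (Const 0)) (\<lambda>_. 0, n # zs, []) 1
        (mem [n, 0, 0, 0, 0, 0, 0, 0, 0, 0, 0, 0] (\<lambda>_. 0), zs, [])"
      unfolding zero .
    show "steps V (Store (Const 11) (Plus (Plus (reg 0) (Times (reg 0) (reg 0))) (Times (Times (reg 0) (reg 0)) (reg 0))))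
        (mem [n, 0, 0, 0, 0, 0, 0, 0, 0, 0, 0, 0] (\<lambda>_. 0), zs, []) 1
        (mem [n, 0, 0, 0, 0, 0, 0, 0, 0, 0, 0, T] (\<lambda>_. 0), zs, [])"
      by (rule steps_Store[OF _ V13]) (use V in \<open>simp_all add: simps T(1)\<close>)
    show "steps V (Store (Const 1) (Const 1))
        (mem [n, 0, 0, 0, 0, 0, 0, 0, 0, 0, 0, T] (\<lambda>_. 0), zs, []) 1
        (mem [n, 1, 0, 0, 0, 0, 0, 0, 0, 0, 0, T] (\<lambda>_. 0), zs, [])"
      by (rule steps_Store[OF _ V13]) (use V in \<open>simp_all add: simps\<close>)
    have "zs ! a \<le> V" if "a < 2 * T" for a using zs(2)[OF that] V(4) by simp
    moreover have "(\<Prod>v<t. zs ! Suc (2 * v)) \<le> V" if "t \<le> T" for t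
      using Qp(2)[OF that] BV by simp
    ultimately show "steps V read_loop (mem [n, 1, 0, 0, 0, 0, 0, 0, 0, 0, 0, T] (\<lambda>_. 0), zs, []) (T * 5 + 1)
        (mem [n, Q, 0, 0, T, 0, 0, 0, 0, 0, 0, T] ar, [], [])"
      unfolding Qp(1) ar_def using zs(1) V(1,2) V13 by (intro steps_read_loop)
    show "steps V (Store (Const 2) (Const 1)) (mem [n, Q, 0, 0, T, 0, 0, 0, 0, 0, 0, T] ar, [], []) 1
        (mem [n, Q, 1, 0, T, 0, 0, 0, 0, 0, 0, T] ar, [], [])"
      by (rule steps_Store[OF _ V13]) (use V arV in \<open>simp_all add: simps\<close>)
    show "steps V (Store (Const 4) (Const 0)) (mem [n, Q, 1, 0, T, 0, 0, 0, 0, 0, 0, T] ar, [], []) 1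
        (mem [n, Q, 1, 0, 0, 0, 0, 0, 0, 0, 0, T] ar, [], [])"
      by (rule steps_Store[OF _ V13]) (use V V13 arV in \<open>simp_all add: simps\<close>)
    show "steps V (Store (Const 9) (Const 1)) (mem [n, Q, 1, 0, 0, 0, 0, 0, 0, 0, 0, T] ar, [], []) 1
        (st 1 0 0 0 0 0 0 1 0 (\<lambda>_. 0))"
      unfolding start
      by (rule steps_Store[OF _ V13]) (use V V13 arV in \<open>simp_all add: simps\<close>)
    show "steps V (Store (Const 4) (Const 0)) (st D x i j k l a 0 q X) 1 (st D x 0 j k l a 0 q X)"
      unfolding st_def
      by (rule steps_Store[OF bounded_st V13]) (use DV le in \<open>simp_all add: small_expr_def\<close>)
  qed (rule search printing)+
  \<comment> \<open>At most \<open>B * (B + 1)\<close> candidates with at most \<open>B ^ 4\<close>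
    steps each dominate; everything else is absorbed by means of \<open>13 \<le> B\<close>.\<close>
  moreover have "1 + (1 + (1 + ((T * 5 + 1) + (1 + (1 + (1 +
      ((B * (B + 1) * (n * (n * (4 * n + 6) + 7) + 4 * n + 10) + 1) + (1 + (n * 4 + 1))))))))) \<le> B ^ 8"
  proof -
    have B1: "1 \<le> B" using B by simp
    have pow: "B ^ p \<le> B ^ r" if "p \<le> r" for p r using that B1 by (rule power_increasing)
    have mB: "13 * B ^ p \<le> B ^ Suc p" for p using B by simp
    have "n * (n * (4 * n + 6) + 7) + 4 * n + 10 \<le> B * (B * (4 * B + 6) + 7) + 4 * B + 10"
      using n by (intro add_mono mult_le_mono) auto
    also have "\<dots> = 4 * B ^ 3 + 6 * B ^ 2 + 11 * B ^ 1 + 10 * B ^ 0"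
      by (simp add: power3_eq_cube power2_eq_square algebra_simps)
    also have "\<dots> \<le> 13 * B ^ 3"
      using mB[of 0] mB[of 1] mB[of 2] by (simp add: numeral_eq_Suc)
    also have "\<dots> \<le> B ^ 4" using mB[of 3] by (simp add: numeral_eq_Suc)
    finally have "B * (B + 1) * (n * (n * (4 * n + 6) + 7) + 4 * n + 10) \<le> B * (2 * B) * B ^ 4"
      using B1 by (intro mult_le_mono) auto
    also have "\<dots> = 2 * B ^ 6" by (simp add: numeral_eq_Suc algebra_simps)
    finally have "B * (B + 1) * (n * (n * (4 * n + 6) + 7) + 4 * n + 10) \<le> 2 * B ^ 6" .
    moreover have "B ^ 1 \<le> B ^ 6" "B ^ 0 \<le> B ^ 6" by (rule pow; simp)+
    moreover have "13 * B ^ 6 \<le> B ^ 7" "13 * B ^ 7 \<le> B ^ 8"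
      using mB[of 6] mB[of 7] by (simp_all add: numeral_eq_Suc)
    ultimately show ?thesis using T(2) n unfolding power_0 power_one_right by linarith
  qed
  ultimately have "steps V solver (\<lambda>_. 0, n # zs, []) (B ^ 8) (m, [], concat (map (\<lambda>i. [X i, D]) [0..<n]))"
    by (rule steps_mono)
  with D(1) ok show ?thesis by blast
qed

text \<open>\<open>2 ^ (2 * s)\<close> is the bound on the scaled notionals. The base of the power
  is at most 2 to the \<open>4 + 7 * s \<le> 11 * s\<close>, and \<open>fact n\<close> at most
  \<open>2 ^ (s * n)\<close>, so \<open>D\<close> is at most \<open>2 ^ (12 * s * n)\<close>. With
  \<open>n \<le> s\<close> the power \<open>(D + 1) ^ n\<close> is at most
  \<open>2 ^ (13 * s ^ 3)\<close>; 15 leaves room for the added 1 and the strict inequality.\<close>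

lemma denominator_power_bound:
  fixes n s :: nat
  assumes "n \<le> s" "1 \<le> s" and D: "D \<le> fact n * (16 * n * (n * 2 ^ (2 * s))\<^sup>2) ^ n"
  shows "(D + 1) ^ n + 1 < 2 ^ (15 * s ^ 3)"
proof -
  have n2: "n \<le> 2 ^ s" using assms(1) less_exp[of s] by linarith
  have "fact n \<le> n ^ n" using fact_le_power[of n, where 'a = nat] by simp
  also have "\<dots> \<le> (2 ^ s) ^ n" using n2 by (rule power_mono) simp
  finally have f: "fact n \<le> (2 :: nat) ^ (s * n)" by (simp add: power_mult)
  have "16 * n * (n * 2 ^ (2 * s))\<^sup>2 \<le> 2 ^ 4 * 2 ^ s * (2 ^ s * 2 ^ (2 * s))\<^sup>2"
    using n2 by (intro mult_le_mono power_mono) auto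
  also have "\<dots> = 2 ^ (4 + s + (s + 2 * s) * 2)"
    by (simp only: power_add[symmetric] power_mult[symmetric])
  also have "\<dots> \<le> 2 ^ (11 * s)" using assms(2) by (intro power_increasing) auto
  finally have "(16 * n * (n * 2 ^ (2 * s))\<^sup>2) ^ n \<le> (2 ^ (11 * s)) ^ n" by (rule power_mono) simp
  with f have "D \<le> 2 ^ (s * n) * 2 ^ (11 * s * n)"
    using D by (simp only: power_mult) (meson mult_le_mono order.trans)
  also have "\<dots> = 2 ^ (12 * s * n)" by (simp flip: power_add)
  finally have "D + 1 \<le> 2 * 2 ^ (12 * s * n)" using one_le_power[of "2 :: nat" "12 * s * n"] by linarith
  also have "\<dots> = 2 ^ (12 * s * n + 1)" by simp
  also have "\<dots> \<le> 2 ^ (13 * s * s)"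
  proof (rule power_increasing)
    have "12 * s * n \<le> 12 * s * s" "1 \<le> s * s" using assms(1,2) by auto
    then show "12 * s * n + 1 \<le> 13 * s * s" by linarith
  qed simp
  finally have "(D + 1) ^ n \<le> (2 ^ (13 * s * s)) ^ n" by (rule power_mono) simp
  also have "\<dots> = 2 ^ (13 * s * s * n)" by (simp add: power_mult)
  also have "\<dots> \<le> 2 ^ (13 * s ^ 3)"
    using assms(1) by (intro power_increasing) (auto simp: power3_eq_cube)
  finally have "(D + 1) ^ n + 1 \<le> 2 ^ (13 * s ^ 3) + 1" by simp
  also have "\<dots> \<le> 2 * 2 ^ (13 * s ^ 3)" using one_le_power[of "2 :: nat" "13 * s ^ 3"] by linarith
  also have "\<dots> = 2 ^ (13 * s ^ 3 + 1)" by simp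
  also have "\<dots> < 2 ^ (15 * s ^ 3)"
    using one_le_power[OF assms(2), of 3] by (intro power_strict_increasing) auto
  finally show ?thesis .
qed

theorem theorem4:
  shows "\<exists>(P :: prog) (p :: nat poly). \<forall>F :: network.
    financial_network F \<and> nondegenerate F \<and> central_cds_debtor F \<longrightarrow>
    (\<exists>t ys. runs P (encode_network F) t ys \<and>
            t \<le> 2 ^ poly p (input_size (encode_network F)) \<and>
            outputs_clearing F ys)"
proof (intro exI[of _ solver] exI[of _ "monom 330 3"] allI impI)
  fix F :: network
  assume F: "financial_network F \<and> nondegenerate F \<and> central_cds_debtor F"
  define n where "n = banks F"
  define zs where "zs = concat (map encode_rat (network_rats F))"
  define T where "T = n + n * n + n * n * n"
  define s where "s = input_size (encode_network F)"
  define Q where "Q = (\<Prod>v<T. zs ! Suc (2 * v))"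
  define inp where "inp a = (if a < 2 * T then zs ! a else 0)" for a
  \<comment> \<open>The bound of \<open>denominator_power_bound\<close> on the number of codes. It
    is also at least \<open>2 ^ s\<close>, which bounds the input data and \<open>Q\<close>.\<close>
  define B :: nat where "B = 2 ^ (15 * s ^ 3)"
  from F obtain d where d: "d < n"
    and cds_d: "\<And>i j k. i < n \<Longrightarrow> j < n \<Longrightarrow> k < n \<Longrightarrow> cds F i j k \<noteq> 0 \<Longrightarrow> i = d"
    and debt_d: "\<not> debt_debtor F d" and ext_d: "(\<Sum>j<n. \<Sum>k<n. cds F d j k) \<le> ext F d"
    unfolding central_cds_debtor_def n_def by blast
  have ext0: "0 \<le> ext F i" if "i < n" for i
    using F that unfolding financial_network_def n_def by blast
  have debt0: "0 \<le> debt F i j" if "i < n" "j < n" for i j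
    using F that unfolding financial_network_def n_def by blast
  have cds0: "0 \<le> cds F i j k" if "i < n" "j < n" "k < n" for i j k
    using F that unfolding financial_network_def n_def by blast
  have enc: "encode_network F = n # zs" by (simp add: encode_network_eq zs_def n_def)
  have lenr: "length (network_rats F) = T" by (simp add: network_rats_nth(1) T_def n_def)
  have lenz: "length zs = 2 * T" unfolding zs_def by (simp only: concat_encode_rat_nth(3) lenr)
  have "1 + 2 * T \<le> s" using length_le_input_size[of "n # zs"] by (simp add: s_def enc lenz)
  then have s: "1 \<le> s" "T \<le> s" "n \<le> s" by (auto simp: T_def)
  have zs2: "zs ! a \<le> 2 ^ s" if "a < 2 * T" for a
    using le_two_power_input_size[of "zs ! a" "n # zs"] that by (simp add: s_def enc lenz)
  have Q2: "(\<Prod>v<t. zs ! Suc (2 * v)) \<le> 2 ^ s" if "t \<le> T" for t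
  proof -
    have "(\<Prod>v<t. zs ! Suc (2 * v)) \<le> 2 ^ input_size zs"
      using that by (intro prod_odd_positions_le) (simp add: lenz)
    also have "\<dots> \<le> 2 ^ s" by (intro power_increasing) (auto simp: s_def enc input_size_def)
    finally show ?thesis .
  qed
  have s3: "s \<le> 15 * s ^ 3" "15 \<le> 15 * s ^ 3"
    using s(1) self_le_power[of s 3] one_le_power[of s 3] by auto
  have sB: "2 ^ s \<le> B" unfolding B_def using s3 by (intro power_increasing) auto
  have "s < 2 ^ s" by (rule less_exp)
  \<comment> \<open>The search starts after the whole input has been read and before anything is
    written, so both tapes are empty.\<close>
  interpret candidate_check n T Q B "B ^ 10" inp "[]" "[]"
  proof
    show "n \<le> B" "T \<le> B" using s sB \<open>s < 2 ^ s\<close> by linarith+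
    show "Q \<le> B" unfolding Q_def using Q2[of T] sB by simp
    show "inp a \<le> B" for a using zs2[of a] sB by (auto simp: inp_def)
    have "(2 :: nat) ^ 15 \<le> B" unfolding B_def using s3 by (intro power_increasing) auto
    then show "13 \<le> B" by simp
  qed (simp_all add: T_def)
  have entry: "inp (2 * e) = encode_rat (network_rats F ! e) ! 0"
    "inp (Suc (2 * e)) = encode_rat (network_rats F ! e) ! 1" if "e < T" for e
    using concat_encode_rat_nth(1,2)[of e "network_rats F"] that by (simp_all add: inp_def zs_def lenr)
  have Q_inp: "Q = (\<Prod>v<T. inp (Suc (2 * v)))"
    unfolding Q_def by (intro prod.cong) (auto simp: inp_def)
  have Q0: "0 < Q"
    unfolding Q_inp by (intro prod_pos) (auto simp: entry(2) encode_rat_denominator_pos simp del: One_nat_def)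
  have rat: "of_rat q = real (rat_at e) / real Q"
    if e: "e < T" "network_rats F ! e = q" "0 \<le> q" for e q
  proof -
    \<comment> \<open>Divisibility makes the integer division in \<open>rat_at\<close> exact, so
      scaling by \<open>Q\<close> loses nothing.\<close>
    have "inp (Suc (2 * e)) dvd Q"
      unfolding Q_inp using e(1) by (auto intro: dvd_prodI)
    then obtain c where c: "Q = inp (Suc (2 * e)) * c" by auto
    have den0: "0 < inp (Suc (2 * e))"
      unfolding entry(2)[OF e(1)] by (rule encode_rat_denominator_pos)
    have "Q div inp (Suc (2 * e)) = c" using den0 by (subst c) simp
    then have "rat_at e = inp (2 * e) * c" by (simp only: rat_at_def)
    moreover have "of_rat q = real (inp (2 * e)) / real (inp (Suc (2 * e)))"
      using of_rat_eq_encode_rat[OF e(3)] by (simp only: entry[OF e(1)] e(2))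
    moreover have "real Q = real (inp (Suc (2 * e))) * real c" "c \<noteq> 0"
      using Q0 c by (simp_all flip: of_nat_mult)
    ultimately show ?thesis using den0 by simp
  qed
  have E: "of_rat (ext F i) = real (E i) / real Q" if "i < n" for i
    unfolding E_def using that
    by (intro rat ext0) (simp_all add: T_def n_def network_rats_nth)
  have C: "of_rat (debt F i j) = real (C i j) / real Q" if "i < n" "j < n" for i j
    unfolding C_def
  proof (rule rat)
    show "n + (i * n + j) < T" using index_less[OF that] by (simp add: T_def)
    show "network_rats F ! (n + (i * n + j)) = debt F i j"
      using network_rats_nth(3)[of i F j] that by (simp only: n_def)
  qed (rule debt0[OF that])
  have S: "of_rat (cds F i j k) = real (S i j k) / real Q" if "i < n" "j < n" "k < n" for i j k
    unfolding S_def
  proof (rule rat)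
    show "n + n * n + ((i * n + j) * n + k) < T" using index_less3[OF that] by (simp add: T_def)
    show "network_rats F ! (n + n * n + ((i * n + j) * n + k)) = cds F i j k"
      using network_rats_nth(4)[of i F j k] that by (simp only: n_def)
  qed (rule cds0[OF that])
  \<comment> \<open>Numerator and cofactor are each at most \<open>2 ^ s\<close>. Beyond the input
    \<open>inp\<close> is 0, so the bound holds for all \<open>e\<close>.\<close>
  have rat_le: "rat_at e \<le> 2 ^ (2 * s)" for e
  proof -
    have "inp (2 * e) \<le> 2 ^ s" using zs2 by (simp add: inp_def)
    moreover have "Q div inp (Suc (2 * e)) \<le> 2 ^ s"
      using Q2[of T] by (auto simp: Q_def intro: order.trans[OF div_le_dividend])
    ultimately have "rat_at e \<le> 2 ^ s * 2 ^ s" unfolding rat_at_def by (rule mult_le_mono)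
    then show ?thesis by (simp add: mult_2 power_add)
  qed
  have "\<exists>D x. 0 < D \<and> D \<le> fact n * (16 * n * (n * 2 ^ (2 * s))\<^sup>2) ^ n \<and> (\<forall>i<n. x i \<le> D) \<and>
    (\<forall>i<n. violation n E C S D x i = 0)"
  proof (rule small_candidate_without_violation[OF d])
    show "S i j k = 0" if "i < n" "j < n" "k < n" "i \<noteq> d" for i j k
    proof -
      have "cds F i j k = 0" using cds_d[OF that(1-3)] that(4) by blast
      then show ?thesis using S[OF that(1-3)] Q0 by simp
    qed
    show "C d j = 0" if "j < n" for j
    proof -
      have "debt F d j = 0"
        using debt_d debt0[OF d that] that unfolding debt_debtor_def n_def by force
      then show ?thesis using C[OF d that] Q0 by simp
    qed
    have "real (\<Sum>j<n. \<Sum>k<n. S d j k) / real Q = (\<Sum>j<n. \<Sum>k<n. of_rat (cds F d j k))"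
      using d by (simp add: S sum_divide_distrib)
    also have "\<dots> = of_rat (\<Sum>j<n. \<Sum>k<n. cds F d j k)" by (simp add: of_rat_sum)
    also have "\<dots> \<le> (of_rat (ext F d) :: real)" using ext_d by (simp add: of_rat_less_eq)
    also have "\<dots> = real (E d) / real Q" by (rule E[OF d])
    finally have "real (\<Sum>j<n. \<Sum>k<n. S d j k) \<le> real (E d)"
      using Q0 by (simp only: divide_le_cancel)
    then show "(\<Sum>j<n. \<Sum>k<n. S d j k) \<le> E d" by (simp only: of_nat_le_iff)
  qed (simp_all add: C_def S_def rat_le)
  then obtain Dm y where Dm: "0 < Dm" "Dm \<le> fact n * (16 * n * (n * 2 ^ (2 * s))\<^sup>2) ^ n"
    and y: "\<forall>i<n. y i \<le> Dm" "\<forall>i<n. violation n E C S Dm y i = 0"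
    by blast
  have DmB: "(Dm + 1) ^ n + 1 < B"
    unfolding B_def by (rule denominator_power_bound[OF s(3,1) Dm(2)])
  have "\<exists>D X m. 0 < D \<and> (\<forall>i<n. X i \<le> D \<and> violation n E C S D X i = 0) \<and>
    steps (B ^ 10) solver (\<lambda>_. 0, n # zs, []) (B ^ 8) (m, [], concat (map (\<lambda>i. [X i, D]) [0..<n]))"
  proof (rule steps_solver[OF refl refl _ lenz _ _ Q_def _ Dm(1) DmB y])
    show "(\<Prod>v<t. zs ! Suc (2 * v)) \<le> B" if "t \<le> T" for t using Q2[OF that] sB by simp
  qed (use d in \<open>auto simp: inp_def\<close>)
  then obtain D X m where D: "0 < D" and X: "\<forall>i<n. X i \<le> D \<and> violation n E C S D X i = 0"
    and st: "steps (B ^ 10) solver (\<lambda>_. 0, n # zs, []) (B ^ 8) (m, [], concat (map (\<lambda>i. [X i, D]) [0..<n]))"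
    by blast
  define ys where "ys = concat (map (\<lambda>i. [X i, D]) [0..<n])"
  from st obtain t where t: "t \<le> B ^ 8 * (20001 * bit_length (B ^ 10))"
    and ex: "exec solver (\<lambda>_. 0, n # zs, []) t (m, [], ys)"
    unfolding steps_def ys_def by blast
  \<comment> \<open>\<open>B ^ 8\<close> steps, \<open>B ^ 4\<close> for the factor 20001 and
    \<open>B ^ 10\<close> for the length of the memory bound give \<open>B ^ 22\<close>; with
    \<open>B = 2 ^ (15 * s ^ 3)\<close> this is the coefficient \<open>22 * 15 = 330\<close> of the
    polynomial.\<close>
  have "t \<le> 2 ^ (330 * s ^ 3)"
  proof -
    have "13 ^ 4 \<le> B ^ 4" using B by (rule power_mono) simp
    then have "20001 \<le> B ^ 4" by simp
    moreover have "bit_length (B ^ 10) \<le> B ^ 10"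
      using B less_exp by (intro bit_length_le) auto
    ultimately have "B ^ 8 * (20001 * bit_length (B ^ 10)) \<le> B ^ 8 * (B ^ 4 * B ^ 10)"
      by (intro mult_le_mono) auto
    also have "\<dots> = B ^ 22" by (simp flip: power_add)
    also have "\<dots> = 2 ^ (330 * s ^ 3)" by (simp add: B_def flip: power_mult)
    finally show ?thesis using t by simp
  qed
  moreover have "runs solver (encode_network F) t ys"
    unfolding runs_def enc using ex by blast
  moreover have "outputs_clearing F ys"
  proof -
    have len: "length ys = 2 * n"
      unfolding ys_def by (subst length_concat_uniform[of _ _ 2]) simp_all
    have nth: "ys ! (2 * i) = X i" "ys ! (2 * i + 1) = D" if "i < n" for i
      using nth_concat_uniform[of n "\<lambda>i. [X i, D]" 2 i 0] nth_concat_uniform[of n "\<lambda>i. [X i, D]" 2 i 1] that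
      by (simp_all add: ys_def mult.commute[of i])
    have "clearing F (\<lambda>i. real (ys ! (2 * i)) / real (ys ! (2 * i + 1)))"
      by (rule clearing_if_no_violation[where x = X, OF n_def Q0 D _ E C S]) (use X nth in auto)
    then show ?thesis
      unfolding outputs_clearing_def n_def[symmetric] using len nth(2) D by simp
  qed
  ultimately show "\<exists>t ys. runs solver (encode_network F) t ys \<and>
            t \<le> 2 ^ poly (monom 330 3) (input_size (encode_network F)) \<and> outputs_clearing F ys"
    by (auto simp: poly_monom s_def)
qed

end
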